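(* Let $\chi,\mu$ be probability measures on $\mathbb{R}$ and $\ddot\mu$ a symmetrization of $\mu$. Suppose that $\chi$ is absolutely continuous with density $f_\chi$ and that the density $f_{\chi*\ddot\mu}$ of $\chi*\ddot\mu$ is continuous. Let $\iota$ be an absolutely continuous probability measure on $\mathbb{R}$ with $f_\iota(\xi)=\mathcal{O}(\xi^{-2})$ as $\xi\to\pm\infty$ and $\Phi_\iota\in L^1(\mathbb{R})$, such that $\Phi_\iota$ is continuously differentiable for $|t|>0$ and there exists $a>2$ with $\Phi_\iota'(t)=\mathcal{O}(|t|^{-a})$ as $t\to\pm\infty$. Suppose there exists $T_{\ddot\mu}>0$ with $\Phi_{\ddot\mu}(t)=0$ for all $|t|>T_{\ddot\mu}$. Suppose further that there exist $T_0\ge0$, a finite complex Borel measure $\kappa$ on $\mathbb{R}$ with $|\kappa|(\mathbb{R})=|\kappa|(D_\kappa)$, and a continuous function of bounded variation $\varphi_\chi:[T_0,\infty]\to\mathbb{C}$ with $\lim_{t\to\infty}\varphi_\chi(t)=0$, such that $\Phi_\chi(t)=\Phi_\kappa(t)\varphi_\chi(t)$ for all $t\ge T_0$. Define $$\theta(t):=\frac1{2\pi}\Phi_\chi(t)\,\mathbf{1}_{[-T_{\ddot\mu},T_{\ddot\mu}]\cap\mathcal{N}_\mu}(t).$$ Then, for every $\xi\in\mathbb{R}$ with $\Delta(\{\xi\},D_\kappa)>0$, $$\lim_{m\to\infty}\mathfrak{d}(\xi,m)=\frac{f_\chi(\xi+)+f_\chi(\xi-)}{2}-\mathcal{F}\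{\theta\}(-\xi)-\mathcal{F}\{\psi_{T_{\ddot\mu},0}\}(-\xi).$$
   Context: Measures are finite signed or complex Borel measures on $\mathbb{R}$. $F_\nu(\xi) := \nu((-\infty,\xi])$, $\Phi_\nu(t) := \int e^{itx}\,\nu(dx)$, $D_\nu:=\{x\in\mathbb{R}:\nu(\{x\})\ne0\}$, $|\nu|$ is the total variation measure, and $\mathcal{N}_\nu := \{t \in \mathbb{R}\cup\{\pm\infty\} : \Phi_\nu(t)=0\}$, where $\pm\infty \in \mathcal{N}_\nu$ means $\lim_{t\to\pm\infty}\Phi_\nu(t)=0$. $f_\nu$ is the Lebesgue density of an absolutely continuous $\nu$; $Q(\xi\pm)$ are one-sided limits. $\Delta(A,B):=\inf_{(a,b)\in A\times B}|a-b|$. $\nu^{*0}:=\delta_{\{0\}}$, $\nu^{*k} := \nu * \nu^{*(k-1)}$, and $F_\nu^{*k}$ is the distribution function of $\nu^{*k}$. A symmetrization of $\mu$ is a probability measure $\ddot\mu = \mu*\eta$, with $\eta$ a probability measure, such that $F_{\ddot\mu}(\xi-)=1-F_{\ddot\mu}(-\xi)$ for all $\xi$, $\Phi_{\ddot\mu}=\Phi_\mu\Phi_\eta$ is even with $0\le\Phi_{\ddot\mu}\le1$, and $\mathcal{N}_{\ddot\mu}=\mathcal{N}_\mu$. Put $\pi_{\ddot\mu} := \delta_{\{0\}} - \ddot\mu$, $\mathfrak{K}_{\ddot\mu}(\xi,m) := \sum_{\ell=0}^m F_{\pi_{\ddot\mu}}^{*\ell}(\xi)$. The deconvolution density is $\mathfrak{d}(\xi,m)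 := \int_{-\infty}^\infty f_{\chi*\ddot\mu}(\xi-x)\,\mathfrak{K}_{\ddot\mu}(dx,m)$, for $(\xi,m)\in\mathbb{R}\times\mathbb{N}_0$. $\mathcal{F}\{q\}(t) := \int_{-\infty}^\infty e^{itx}q(x)\,dx$. For $\tau\ge0$ and $\xi$ with $\Delta(\{\xi\},D_\kappa)>0$, $\mathcal{F}\{\psi_{\tau,0}\}(-\xi)$ denotes $$\mathcal{F}\{\psi_{\tau,0}\}(-\xi)=\mathbf{1}_{\{\tau<T_0\}}\,\mathcal{F}\{\psi_\tau\}(-\xi)+\operatorname{Re}\theta_\tau(-\xi),\qquad \psi_\tau(t):=\frac1{2\pi}\mathbf{1}_{\{\tau\le|t|\le T_0\}}\Phi_\chi(t),$$ $$\theta_\tau(-\xi):=\int_{-\infty}^\infty\int_{\max\{T_0,\tau\}}^\infty\frac{e^{i(x-\xi)\max\{T_0,\tau\}}-e^{i(x-\xi)u}}{i\pi(x-\xi)}\,\varphi_\chi(du)\,\kappa(dx);$$ it is the value of $\lim_{\delta\downarrow0}\frac1{2\pi}\int_{|t|\ge\tau}e^{-i\xi t}\Phi_\iota(\delta t)\Phi_\chi(t)\,dt$. *)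

theory Defs
  imports "HOL-Probability.Probability" "HOL-Library.Landau_Symbols"
begin

section \<open>Complex Borel measures on the real line\<close>

text \<open>
  A finite complex (or signed) Borel measure is a countably additive set function on the Borel sets.
  As for the library's \<^const>\<open>measure\<close>, its value on other sets is 0; this makes equality
  of set functions the equality of measures. Countable additivity for the constantly empty family
  gives \<open>\<nu> {} = 0\<close>.
\<close>

definition complex_measure :: "(real set \<Rightarrow> complex) \<Rightarrow> bool" where
  "complex_measure \<nu> \<longleftrightarrow>
     (\<forall>A. A \<notin> sets borel \<longrightarrow> \<nu> A = 0) \<and>
     (\<forall>A :: nat \<Rightarrow> real set. range A \<subseteq> sets borel \<longrightarrow> disjoint_family A \<longrightarrow>
        (\<lambda>n. \<nu> (A n)) sums \<nu> (\<Union>n. A n))"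

definition of_measure :: "real measure \<Rightarrow> real set \<Rightarrow> complex" where
  "of_measure M A = complex_of_real (measure M A)"

text \<open>
  Jordan decomposition: the positive part of a signed measure \<open>\<sigma>\<close> is
  \<open>\<sigma>\<^sup>+(A) = sup {\<sigma>(B) | B \<subseteq> A Borel}\<close> and the negative part is that of \<open>-\<sigma>\<close>.
  Since \<^const>\<open>ennreal\<close> truncates at 0 and \<open>\<sigma> {} = 0\<close>, truncation does not change the supremum.
\<close>

definition positive_part :: "(real set \<Rightarrow> real) \<Rightarrow> real measure" where
  "positive_part \<sigma> = measure_of UNIV (sets borel)
     (\<lambda>A. SUP B\<in>{B \<in> sets borel. B \<subseteq> A}. ennreal (\<sigma> B))"

definition signed_integral :: "(real set \<Rightarrow> real) \<Rightarrow> (real \<Rightarrow> complex) \<Rightarrow> complex" where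
  "signed_integral \<sigma> f =
     (\<integral>x. f x \<partial>positive_part \<sigma>) - (\<integral>x. f x \<partial>positive_part (\<lambda>A. - \<sigma> A))"

definition complex_integral :: "(real set \<Rightarrow> complex) \<Rightarrow> (real \<Rightarrow> complex) \<Rightarrow> complex" where
  "complex_integral \<nu> f =
     signed_integral (\<lambda>A. Re (\<nu> A)) f + \<i> * signed_integral (\<lambda>A. Im (\<nu> A)) f"

definition total_variation :: "(real set \<Rightarrow> complex) \<Rightarrow> real set \<Rightarrow> ennreal" where
  "total_variation \<nu> A =
     (SUP E\<in>{E :: nat \<Rightarrow> real set. range E \<subseteq> sets borel \<and> disjoint_family E \<and> (\<Union>n. E n) = A}.
        \<Sum>n. ennreal (norm (\<nu> (E n))))"

definition atoms :: "(real set \<Rightarrow> complex) \<Rightarrow> real set" where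
  "atoms \<nu> = {x. \<nu> {x} \<noteq> 0}"

definition complex_cdf :: "(real set \<Rightarrow> complex) \<Rightarrow> real \<Rightarrow> complex" where
  "complex_cdf \<nu> \<xi> = \<nu> {..\<xi>}"

definition complex_char :: "(real set \<Rightarrow> complex) \<Rightarrow> real \<Rightarrow> complex" where
  "complex_char \<nu> t = complex_integral \<nu> (\<lambda>x. iexp (t * x))"

definition complex_convolution ::
    "(real set \<Rightarrow> complex) \<Rightarrow> (real set \<Rightarrow> complex) \<Rightarrow> real set \<Rightarrow> complex" where
  "complex_convolution \<nu> \<rho> A =
     (if A \<in> sets borel
      then complex_integral \<nu> (\<lambda>x. complex_integral \<rho> (\<lambda>y. indicator A (x + y)))
      else 0)"

fun convolution_power :: "(real set \<Rightarrow> complex) \<Rightarrow> nat \<Rightarrow> real set \<Rightarrow> complex" where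
  "convolution_power \<nu> 0 = of_measure (return borel 0)"
| "convolution_power \<nu> (Suc k) = complex_convolution \<nu> (convolution_power \<nu> k)"

text \<open>
  The measure \<open>G(dx)\<close> of a right-continuous function \<open>G\<close> of bounded variation on the real line.
  It is unique, because the half-open intervals generate the Borel sets.
\<close>

definition stieltjes_measure :: "(real \<Rightarrow> complex) \<Rightarrow> real set \<Rightarrow> complex" where
  "stieltjes_measure G =
     (THE \<nu>. complex_measure \<nu> \<and> (\<forall>a b. a \<le> b \<longrightarrow> \<nu> {a<..b} = G b - G a))"

definition stieltjes_integral :: "(real \<Rightarrow> complex) \<Rightarrow> (real \<Rightarrow> complex) \<Rightarrow> complex" where
  "stieltjes_integral G f = complex_integral (stieltjes_measure G) f"

definition bounded_variation_on :: "('a::linorder \<Rightarrow> complex) \<Rightarrow> 'a set \<Rightarrow> bool" where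
  "bounded_variation_on f S \<longleftrightarrow>
     (\<exists>M. \<forall>xs. sorted xs \<and> set xs \<subseteq> S \<longrightarrow>
        (\<Sum>i<length xs - 1. norm (f (xs ! Suc i) - f (xs ! i))) \<le> M)"


section \<open>Densities, zeros of characteristic functions, symmetrization\<close>

definition has_density :: "real measure \<Rightarrow> (real \<Rightarrow> real) \<Rightarrow> bool" where
  "has_density M f \<longleftrightarrow>
     f \<in> borel_measurable borel \<and> (AE x in lborel. 0 \<le> f x) \<and>
     M = density lborel (\<lambda>x. ennreal (f x))"

definition char_zeros :: "real measure \<Rightarrow> ereal set" where
  "char_zeros M =
     {ereal t | t. char M t = 0} \<union>
     {x. x = \<infinity> \<and> (char M \<longlongrightarrow> 0) at_top} \<union>
     {x. x = -\<infinity> \<and> (char M \<longlongrightarrow> 0) at_bot}"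

definition symmetrization :: "real measure \<Rightarrow> real measure \<Rightarrow> bool" where
  "symmetrization \<mu> \<mu>s \<longleftrightarrow>
     (\<exists>\<eta>. real_distribution \<eta> \<and> \<mu>s = (\<mu> \<star> \<eta>)) \<and>
     (\<forall>\<xi>. (cdf \<mu>s \<longlongrightarrow> 1 - cdf \<mu>s (- \<xi>)) (at_left \<xi>)) \<and>
     (\<forall>t. char \<mu>s (- t) = char \<mu>s t) \<and>
     (\<forall>t. char \<mu>s t \<in> \<real> \<and> 0 \<le> Re (char \<mu>s t) \<and> Re (char \<mu>s t) \<le> 1) \<and>
     char_zeros \<mu>s = char_zeros \<mu>"

text \<open>
  The infimum is taken in the extended reals, so that the distance to the empty set is \<open>\<infinity>\<close>
  (the library's \<^const>\<open>setdist\<close> would give 0).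
\<close>

definition gap :: "real set \<Rightarrow> real set \<Rightarrow> ereal" where
  "gap A B = (INF (a, b)\<in>A \<times> B. ereal \<bar>a - b\<bar>)"


section \<open>The deconvolution density\<close>

definition complementary_measure :: "real measure \<Rightarrow> real set \<Rightarrow> complex" where
  "complementary_measure \<mu>s A = of_measure (return borel 0) A - of_measure \<mu>s A"

definition deconv_kernel :: "real measure \<Rightarrow> real \<Rightarrow> nat \<Rightarrow> complex" where
  "deconv_kernel \<mu>s \<xi> m =
     (\<Sum>l=0..m. complex_cdf (convolution_power (complementary_measure \<mu>s) l) \<xi>)"

text \<open>Here \<open>g\<close> stands for the density of the convolution of \<open>chi\<close> with the symmetrization.\<close>

definition deconv_density :: "(real \<Rightarrow> real) \<Rightarrow> real measure \<Rightarrow> real \<Rightarrow> nat \<Rightarrow> complex" where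
  "deconv_density g \<mu>s \<xi> m =
     stieltjes_integral (\<lambda>x. deconv_kernel \<mu>s x m) (\<lambda>x. complex_of_real (g (\<xi> - x)))"


section \<open>Fourier transforms in the limit formula\<close>

definition fourier :: "(real \<Rightarrow> complex) \<Rightarrow> real \<Rightarrow> complex" where
  "fourier q t = (CLINT x|lborel. iexp (t * x) * q x)"

definition theta_zeros :: "real measure \<Rightarrow> real measure \<Rightarrow> real \<Rightarrow> real \<Rightarrow> complex" where
  "theta_zeros chi \<mu> T t =
     1 / (2 * of_real pi) * char chi t * indicator {s. s \<in> {-T..T} \<and> ereal s \<in> char_zeros \<mu>} t"

definition psi :: "real measure \<Rightarrow> real \<Rightarrow> real \<Rightarrow> real \<Rightarrow> complex" where
  "psi chi T0 \<tau> t =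
     1 / (2 * of_real pi) * indicator {s. \<tau> \<le> \<bar>s\<bar> \<and> \<bar>s\<bar> \<le> T0} t * char chi t"

text \<open>
  The value at \<open>s = -\<xi>\<close> is the one in the limit formula. The function \<open>\<phi>\<close> lives on
  \<open>[T0, \<infinity>]\<close>. Its Stieltjes measure on the real line is that of its constant extension to the
  left of \<open>T0\<close>, and there is no mass at \<open>\<infinity>\<close> since \<open>\<phi>\<close> is continuous there.
  The quotient is 0 for \<open>x = -s\<close>, that is \<open>x = \<xi>\<close>, which is a \<open>\<kappa>\<close>-null set
  if \<open>\<xi>\<close> is not an atom.
\<close>

definition theta_tail ::
    "real \<Rightarrow> (ereal \<Rightarrow> complex) \<Rightarrow> (real set \<Rightarrow> complex) \<Rightarrow> real \<Rightarrow> real \<Rightarrow> complex" where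
  "theta_tail T0 \<phi> \<kappa> \<tau> s =
     complex_integral \<kappa> (\<lambda>x.
       stieltjes_integral (\<lambda>u. \<phi> (ereal (max T0 u))) (\<lambda>u.
         indicator {max T0 \<tau>..} u *
         ((iexp ((x + s) * max T0 \<tau>) - iexp ((x + s) * u)) / (\<i> * of_real (pi * (x + s))))))"

text \<open>
  Despite its notation, the transform of \<open>\<psi>\<^sub>\<tau>\<^sub>,\<^sub>0\<close> is not the integral of a function of
  that name, but the following expression.
\<close>

definition fourier_psi0 ::
    "real measure \<Rightarrow> real \<Rightarrow> (ereal \<Rightarrow> complex) \<Rightarrow> (real set \<Rightarrow> complex) \<Rightarrow> real \<Rightarrow> real \<Rightarrow> complex" where
  "fourier_psi0 chi T0 \<phi> \<kappa> \<tau> s =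
     (if \<tau> < T0 then fourier (psi chi T0 \<tau>) s else 0)
     + complex_of_real (Re (theta_tail T0 \<phi> \<kappa> \<tau> s))"

end

theory Submission
  imports Defs
begin

text \<open>
  Write \<open>P\<close> for the characteristic function of the symmetrization; its values lie in \<open>[0, 1]\<close> and it
  vanishes outside \<open>[-T, T]\<close>. Let \<open>I\<^sub>R(\<xi>)\<close> be the integral of \<open>exp (- \<i> \<xi> t) \<Phi>(t) / (2 \<pi>)\<close> over
  \<open>\<bar>t\<bar> \<le> R\<close>, where \<open>\<Phi>\<close> is the characteristic function of \<open>chi\<close>.

  The continuous density of \<open>chi \<star> \<mu>s\<close> is the inverse Fourier integral of \<open>\<Phi> P\<close>, and the Stieltjes measure
  of the deconvolution kernel has the characteristic function \<open>\<Sum>l\<le>m. (1 - P)\<^sup>l\<close>. By Fubini and the geometric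
  sum, the deconvolution density is therefore the inverse Fourier integral of \<open>\<Phi> (1 - (1 - P)\<^sup>m\<^sup>+\<^sup>1)\<close> over
  \<open>[-T, T]\<close> (\<open>deconv_density_eq_inversion_integral\<close>). The power tends to 0 where \<open>P > 0\<close> and
  is 1 where \<open>P = 0\<close>, so that by dominated convergence the limit is \<open>I\<^sub>T(\<xi>)\<close> minus the transform of
  \<open>theta_zeros\<close> (\<open>deconv_density_tendsto\<close>).

  What remains is a pointwise inversion theorem for \<open>chi\<close>: the one-sided limits of its density at
  \<open>\<xi>\<close> equal \<open>lim I\<^sub>R(\<xi>)\<close>, and this limit is \<open>I\<^sub>T(\<xi>)\<close> plus the transform of \<open>\<psi>\<^sub>T\<^sub>,\<^sub>0\<close>. For \<open>t\<close>
  beyond \<open>M = max T0 T\<close> the function \<open>\<Phi>\<close> is the product of the characteristic function of \<open>\<kappa>\<close> and of \<open>\<phi>\<close>, and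
  \<open>\<phi>(t)\<close> is minus the mass that its Stieltjes measure puts on \<open>(t, \<infinity>)\<close>. Exchanging the integrals
  turns the part of \<open>I\<^sub>R(\<xi>)\<close> over \<open>M \<le> \<bar>t\<bar> \<le> R\<close> into the real part of a double integral of
  \<open>(exp (\<i> y M) - exp (\<i> y min u R)) / (\<i> \<pi> y)\<close>, where \<open>y = x - \<xi>\<close>, against \<open>\<phi>(du)\<close> and \<open>\<kappa>(dx)\<close>. Since \<open>\<kappa>\<close> lives
  on its atoms, \<open>\<bar>y\<bar>\<close> is at least the distance \<open>d\<close> from \<open>\<xi>\<close> to the atoms. Replacing \<open>min u R\<close> by \<open>u\<close>
  thus costs at most \<open>2 / (\<pi> d)\<close> times the total variation of \<open>\<kappa>\<close> times the variation of \<open>\<phi>\<close> beyond \<open>R\<close>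
  (\<open>fourier_tail_estimate\<close>).

  This error is locally uniform in \<open>\<xi>\<close>. So, off the closure of the atoms, the integrals \<open>I\<^sub>R\<close> converge
  locally uniformly to a continuous function \<open>L\<close>. Integrating \<open>I\<^sub>R\<close> over an interval gives the expression
  in the inversion formula of Levy, and hence \<open>L\<close> is a density of \<open>chi\<close> there
  (\<open>density_eq_inversion_limit\<close>). Changing the density on a null set to \<open>L\<close> yields the version with
  one-sided limits, and any one-sided limits of any density at \<open>\<xi>\<close> have the value \<open>L(\<xi>)\<close>.

  Complex measures are reduced to positive ones by the fact that each of them has an integrable density
  with respect to a finite measure (\<open>complex_measure_has_density\<close>); integrals against it,
  convolutions and characteristic functions then become Bochner integrals.
\<close>

section \<open>Sums and domination of finite measures\<close>

lemma sum_of_finite_measures: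
  fixes M N :: "real measure"
  assumes "finite_measure M" "finite_measure N" and [measurable_cong, simp]: "sets M = sets borel" "sets N = sets borel"
  obtains S where "finite_measure S" "sets S = sets borel"
    "\<And>A. A \<in> sets borel \<Longrightarrow> emeasure S A = emeasure M A + emeasure N A"
proof -
  define S where "S = measure_of UNIV (sets borel) (\<lambda>A. emeasure M A + emeasure N A)"
  have sets_S: "sets S = sets borel"
    unfolding S_def using sets.sigma_sets_eq[of borel] by (subst sets_measure_of) auto
  have em: "emeasure S A = emeasure M A + emeasure N A" if "A \<in> sets borel" for A
  proof (rule emeasure_measure_of[OF S_def])
    show "positive (sets S) (\<lambda>A. emeasure M A + emeasure N A)"
      by (simp add: positive_def)
    show "countably_additive (sets S) (\<lambda>A. emeasure M A + emeasure N A)"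
    proof (rule countably_additiveI)
      fix A :: "nat \<Rightarrow> real set" assume "range A \<subseteq> sets S" "disjoint_family A"
      then show "(\<Sum>i. emeasure M (A i) + emeasure N (A i)) = emeasure M (\<Union>i. A i) + emeasure N (\<Union>i. A i)"
        by (subst suminf_add[symmetric]) (auto simp: sets_S suminf_emeasure)
    qed
  qed (use that sets_S in auto)
  interpret M: finite_measure M by fact
  interpret N: finite_measure N by fact
  have "finite_measure S"
    by (rule finite_measureI) (use em[of UNIV] sets_eq_imp_space_eq[OF sets_S] in simp)
  then show ?thesis using em sets_S by (intro that[of S]) auto
qed

text \<open>
  The Radon-Nikodym derivative may be taken finite and real, because it is integrable.
\<close>

lemma dominated_measure_density:
  fixes M S :: "real measure"
  assumes "finite_measure M" "finite_measure S" "sets M = sets borel" "sets S = sets borel"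
    and le: "\<And>A. A \<in> sets borel \<Longrightarrow> emeasure M A \<le> emeasure S A"
  obtains d :: "real \<Rightarrow> real" where "integrable S d" "\<And>x. 0 \<le> d x" "M = density S d"
proof -
  interpret M: finite_measure M by fact
  interpret S: finite_measure S by fact
  have "absolutely_continuous S M"
    unfolding absolutely_continuous_def using le assms(3,4)
    by (auto simp: null_sets_def) (metis le_zero_eq)
  then have "\<exists>f\<in>borel_measurable S. density S f = M"
    using S.Radon_Nikodym[of M] assms by simp
  then obtain f where f[measurable]: "f \<in> borel_measurable S" and df: "density S f = M" by blast
  have fin: "(\<integral>\<^sup>+x. f x \<partial>S) \<noteq> \<infinity>"
  proof -
    have "emeasure M (space S) = (\<integral>\<^sup>+x. f x \<partial>S)"
      unfolding df[symmetric] by (subst emeasure_density) (auto intro!: nn_integral_cong)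
    then show ?thesis using M.emeasure_finite by auto
  qed
  then have AEf: "AE x in S. f x \<noteq> \<infinity>" by (intro nn_integral_PInf_AE) auto
  have eq: "M = density S (\<lambda>x. ennreal (enn2real (f x)))"
    unfolding df[symmetric] using AEf by (intro density_cong) (auto elim!: eventually_mono simp: top.not_eq_extremum)
  have int: "integrable S (\<lambda>x. enn2real (f x))"
  proof (rule integrableI_nonneg)
    have "(\<integral>\<^sup>+x. ennreal (enn2real (f x)) \<partial>S) = (\<integral>\<^sup>+x. f x \<partial>S)"
      using AEf by (intro nn_integral_cong_AE) (auto elim!: eventually_mono simp: top.not_eq_extremum)
    then show "(\<integral>\<^sup>+x. ennreal (enn2real (f x)) \<partial>S) < \<infinity>" using fin by (simp add: top.not_eq_extremum)
  qed auto
  show ?thesis using that[OF int _ eq] by simp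
qed

section \<open>Integrals against complex measures given by densities\<close>

text \<open>
  The supremum over \<open>B \<subseteq> A\<close> of the integrals of \<open>s\<close> is attained at \<open>B = A \<inter> {s > 0}\<close>. The function
  \<^const>\<open>ennreal\<close> cuts off the negative values of \<open>s\<close>, so the right-hand side is the density \<open>max 0 s\<close>.
\<close>

lemma positive_part_density:
  fixes s :: "real \<Rightarrow> real"
  assumes [measurable_cong, simp]: "sets S = sets borel" and s: "integrable S s"
    and \<sigma>: "\<And>A. A \<in> sets borel \<Longrightarrow> \<sigma> A = (\<integral>x. indicator A x * s x \<partial>S)"
  shows "positive_part \<sigma> = density S (\<lambda>x. ennreal (s x))"
proof -
  have [measurable]: "s \<in> borel_measurable borel"
    using borel_measurable_integrable[OF s] measurable_cong_sets[OF assms(1) refl] by blast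
  have [simp]: "space S = UNIV" using sets_eq_imp_space_eq[OF assms(1)] by simp
  let ?D = "density S (\<lambda>x. ennreal (s x))"
  have eq: "(SUP B\<in>{B \<in> sets borel. B \<subseteq> A}. ennreal (\<sigma> B)) = emeasure ?D A" if A[measurable]: "A \<in> sets borel" for A
  proof (rule antisym)
    have val: "(\<integral>\<^sup>+x. ennreal (s x) * indicator A x \<partial>S) = ennreal (\<sigma> (A \<inter> {x. 0 < s x}))"
    proof -
      have "\<sigma> (A \<inter> {x. 0 < s x}) = (\<integral>x. indicator (A \<inter> {x. 0 < s x}) x * s x \<partial>S)"
        by (rule \<sigma>) measurable
      also have "ennreal \<dots> = (\<integral>\<^sup>+x. ennreal (indicator (A \<inter> {x. 0 < s x}) x * s x) \<partial>S)"
      proof (rule nn_integral_eq_integral[symmetric])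
        show "integrable S (\<lambda>x. indicator (A \<inter> {x. 0 < s x}) x * s x)"
          using integrable_real_mult_indicator[OF _ s, of "A \<inter> {x. 0 < s x}"] by (simp add: mult.commute)
      qed (auto simp: indicator_def)
      also have "\<dots> = (\<integral>\<^sup>+x. ennreal (s x) * indicator A x \<partial>S)"
        by (intro nn_integral_cong) (auto simp: indicator_def ennreal_neg)
      finally show ?thesis by simp
    qed
    show "(SUP B\<in>{B \<in> sets borel. B \<subseteq> A}. ennreal (\<sigma> B)) \<le> emeasure ?D A"
    proof (rule SUP_least, clarsimp)
      fix B assume B[measurable]: "B \<in> sets borel" and "B \<subseteq> A"
      have "integrable S (\<lambda>x. indicator B x * s x)"
        using integrable_real_mult_indicator[OF _ s, of B] by (simp add: mult.commute)
      then have "ennreal (\<sigma> B) \<le> ennreal (\<integral>x. max 0 (indicator B x * s x) \<partial>S)"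
        unfolding \<sigma>[OF B] by (intro ennreal_leI integral_mono) auto
      also have "\<dots> = (\<integral>\<^sup>+x. ennreal (max 0 (indicator B x * s x)) \<partial>S)"
        using \<open>integrable S (\<lambda>x. indicator B x * s x)\<close> by (intro nn_integral_eq_integral[symmetric]) auto
      also have "\<dots> \<le> (\<integral>\<^sup>+x. ennreal (s x) * indicator A x \<partial>S)"
        using \<open>B \<subseteq> A\<close> by (intro nn_integral_mono) (auto simp: indicator_def)
      finally show "ennreal (\<sigma> B) \<le> emeasure ?D A" by (subst emeasure_density) auto
    qed
    show "emeasure ?D A \<le> (SUP B\<in>{B \<in> sets borel. B \<subseteq> A}. ennreal (\<sigma> B))"
      by (subst emeasure_density) (auto simp: val intro!: SUP_upper2[of "A \<inter> {x. 0 < s x}"])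
  qed
  have "positive_part \<sigma> = measure_of UNIV (sets borel) (emeasure ?D)"
    unfolding positive_part_def
    by (rule measure_of_eq) (auto simp: eq sets.sigma_sets_eq[of borel, simplified])
  also have "\<dots> = ?D"
    using measure_of_of_measure[of ?D] by simp
  finally show ?thesis .
qed

text \<open>
  The difference need not be the Jordan decomposition. Both measures have densities \<open>p\<close>, \<open>q\<close> with respect to
  their sum, the Jordan parts have the densities \<open>max 0 (p - q)\<close> and \<open>max 0 (q - p)\<close>, and the difference
  of the two is \<open>p - q\<close> again.
\<close>

lemma signed_integral_diff:
  fixes f :: "real \<Rightarrow> complex"
  assumes fin: "finite_measure M" "finite_measure N" and sets: "sets M = sets borel" "sets N = sets borel"
    and \<sigma>: "\<And>A. A \<in> sets borel \<Longrightarrow> \<sigma> A = measure M A - measure N A"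
    and f: "integrable M f" "integrable N f"
  shows "signed_integral \<sigma> f = (\<integral>x. f x \<partial>M) - (\<integral>x. f x \<partial>N)"
proof -
  obtain S where S: "finite_measure S" "sets S = sets borel"
    and em: "\<And>A. A \<in> sets borel \<Longrightarrow> emeasure S A = emeasure M A + emeasure N A"
    using sum_of_finite_measures[OF fin sets] by metis
  obtain p where p: "integrable S p" "\<And>x. 0 \<le> p x" "M = density S p"
    using dominated_measure_density[OF fin(1) S(1) sets(1) S(2)] em by auto
  obtain q where q: "integrable S q" "\<And>x. 0 \<le> q x" "N = density S q"
    using dominated_measure_density[OF fin(2) S(1) sets(2) S(2)] em by auto
  have [measurable]: "f \<in> borel_measurable S" "f \<in> borel_measurable borel"
    using borel_measurable_integrable[OF f(1)] measurable_cong_sets[OF sets(1) refl]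
      measurable_cong_sets[OF S(2) refl] by blast+
  have [measurable]: "p \<in> borel_measurable S" "q \<in> borel_measurable S"
    using p(1) q(1) by auto
  note [measurable_cong] = S(2)
  have meas: "measure (density S d) A = (\<integral>x. indicator A x * d x \<partial>S)"
    if d: "integrable S d" "\<And>x. 0 \<le> d x" and A: "A \<in> sets borel" for d A
  proof -
    have [measurable]: "A \<in> sets S" "d \<in> borel_measurable S" using A S(2) d(1) by auto
    have "integrable S (\<lambda>x. indicator A x * d x)"
      using integrable_real_mult_indicator[OF \<open>A \<in> sets S\<close> d(1)] by (simp add: mult.commute)
    then have "emeasure (density S d) A = ennreal (\<integral>x. indicator A x * d x \<partial>S)"
      using d(2) by (subst emeasure_density, simp, simp, subst nn_integral_eq_integral[symmetric])
        (auto intro!: nn_integral_cong simp: indicator_def)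
    then show ?thesis using d(2) by (simp add: measure_def)
  qed
  have \<sigma>': "\<sigma> A = (\<integral>x. indicator A x * (p x - q x) \<partial>S)" if A: "A \<in> sets borel" for A
  proof -
    have "\<sigma> A = measure (density S p) A - measure (density S q) A"
      using \<sigma>[OF A] p(3) q(3) by simp
    also have "\<dots> = (\<integral>x. indicator A x * p x \<partial>S) - (\<integral>x. indicator A x * q x \<partial>S)"
      using meas p q A by simp
    also have "\<dots> = (\<integral>x. indicator A x * (p x - q x) \<partial>S)"
      using integrable_real_mult_indicator[OF _ p(1), of A] integrable_real_mult_indicator[OF _ q(1), of A] A S(2)
      by (simp add: right_diff_distrib mult.commute[of "indicator A _"])
    finally show ?thesis .
  qed
  have pp: "positive_part \<sigma> = density S (\<lambda>x. ennreal (p x - q x))"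
    by (rule positive_part_density[OF S(2) _ \<sigma>']) (use p q in auto)
  have pn: "positive_part (\<lambda>A. - \<sigma> A) = density S (\<lambda>x. ennreal (q x - p x))"
  proof (rule positive_part_density[OF S(2)])
    fix A :: "real set" assume "A \<in> sets borel"
    then show "- \<sigma> A = (\<integral>x. indicator A x * (q x - p x) \<partial>S)"
      unfolding \<sigma>'[OF \<open>A \<in> sets borel\<close>] by (subst integral_minus[symmetric]) (simp add: algebra_simps)
  qed (use p q in auto)
  have mx: "density S (\<lambda>x. ennreal (u x)) = density S (\<lambda>x. ennreal (max 0 (u x)))" for u :: "real \<Rightarrow> real"
    by simp
  have fp: "integrable S (\<lambda>x. p x *\<^sub>R f x)" "integrable S (\<lambda>x. q x *\<^sub>R f x)"
    using f p q by (simp_all add: integrable_density)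
  have i1: "integrable S (\<lambda>x. max 0 (p x - q x) *\<^sub>R f x)"
    by (rule Bochner_Integration.integrable_bound[OF fp(1)])
       (use p(2) q(2) in \<open>auto intro!: AE_I2 mult_right_mono simp: max_def\<close>)
  have i2: "integrable S (\<lambda>x. max 0 (q x - p x) *\<^sub>R f x)"
    by (rule Bochner_Integration.integrable_bound[OF fp(2)])
       (use p(2) q(2) in \<open>auto intro!: AE_I2 mult_right_mono simp: max_def\<close>)
  have "signed_integral \<sigma> f = (\<integral>x. max 0 (p x - q x) *\<^sub>R f x \<partial>S) - (\<integral>x. max 0 (q x - p x) *\<^sub>R f x \<partial>S)"
    unfolding signed_integral_def pp pn by (subst (1 2) mx, subst (1 2) integral_density) auto
  also have "\<dots> = (\<integral>x. p x *\<^sub>R f x - q x *\<^sub>R f x \<partial>S)"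
    by (subst Bochner_Integration.integral_diff[OF i1 i2, symmetric], rule Bochner_Integration.integral_cong)
       (auto simp: max_def scaleR_left_diff_distrib)
  also have "\<dots> = (\<integral>x. f x \<partial>M) - (\<integral>x. f x \<partial>N)"
    using p q fp by (simp add: integral_density)
  finally show ?thesis .
qed

lemma
  fixes k :: "'a \<Rightarrow> real" and X :: "'a \<Rightarrow> real"
  assumes X[measurable]: "X \<in> borel_measurable M" and k: "integrable M k" and k0: "\<And>\<omega>. 0 \<le> k \<omega>"
  shows finite_distr_density: "finite_measure (distr (density M (\<lambda>\<omega>. ennreal (k \<omega>))) borel X)"
    and measure_distr_density: "\<And>A. A \<in> sets borel \<Longrightarrow>
      measure (distr (density M (\<lambda>\<omega>. ennreal (k \<omega>))) borel X) A = (\<integral>\<omega>. indicator A (X \<omega>) * k \<omega> \<partial>M)"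
proof -
  have [measurable]: "k \<in> borel_measurable M" using k by auto
  have *: "emeasure (distr (density M (\<lambda>\<omega>. ennreal (k \<omega>))) borel X) A
      = ennreal (\<integral>\<omega>. indicator A (X \<omega>) * k \<omega> \<partial>M)" if [measurable]: "A \<in> sets borel" for A
  proof -
    have "emeasure (distr (density M (\<lambda>\<omega>. ennreal (k \<omega>))) borel X) A = (\<integral>\<^sup>+\<omega>. ennreal (k \<omega>) * indicator (X -` A \<inter> space M) \<omega> \<partial>M)"
      by (subst emeasure_distr, simp, simp, subst emeasure_density) auto
    also have "\<dots> = (\<integral>\<^sup>+\<omega>. ennreal (indicator A (X \<omega>) * k \<omega>) \<partial>M)"
      by (intro nn_integral_cong) (auto simp: indicator_def)
    also have "\<dots> = ennreal (\<integral>\<omega>. indicator A (X \<omega>) * k \<omega> \<partial>M)"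
      by (rule nn_integral_eq_integral)
         (auto intro!: Bochner_Integration.integrable_bound[OF k] simp: k0 indicator_def)
    finally show ?thesis .
  qed
  show "finite_measure (distr (density M (\<lambda>\<omega>. ennreal (k \<omega>))) borel X)"
    by (rule finite_measureI) (use *[of UNIV] in simp)
  show "measure (distr (density M (\<lambda>\<omega>. ennreal (k \<omega>))) borel X) A = (\<integral>\<omega>. indicator A (X \<omega>) * k \<omega> \<partial>M)"
    if "A \<in> sets borel" for A
    using *[OF that] by (simp add: measure_def k0 integral_nonneg_AE)
qed

lemma signed_integral_pushforward:
  fixes k :: "'a \<Rightarrow> real" and X :: "'a \<Rightarrow> real" and f :: "real \<Rightarrow> complex"
  assumes X[measurable]: "X \<in> borel_measurable M" and k: "integrable M k"
    and \<sigma>: "\<And>A. A \<in> sets borel \<Longrightarrow> \<sigma> A = (\<integral>\<omega>. indicator A (X \<omega>) * k \<omega> \<partial>M)"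
    and f[measurable]: "f \<in> borel_measurable borel" and fk: "integrable M (\<lambda>\<omega>. f (X \<omega>) * k \<omega>)"
  shows "signed_integral \<sigma> f = (\<integral>\<omega>. f (X \<omega>) * k \<omega> \<partial>M)"
proof -
  have [measurable]: "k \<in> borel_measurable M" using k by auto
  define kp kn where "kp \<omega> = max 0 (k \<omega>)" and "kn \<omega> = max 0 (- k \<omega>)" for \<omega>
  have [measurable]: "kp \<in> borel_measurable M" "kn \<in> borel_measurable M" unfolding kp_def kn_def by auto
  have int: "integrable M kp" "integrable M kn" unfolding kp_def kn_def using k by auto
  have nn: "0 \<le> kp \<omega>" "0 \<le> kn \<omega>" for \<omega> by (auto simp: kp_def kn_def)
  let ?M = "distr (density M (\<lambda>\<omega>. ennreal (kp \<omega>))) borel X"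
  let ?N = "distr (density M (\<lambda>\<omega>. ennreal (kn \<omega>))) borel X"
  have ip: "integrable M (\<lambda>\<omega>. kp \<omega> *\<^sub>R f (X \<omega>))" "integrable M (\<lambda>\<omega>. kn \<omega> *\<^sub>R f (X \<omega>))"
    by (rule Bochner_Integration.integrable_bound[OF fk];
        auto intro!: AE_I2 simp: kp_def kn_def norm_mult max_def mult.commute[of "\<bar>_\<bar>"] intro: mult_nonneg_nonpos)+
  have "signed_integral \<sigma> f = (\<integral>x. f x \<partial>?M) - (\<integral>x. f x \<partial>?N)"
  proof (rule signed_integral_diff)
    fix A :: "real set" assume A[measurable]: "A \<in> sets borel"
    have "integrable M (\<lambda>\<omega>. indicator A (X \<omega>) * kp \<omega>)" "integrable M (\<lambda>\<omega>. indicator A (X \<omega>) * kn \<omega>)"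
      by (rule Bochner_Integration.integrable_bound[OF int(1)] Bochner_Integration.integrable_bound[OF int(2)];
        auto intro!: AE_I2 simp: indicator_def)+
    then have "measure ?M A - measure ?N A = (\<integral>\<omega>. indicator A (X \<omega>) * kp \<omega> - indicator A (X \<omega>) * kn \<omega> \<partial>M)"
      by (simp add: measure_distr_density[OF X int(1) nn(1) A] measure_distr_density[OF X int(2) nn(2) A])
    also have "\<dots> = (\<integral>\<omega>. indicator A (X \<omega>) * k \<omega> \<partial>M)"
      by (intro Bochner_Integration.integral_cong) (auto simp: kp_def kn_def indicator_def)
    finally show "\<sigma> A = measure ?M A - measure ?N A" using \<sigma>[OF A] by simp
  next
    show "integrable ?M f" "integrable ?N f"
      using ip by (simp_all add: integrable_distr_eq integrable_density nn)
  qed (use X int nn in \<open>auto intro!: finite_distr_density\<close>)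
  also have "\<dots> = (\<integral>\<omega>. kp \<omega> *\<^sub>R f (X \<omega>) - kn \<omega> *\<^sub>R f (X \<omega>) \<partial>M)"
    using ip by (simp add: integral_distr integral_density nn)
  also have "\<dots> = (\<integral>\<omega>. f (X \<omega>) * k \<omega> \<partial>M)"
    by (intro Bochner_Integration.integral_cong)
       (auto simp: kp_def kn_def max_def scaleR_conv_of_real mult.commute)
  finally show ?thesis .
qed

text \<open>
  The space of \<open>M\<close> is arbitrary in order to cover convolutions, where \<open>X\<close> is the addition on a product
  space, as well as densities, where \<open>X\<close> is the identity.
\<close>

lemma complex_integral_pushforward:
  fixes k :: "'a \<Rightarrow> complex" and X :: "'a \<Rightarrow> real" and f :: "real \<Rightarrow> complex"
  assumes X[measurable]: "X \<in> borel_measurable M" and k: "integrable M k"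
    and \<nu>: "\<And>A. A \<in> sets borel \<Longrightarrow> \<nu> A = (\<integral>\<omega>. indicator A (X \<omega>) * k \<omega> \<partial>M)"
    and f[measurable]: "f \<in> borel_measurable borel" and fk: "integrable M (\<lambda>\<omega>. f (X \<omega>) * k \<omega>)"
  shows "complex_integral \<nu> f = (\<integral>\<omega>. f (X \<omega>) * k \<omega> \<partial>M)"
proof -
  have [measurable]: "k \<in> borel_measurable M" using k by auto
  have ind: "integrable M (\<lambda>\<omega>. indicator A (X \<omega>) * k \<omega>)" if [measurable]: "A \<in> sets borel" for A
    by (rule Bochner_Integration.integrable_bound[OF k]) (auto simp: indicator_def)
  have re: "integrable M (\<lambda>\<omega>. f (X \<omega>) * complex_of_real (Re (k \<omega>)))"
    by (rule Bochner_Integration.integrable_bound[OF fk])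
       (auto simp: norm_mult abs_Re_le_cmod intro!: mult_left_mono)
  have im: "integrable M (\<lambda>\<omega>. f (X \<omega>) * complex_of_real (Im (k \<omega>)))"
    by (rule Bochner_Integration.integrable_bound[OF fk])
       (auto simp: norm_mult abs_Im_le_cmod intro!: mult_left_mono)
  have "signed_integral (\<lambda>A. Re (\<nu> A)) f = (\<integral>\<omega>. f (X \<omega>) * Re (k \<omega>) \<partial>M)"
  proof (rule signed_integral_pushforward)
    fix A :: "real set" assume A[measurable]: "A \<in> sets borel"
    have "Re (\<nu> A) = (\<integral>\<omega>. Re (indicator A (X \<omega>) * k \<omega>) \<partial>M)"
      unfolding \<nu>[OF A] by (rule integral_Re[OF ind[OF A], symmetric])
    then show "Re (\<nu> A) = (\<integral>\<omega>. indicator A (X \<omega>) * Re (k \<omega>) \<partial>M)"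
      by (auto simp: indicator_def intro!: Bochner_Integration.integral_cong)
  qed (use re k in auto)
  moreover have "signed_integral (\<lambda>A. Im (\<nu> A)) f = (\<integral>\<omega>. f (X \<omega>) * Im (k \<omega>) \<partial>M)"
  proof (rule signed_integral_pushforward)
    fix A :: "real set" assume A[measurable]: "A \<in> sets borel"
    have "Im (\<nu> A) = (\<integral>\<omega>. Im (indicator A (X \<omega>) * k \<omega>) \<partial>M)"
      unfolding \<nu>[OF A] by (rule integral_Im[OF ind[OF A], symmetric])
    then show "Im (\<nu> A) = (\<integral>\<omega>. indicator A (X \<omega>) * Im (k \<omega>) \<partial>M)"
      by (auto simp: indicator_def intro!: Bochner_Integration.integral_cong)
  qed (use im k in auto)
  ultimately have "complex_integral \<nu> f = (\<integral>\<omega>. f (X \<omega>) * Re (k \<omega>) + \<i> * (f (X \<omega>) * Im (k \<omega>)) \<partial>M)"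
    using re im by (simp add: complex_integral_def)
  also have "\<dots> = (\<integral>\<omega>. f (X \<omega>) * k \<omega> \<partial>M)"
    by (intro Bochner_Integration.integral_cong refl)
       (metis complex_eq distrib_left mult.left_commute)
  finally show ?thesis .
qed

section \<open>Jordan decomposition\<close>

definition countably_additive_real :: "(real set \<Rightarrow> real) \<Rightarrow> bool" where
  "countably_additive_real \<sigma> \<longleftrightarrow> (\<forall>A :: nat \<Rightarrow> real set. range A \<subseteq> sets borel \<longrightarrow> disjoint_family A \<longrightarrow>
        (\<lambda>n. \<sigma> (A n)) sums \<sigma> (\<Union>n. A n))"

lemma countably_additive_realD:
  "countably_additive_real \<sigma> \<Longrightarrow> (\<And>n. A n \<in> sets borel) \<Longrightarrow> disjoint_family A \<Longrightarrow> (\<lambda>n::nat. \<sigma> (A n)) sums \<sigma> (\<Union>n. A n)"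
  unfolding countably_additive_real_def by blast

lemma countably_additive_real_empty: assumes "countably_additive_real \<sigma>" shows "\<sigma> {} = 0"
proof -
  have "(\<lambda>n::nat. \<sigma> {}) sums \<sigma> (\<Union>n::nat. {})"
    by (rule countably_additive_realD[OF assms, of "\<lambda>_. {}"]) (auto simp: disjoint_family_on_def)
  then show ?thesis using sums_summable summable_const_iff by blast
qed

lemma countably_additive_real_Un:
  assumes "countably_additive_real \<sigma>" "A \<in> sets borel" "B \<in> sets borel" "A \<inter> B = {}"
  shows "\<sigma> (A \<union> B) = \<sigma> A + \<sigma> B"
proof -
  have "(\<lambda>n. \<sigma> (binaryset A B n)) sums \<sigma> (\<Union>n. binaryset A B n)"
    using assms by (intro countably_additive_realD) (auto simp: binaryset_def disjoint_family_on_def)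
  moreover have "(\<lambda>n. \<sigma> (binaryset A B n)) sums (\<sigma> A + \<sigma> B)"
    by (rule binaryset_sums) (rule countably_additive_real_empty[OF assms(1)])
  ultimately show ?thesis by (simp add: UN_binaryset_eq sums_unique2)
qed

lemma countably_additive_real_Diff:
  assumes "countably_additive_real \<sigma>" "A \<in> sets borel" "B \<in> sets borel" "B \<subseteq> A"
  shows "\<sigma> (A - B) = \<sigma> A - \<sigma> B"
  using countably_additive_real_Un[OF assms(1), of "A - B" B] assms by (simp add: Un_absorb2 Int_commute)

text \<open>
  If \<open>\<sigma>\<close> is unbounded on the subsets of \<open>F\<close>, choose \<open>B \<subseteq> F\<close> with \<open>\<bar>\<sigma> B\<bar> > \<bar>\<sigma> F\<bar> + 1\<close>. Then both \<open>B\<close> and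
  \<open>F - B\<close> have mass of modulus at least 1, and \<open>\<sigma>\<close> is unbounded on the subsets of one of them. Splitting
  off the other one and iterating produces disjoint sets of mass at least 1 in modulus, contrary to the convergence of
  the series of their masses.
\<close>

lemma countably_additive_real_bounded:
  assumes ca: "countably_additive_real \<sigma>"
  obtains C where "\<And>A. A \<in> sets borel \<Longrightarrow> \<bar>\<sigma> A\<bar> \<le> C"
proof (rule ccontr)
  assume "\<not> thesis"
  define P where "P F \<longleftrightarrow> F \<in> sets borel \<and> \<not> (\<exists>C. \<forall>B\<in>sets borel. B \<subseteq> F \<longrightarrow> \<bar>\<sigma> B\<bar> \<le> C)" for F
  have "P UNIV" using \<open>\<not> thesis\<close> that unfolding P_def by auto
  have step: "\<exists>F'. P F' \<and> F' \<subseteq> F \<and> 1 \<le> \<bar>\<sigma> (F - F')\<bar>" if "P F" for F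
  proof -
    have [measurable]: "F \<in> sets borel" using that P_def by blast
    have "\<not> (\<forall>B\<in>sets borel. B \<subseteq> F \<longrightarrow> \<bar>\<sigma> B\<bar> \<le> \<bar>\<sigma> F\<bar> + 1)"
      using that unfolding P_def by blast
    then obtain B where B[measurable]: "B \<in> sets borel" and "B \<subseteq> F" and big: "\<bar>\<sigma> B\<bar> > \<bar>\<sigma> F\<bar> + 1"
      by (auto simp: not_le)
    note B = B \<open>B \<subseteq> F\<close>
    have d: "\<sigma> (F - B) = \<sigma> F - \<sigma> B"
      by (rule countably_additive_real_Diff[OF ca]) (use B in auto)
    have "P B \<or> P (F - B)"
    proof (rule ccontr)
      assume "\<not> (P B \<or> P (F - B))"
      then obtain C D where C: "\<And>E. E \<in> sets borel \<Longrightarrow> E \<subseteq> B \<Longrightarrow> \<bar>\<sigma> E\<bar> \<le> C"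
        and D: "\<And>E. E \<in> sets borel \<Longrightarrow> E \<subseteq> F - B \<Longrightarrow> \<bar>\<sigma> E\<bar> \<le> D"
        unfolding P_def using B by (metis \<open>F \<in> sets borel\<close> sets.Diff)
      have "\<bar>\<sigma> E\<bar> \<le> C + D" if [measurable]: "E \<in> sets borel" and "E \<subseteq> F" for E
      proof -
        have "\<sigma> ((E \<inter> B) \<union> (E - B)) = \<sigma> (E \<inter> B) + \<sigma> (E - B)"
          by (rule countably_additive_real_Un[OF ca]) auto
        moreover have "(E \<inter> B) \<union> (E - B) = E" by auto
        moreover have "\<bar>\<sigma> (E \<inter> B)\<bar> \<le> C" "\<bar>\<sigma> (E - B)\<bar> \<le> D"
          using \<open>E \<subseteq> F\<close> by (auto intro!: C D)
        ultimately show ?thesis by simp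
      qed
      then show False using \<open>P F\<close> unfolding P_def by blast
    qed
    then show ?thesis
    proof
      assume "P B" then show ?thesis using B big d by (intro exI[of _ B]) auto
    next
      assume "P (F - B)"
      moreover have "F - (F - B) = B" using B by auto
      ultimately show ?thesis using big by (intro exI[of _ "F - B"]) auto
    qed
  qed
  obtain F where F: "\<And>n::nat. P (F n)" "\<And>n. F (Suc n) \<subseteq> F n \<and> 1 \<le> \<bar>\<sigma> (F n - F (Suc n))\<bar>"
  proof -
    have "\<exists>F. \<forall>n::nat. P (F n) \<and> (F (Suc n) \<subseteq> F n \<and> 1 \<le> \<bar>\<sigma> (F n - F (Suc n))\<bar>)"
      by (rule dependent_nat_choice[of "\<lambda>_. P" "\<lambda>_ F F'. F' \<subseteq> F \<and> 1 \<le> \<bar>\<sigma> (F - F')\<bar>"])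
         (rule exI[of _ UNIV], rule \<open>P UNIV\<close>, rule step)
    then show thesis using that by metis
  qed
  have "antimono F" using F(2) by (intro decseq_SucI) auto
  have "disjoint_family (\<lambda>n. F n - F (Suc n))"
    unfolding disjoint_family_on_def
  proof (intro ballI impI)
    fix m n :: nat assume "m \<noteq> n"
    have *: "(F i - F (Suc i)) \<inter> (F j - F (Suc j)) = {}" if "i < j" for i j
      using antimonoD[OF \<open>antimono F\<close>, of "Suc i" j] that by auto
    show "(F m - F (Suc m)) \<inter> (F n - F (Suc n)) = {}"
      using *[of m n] *[of n m] \<open>m \<noteq> n\<close> by (cases "m < n") auto
  qed
  then have "(\<lambda>n. \<sigma> (F n - F (Suc n))) sums \<sigma> (\<Union>n. F n - F (Suc n))"
    using F(1) P_def by (intro countably_additive_realD[OF ca]) auto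
  then have "(\<lambda>n. \<sigma> (F n - F (Suc n))) \<longlonglongrightarrow> 0"
    using sums_summable summable_LIMSEQ_zero by blast
  then have "eventually (\<lambda>n. \<bar>\<sigma> (F n - F (Suc n))\<bar> < 1) sequentially"
    using order_tendstoD(2)[OF tendsto_rabs_zero, of "\<lambda>n. \<sigma> (F n - F (Suc n))"] by simp
  then show False using F(2) by (auto simp: eventually_sequentially) (metis less_le_not_le le_refl)
qed

text \<open>
  Countable additivity of the supremum: a subset of a disjoint union splits into subsets of the members, which gives one inequality.
  For the other one, subsets of two disjoint sets can be joined, after those of negative mass are replaced by
  the empty set; so the supremum is superadditive on finite unions, and the partial sums are bounded.
\<close>

lemma positive_part_measure:
  assumes ca: "countably_additive_real \<sigma>"
  shows "finite_measure (positive_part \<sigma>)" "sets (positive_part \<sigma>) = sets borel"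
    "\<And>A. A \<in> sets borel \<Longrightarrow> emeasure (positive_part \<sigma>) A = (SUP B\<in>{B \<in> sets borel. B \<subseteq> A}. ennreal (\<sigma> B))"
proof -
  let ?p = "\<lambda>A. SUP B\<in>{B \<in> sets borel. B \<subseteq> A}. ennreal (\<sigma> B)"
  have emp: "\<sigma> {} = 0" by (rule countably_additive_real_empty[OF ca])
  show S: "sets (positive_part \<sigma>) = sets borel"
    unfolding positive_part_def using sets.sigma_sets_eq[of borel] by (subst sets_measure_of) auto
  have super: "?p A + ?p A' \<le> ?p (A \<union> A')" if "A \<inter> A' = {}" for A A'
  proof -
    have ne: "{B \<in> sets borel. B \<subseteq> A} \<noteq> {}" "{B \<in> sets borel. B \<subseteq> A'} \<noteq> {}" by auto
    have "ennreal (\<sigma> B) + ennreal (\<sigma> B') \<le> ?p (A \<union> A')"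
      if "B \<in> sets borel" "B \<subseteq> A" "B' \<in> sets borel" "B' \<subseteq> A'" for B B'
    proof -
      \<comment> \<open>Replacing a set of negative mass by the empty set does not change the truncated value.\<close>
      define C where "C = (if \<sigma> B \<ge> 0 then B else {})"
      define C' where "C' = (if \<sigma> B' \<ge> 0 then B' else {})"
      have "C \<inter> C' = {}" "C \<union> C' \<subseteq> A \<union> A'" using that \<open>A \<inter> A' = {}\<close> by (auto simp: C_def C'_def)
      have [measurable]: "C \<in> sets borel" "C' \<in> sets borel" using that by (auto simp: C_def C'_def)
      have "\<sigma> (C \<union> C') = \<sigma> C + \<sigma> C'"
        using \<open>C \<inter> C' = {}\<close> by (intro countably_additive_real_Un[OF ca]) auto
      moreover have "ennreal (\<sigma> B) = ennreal (\<sigma> C)" "0 \<le> \<sigma> C"  "ennreal (\<sigma> B') = ennreal (\<sigma> C')" "0 \<le> \<sigma> C'"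
        by (auto simp: C_def C'_def emp ennreal_neg)
      ultimately have "ennreal (\<sigma> B) + ennreal (\<sigma> B') = ennreal (\<sigma> (C \<union> C'))" by (simp add: ennreal_plus)
      also have "\<dots> \<le> ?p (A \<union> A')" using \<open>C \<union> C' \<subseteq> A \<union> A'\<close> by (intro SUP_upper) auto
      finally show ?thesis .
    qed
    then show ?thesis
      by (subst ennreal_SUP_add_left[OF ne(1), symmetric], intro SUP_least,
          subst ennreal_SUP_add_right[OF ne(2)], intro SUP_least) auto
  qed
  have "countably_additive (sets borel) ?p"
  proof (rule countably_additiveI)
    fix A :: "nat \<Rightarrow> real set" assume A: "range A \<subseteq> sets borel" and dj: "disjoint_family A"
    have fin: "(\<Sum>i<n. ?p (A i)) \<le> ?p (\<Union>i<n. A i)" for n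
    proof (induction n)
      case (Suc n)
      have "A i \<inter> A n = {}" if "i < n" for i using disjoint_family_onD[OF dj, of i n] that by simp
      then have "(\<Union>i<n. A i) \<inter> A n = {}" by blast
      then have "?p (\<Union>i<n. A i) + ?p (A n) \<le> ?p ((\<Union>i<n. A i) \<union> A n)" by (rule super)
      then have "?p (\<Union>i<n. A i) + ?p (A n) \<le> ?p (\<Union>i<Suc n. A i)"
        by (simp only: lessThan_Suc UN_insert Un_commute)
      with add_right_mono[OF Suc] have "(\<Sum>i<n. ?p (A i)) + ?p (A n) \<le> ?p (\<Union>i<Suc n. A i)"
        by (rule order_trans)
      then show ?case by simp
    qed auto
    show "(\<Sum>i. ?p (A i)) = ?p (\<Union>i. A i)"
    proof (rule antisym)
      show "(\<Sum>i. ?p (A i)) \<le> ?p (\<Union>i. A i)"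
        unfolding suminf_eq_SUP
      proof (rule SUP_least)
        fix n
        have "?p (\<Union>i<n. A i) \<le> ?p (\<Union>i. A i)" by (rule SUP_subset_mono) auto
        with fin[of n] show "(\<Sum>i<n. ?p (A i)) \<le> ?p (\<Union>i. A i)" by (rule order_trans)
      qed
      show "?p (\<Union>i. A i) \<le> (\<Sum>i. ?p (A i))"
      proof (rule SUP_least, clarsimp)
        fix B assume B: "B \<in> sets borel" "B \<subseteq> (\<Union>i. A i)"
        have sm: "(\<lambda>n. \<sigma> (B \<inter> A n)) sums \<sigma> (\<Union>n. B \<inter> A n)"
          using A B disjoint_family_subset[OF dj, of "\<lambda>n. B \<inter> A n"]
          by (intro countably_additive_realD[OF ca]) auto
        have "(\<Union>n. B \<inter> A n) = B" using B by auto
        with sm have sm: "(\<lambda>n. \<Sum>i<n. \<sigma> (B \<inter> A i)) \<longlonglongrightarrow> \<sigma> B" by (simp add: sums_def)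
        show "ennreal (\<sigma> B) \<le> (\<Sum>i. ?p (A i))"
        proof (rule tendsto_upperbound)
          show "(\<lambda>n. ennreal (\<Sum>i<n. \<sigma> (B \<inter> A i))) \<longlonglongrightarrow> ennreal (\<sigma> B)"
            using sm by (rule tendsto_ennrealI)
          show "\<forall>\<^sub>F n in sequentially. ennreal (\<Sum>i<n. \<sigma> (B \<inter> A i)) \<le> (\<Sum>i. ?p (A i))"
          proof (rule always_eventually, rule allI)
            fix n
            have "ennreal (\<Sum>i<n. \<sigma> (B \<inter> A i)) \<le> ennreal (\<Sum>i<n. max 0 (\<sigma> (B \<inter> A i)))"
              by (intro ennreal_leI sum_mono) auto
            also have "\<dots> = (\<Sum>i<n. ennreal (\<sigma> (B \<inter> A i)))"
              by (subst sum_ennreal[symmetric]) auto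
            also have "\<dots> \<le> (\<Sum>i<n. ?p (A i))"
              using A B by (intro sum_mono SUP_upper) auto
            also have "\<dots> \<le> (\<Sum>i. ?p (A i))" by (intro sum_le_suminf) auto
            finally show "ennreal (\<Sum>i<n. \<sigma> (B \<inter> A i)) \<le> (\<Sum>i. ?p (A i))" .
          qed
        qed auto
      qed
    qed
  qed
  then show em: "emeasure (positive_part \<sigma>) A = ?p A" if "A \<in> sets borel" for A
    by (intro emeasure_measure_of[OF positive_part_def]) (use S that in \<open>auto simp: positive_def emp\<close>)
  obtain C where C: "\<And>A. A \<in> sets borel \<Longrightarrow> \<bar>\<sigma> A\<bar> \<le> C" using countably_additive_real_bounded[OF ca] by blast
  show "finite_measure (positive_part \<sigma>)"
  proof (rule finite_measureI)
    have "emeasure (positive_part \<sigma>) UNIV \<le> ennreal C"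
      using C by (subst em) (auto intro!: SUP_least ennreal_leI dest: abs_le_D1)
    then show "emeasure (positive_part \<sigma>) (space (positive_part \<sigma>)) \<noteq> \<infinity>"
      using sets_eq_imp_space_eq[OF S] by (auto simp: top_unique)
  qed
qed

text \<open>
  For \<open>B \<subseteq> A\<close>, \<open>\<sigma> B = \<sigma> A - \<sigma> (A - B) \<le> \<sigma> A + \<sigma>\<^sup>-(A)\<close>, and taking the supremum over
  \<open>B\<close> gives \<open>\<sigma>\<^sup>+(A) \<le> \<sigma> A + \<sigma>\<^sup>-(A)\<close>. The other inequality is this one for \<open>-\<sigma>\<close>.
\<close>

lemma jordan_decomposition:
  assumes ca: "countably_additive_real \<sigma>" and A: "A \<in> sets borel"
  shows "\<sigma> A = measure (positive_part \<sigma>) A - measure (positive_part (\<lambda>A. - \<sigma> A)) A"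
proof -
  have ca': "countably_additive_real (\<lambda>A. - \<sigma> A)"
    using ca unfolding countably_additive_real_def by (auto intro: sums_minus)
  have le: "measure (positive_part \<tau>) A \<le> \<tau> A + measure (positive_part (\<lambda>A. - \<tau> A)) A"
    if t: "countably_additive_real \<tau>" "countably_additive_real (\<lambda>A. - \<tau> A)" for \<tau>
  proof -
    interpret N: finite_measure "positive_part (\<lambda>A. - \<tau> A)" by (rule positive_part_measure[OF t(2)])
    interpret P: finite_measure "positive_part \<tau>" by (rule positive_part_measure[OF t(1)])
    have n: "- \<tau> B \<le> measure (positive_part (\<lambda>A. - \<tau> A)) A" if "B \<in> sets borel" "B \<subseteq> A" for B
    proof -
      have "ennreal (- \<tau> B) \<le> emeasure (positive_part (\<lambda>A. - \<tau> A)) A"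
        unfolding positive_part_measure(3)[OF t(2) A] using that by (intro SUP_upper) auto
      then show ?thesis unfolding N.emeasure_eq_measure by simp
    qed
    have "emeasure (positive_part \<tau>) A \<le> ennreal (\<tau> A + measure (positive_part (\<lambda>A. - \<tau> A)) A)"
      unfolding positive_part_measure(3)[OF t(1) A]
    proof (rule SUP_least, clarsimp, rule ennreal_leI)
      fix B assume B: "B \<in> sets borel" "B \<subseteq> A"
      then have "\<tau> (A - B) = \<tau> A - \<tau> B" using countably_additive_real_Diff[OF t(1) A] by auto
      with n[of "A - B"] A B show "\<tau> B \<le> \<tau> A + measure (positive_part (\<lambda>A. - \<tau> A)) A" by auto
    qed
    then show ?thesis
      using n[OF A order_refl] unfolding P.emeasure_eq_measure by simp
  qed
  show ?thesis using le[OF ca ca'] le[OF ca'] ca by simp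
qed

lemma complex_measure_parts:
  assumes "complex_measure \<nu>"
  shows "countably_additive_real (\<lambda>A. Re (\<nu> A))" "countably_additive_real (\<lambda>A. Im (\<nu> A))"
  using assms unfolding complex_measure_def countably_additive_real_def
  by (auto intro: sums_Re sums_Im)

definition has_complex_density :: "(real set \<Rightarrow> complex) \<Rightarrow> real measure \<Rightarrow> (real \<Rightarrow> complex) \<Rightarrow> bool" where
  "has_complex_density \<nu> S h \<longleftrightarrow> finite_measure S \<and> sets S = sets borel \<and> integrable S h \<and>
     (\<forall>A\<in>sets borel. \<nu> A = (\<integral>x. indicator A x * h x \<partial>S))"

lemma measure_density_integral:
  fixes d :: "real \<Rightarrow> real"
  assumes S[measurable_cong]: "sets S = sets borel" and d: "integrable S d" "\<And>x. 0 \<le> d x" and [measurable]: "A \<in> sets borel"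
  shows "measure (density S d) A = (\<integral>x. indicator A x * d x \<partial>S)"
proof -
  have "distr (density S d) borel (\<lambda>x. x) = density S d"
    by (rule distr_id2) (simp add: S)
  then show ?thesis
    using measure_distr_density[of "\<lambda>x. x" S d A] d by simp
qed

text \<open>
  The reference measure is the sum of the Jordan parts of the real and of the imaginary part.
\<close>

lemma complex_measure_has_density:
  assumes "complex_measure \<nu>"
  obtains S h where "has_complex_density \<nu> S h"
proof -
  note ca = complex_measure_parts[OF assms]
  have cam: "countably_additive_real (\<lambda>A. - Re (\<nu> A))" "countably_additive_real (\<lambda>A. - Im (\<nu> A))"
    using ca unfolding countably_additive_real_def by (auto intro: sums_minus)
  let ?P = "\<lambda>i::nat. positive_part (if i = 0 then (\<lambda>A. Re (\<nu> A)) else if i = 1 then (\<lambda>A. - Re (\<nu> A))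
     else if i = 2 then (\<lambda>A. Im (\<nu> A)) else (\<lambda>A. - Im (\<nu> A)))"
  have P: "finite_measure (?P i)" "sets (?P i) = sets borel" for i
    by (auto intro!: positive_part_measure ca cam)
  obtain S1 where S1: "finite_measure S1" "sets S1 = sets borel"
    "\<And>A. A \<in> sets borel \<Longrightarrow> emeasure S1 A = emeasure (?P 0) A + emeasure (?P 1) A"
    using sum_of_finite_measures[OF P(1) P(1) P(2) P(2), of 0 1] by metis
  obtain S2 where S2: "finite_measure S2" "sets S2 = sets borel"
    "\<And>A. A \<in> sets borel \<Longrightarrow> emeasure S2 A = emeasure (?P 2) A + emeasure (?P 3) A"
    using sum_of_finite_measures[OF P(1) P(1) P(2) P(2), of 2 3] by metis
  obtain S where S: "finite_measure S" "sets S = sets borel"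
    "\<And>A. A \<in> sets borel \<Longrightarrow> emeasure S A = emeasure S1 A + emeasure S2 A"
    using sum_of_finite_measures[OF S1(1) S2(1) S1(2) S2(2)] by metis
  have "\<exists>d. integrable S d \<and> (\<forall>x. 0 \<le> d x) \<and> ?P i = density S d" if "i < 4" for i
  proof -
    have "emeasure (?P i) A \<le> emeasure S A" if "A \<in> sets borel" for A
    proof -
      have eS: "emeasure S A = emeasure (?P 0) A + emeasure (?P 1) A + (emeasure (?P 2) A + emeasure (?P 3) A)"
        using S(3) S1(3) S2(3) that by simp
      have "i = 0 \<or> i = 1 \<or> i = 2 \<or> i = 3" using \<open>i < 4\<close> by auto
      then show ?thesis unfolding eS
        by (elim disjE) (simp_all add: add.assoc add_increasing add_increasing2)
    qed
    then show ?thesis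
      using dominated_measure_density[OF P(1) S(1) P(2) S(2), of i] by metis
  qed
  then obtain d where d: "\<And>i. i < 4 \<Longrightarrow> integrable S (d i)" "\<And>i x. i < 4 \<Longrightarrow> 0 \<le> d i x"
    "\<And>i. i < 4 \<Longrightarrow> ?P i = density S (d i)" by metis
  define h where "h x = complex_of_real (d 0 x - d 1 x) + \<i> * complex_of_real (d 2 x - d 3 x)" for x
  have "integrable S h" unfolding h_def using d(1) by auto
  moreover have "\<nu> A = (\<integral>x. indicator A x * h x \<partial>S)" if A[measurable]: "A \<in> sets borel" for A
  proof -
    have m: "measure (?P i) A = (\<integral>x. indicator A x * d i x \<partial>S)" if "i < 4" for i
      using measure_density_integral[OF S(2) d(1)[OF that] d(2)[OF that] A] d(3)[OF that] by simp
    have int: "integrable S (\<lambda>x. indicator A x * d i x)" if "i < 4" for i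
      using integrable_real_mult_indicator[OF _ d(1)[OF that], of A] A S(2) by (simp add: mult.commute)
    have "Re (\<nu> A) = measure (?P 0) A - measure (?P 1) A"
      using jordan_decomposition[OF ca(1) A] by simp
    also have "\<dots> = (\<integral>x. indicator A x * d 0 x - indicator A x * d 1 x \<partial>S)"
      using int[of 0] int[of 1] m[of 0] m[of 1] by simp
    finally have re: "Re (\<nu> A) = (\<integral>x. indicator A x * d 0 x - indicator A x * d 1 x \<partial>S)" .
    have "Im (\<nu> A) = measure (?P 2) A - measure (?P 3) A"
      using jordan_decomposition[OF ca(2) A] by simp
    also have "\<dots> = (\<integral>x. indicator A x * d 2 x - indicator A x * d 3 x \<partial>S)"
      using int[of 2] int[of 3] m[of 2] m[of 3] by simp
    finally have im: "Im (\<nu> A) = (\<integral>x. indicator A x * d 2 x - indicator A x * d 3 x \<partial>S)" .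
    have "\<nu> A = complex_of_real (Re (\<nu> A)) + \<i> * complex_of_real (Im (\<nu> A))" by (simp add: complex_eq)
    also have "\<dots> = (\<integral>x. complex_of_real (indicator A x * d 0 x - indicator A x * d 1 x)
       + \<i> * complex_of_real (indicator A x * d 2 x - indicator A x * d 3 x) \<partial>S)"
      unfolding re im using int[of 0] int[of 1] int[of 2] int[of 3]
      by (subst Bochner_Integration.integral_add) (simp_all del: of_real_diff)
    also have "\<dots> = (\<integral>x. indicator A x * h x \<partial>S)"
      by (intro Bochner_Integration.integral_cong refl) (auto simp: h_def indicator_def)
    finally show ?thesis .
  qed
  ultimately show ?thesis using S that unfolding has_complex_density_def by metis
qed

section \<open>Complex measures: construction, uniqueness, integration\<close>

lemma complex_measure_borel: "complex_measure \<nu> \<Longrightarrow> A \<notin> sets borel \<Longrightarrow> \<nu> A = 0"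
  unfolding complex_measure_def by blast

lemma complex_measure_sums:
  "complex_measure \<nu> \<Longrightarrow> (\<And>n. A n \<in> sets borel) \<Longrightarrow> disjoint_family A \<Longrightarrow> (\<lambda>n::nat. \<nu> (A n)) sums \<nu> (\<Union>n. A n)"
  unfolding complex_measure_def by blast

lemma complex_measure_empty [simp]: "complex_measure \<nu> \<Longrightarrow> \<nu> {} = 0"
  using complex_measure_parts[THEN countably_additive_real_empty] by (simp add: complex_eq_iff)

lemma complex_measure_Un:
  "complex_measure \<nu> \<Longrightarrow> A \<in> sets borel \<Longrightarrow> B \<in> sets borel \<Longrightarrow> A \<inter> B = {} \<Longrightarrow> \<nu> (A \<union> B) = \<nu> A + \<nu> B"
  using complex_measure_parts[THEN countably_additive_real_Un] by (simp add: complex_eq_iff)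

lemma complex_measure_add:
  "complex_measure \<nu> \<Longrightarrow> complex_measure \<rho> \<Longrightarrow> complex_measure (\<lambda>A. \<nu> A + \<rho> A)"
  unfolding complex_measure_def by (auto intro: sums_add)

lemma complex_measure_mult: "complex_measure \<nu> \<Longrightarrow> complex_measure (\<lambda>A. c * \<nu> A)"
  unfolding complex_measure_def by (auto intro: sums_mult)

lemma complex_measure_diff:
  "complex_measure \<nu> \<Longrightarrow> complex_measure \<rho> \<Longrightarrow> complex_measure (\<lambda>A. \<nu> A - \<rho> A)"
  unfolding complex_measure_def by (auto intro: sums_diff)

lemma complex_measure_sum:
  "(\<And>i. i \<in> I \<Longrightarrow> complex_measure (\<nu> i)) \<Longrightarrow> complex_measure (\<lambda>A. \<Sum>i\<in>I. \<nu> i A)"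
  unfolding complex_measure_def by (auto intro!: sums_sum)

lemma complex_measure_of_measure:
  assumes "finite_measure M" "sets M = sets borel"
  shows "complex_measure (of_measure M)"
proof -
  interpret finite_measure M by fact
  show ?thesis unfolding complex_measure_def of_measure_def
  proof (intro conjI allI impI)
    fix A :: "nat \<Rightarrow> real set" assume "range A \<subseteq> sets borel" "disjoint_family A"
    then show "(\<lambda>n. complex_of_real (measure M (A n))) sums complex_of_real (measure M (\<Union>n. A n))"
      by (intro sums_of_real finite_measure_UNION) (auto simp: assms)
  qed (simp add: measure_notin_sets assms)
qed

lemma complex_measure_pushforward:
  fixes k :: "'a \<Rightarrow> complex" and X :: "'a \<Rightarrow> real"
  assumes X[measurable]: "X \<in> borel_measurable M" and k: "integrable M k"
  shows "complex_measure (\<lambda>A. if A \<in> sets borel then (\<integral>\<omega>. indicator A (X \<omega>) * k \<omega> \<partial>M) else 0)"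
  unfolding complex_measure_def
proof (intro conjI allI impI)
  have [measurable]: "k \<in> borel_measurable M" using k by auto
  fix A :: "nat \<Rightarrow> real set" assume "range A \<subseteq> sets borel" and dj: "disjoint_family A"
  then have [measurable]: "A n \<in> sets borel" for n by auto
  let ?f = "\<lambda>B \<omega>. indicator B (X \<omega>) * k \<omega>"
  have "(\<lambda>n. \<integral>\<omega>. ?f (\<Union>i<n. A i) \<omega> \<partial>M) \<longlonglongrightarrow> (\<integral>\<omega>. ?f (\<Union>i. A i) \<omega> \<partial>M)"
  proof (rule integral_dominated_convergence[where w="\<lambda>\<omega>. norm (k \<omega>)"])
    show "AE \<omega> in M. (\<lambda>n. ?f (\<Union>i<n. A i) \<omega>) \<longlonglongrightarrow> ?f (\<Union>i. A i) \<omega>"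
    proof (intro AE_I2 tendsto_intros)
      fix \<omega>
      show "(\<lambda>n. indicator (\<Union>i<n. A i) (X \<omega>) :: complex) \<longlonglongrightarrow> indicator (\<Union>i. A i) (X \<omega>)"
        using LIMSEQ_indicator_UN[of A "X \<omega>"] by simp
    qed
  qed (use k in \<open>auto simp: indicator_def\<close>)
  moreover have "(\<integral>\<omega>. ?f (\<Union>i<n. A i) \<omega> \<partial>M) = (\<Sum>i<n. \<integral>\<omega>. ?f (A i) \<omega> \<partial>M)" for n
  proof -
    have "integrable M (?f (A i))" for i
      by (rule Bochner_Integration.integrable_bound[OF k]) (auto simp: indicator_def)
    then have "(\<Sum>i<n. \<integral>\<omega>. ?f (A i) \<omega> \<partial>M) = (\<integral>\<omega>. (\<Sum>i<n. ?f (A i) \<omega>) \<partial>M)"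
      by (intro Bochner_Integration.integral_sum[symmetric])
    also have "\<dots> = (\<integral>\<omega>. ?f (\<Union>i<n. A i) \<omega> \<partial>M)"
    proof (intro Bochner_Integration.integral_cong refl)
      fix \<omega>
      have "disjoint_family_on A {..<n}" using dj by (auto simp: disjoint_family_on_def)
      then have "(indicator (\<Union>i<n. A i) (X \<omega>) :: complex) = (\<Sum>i<n. indicator (A i) (X \<omega>))"
        by (intro indicator_UN_disjoint) auto
      then show "(\<Sum>i<n. ?f (A i) \<omega>) = ?f (\<Union>i<n. A i) \<omega>" by (simp add: sum_distrib_right)
    qed
    finally show ?thesis by simp
  qed
  ultimately show "(\<lambda>n. if A n \<in> sets borel then \<integral>\<omega>. ?f (A n) \<omega> \<partial>M else 0) sums
      (if (\<Union>n. A n) \<in> sets borel then \<integral>\<omega>. ?f (\<Union>n. A n) \<omega> \<partial>M else 0)"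
    by (simp add: sums_def)
qed simp

text \<open>
  The half-open intervals are stable under intersection and generate the Borel sets. Complements are
  within reach since the total masses agree, the line being a disjoint union of unit intervals.
\<close>

lemma complex_measure_eqI:
  assumes \<nu>: "complex_measure \<nu>" and \<rho>: "complex_measure \<rho>"
    and eq: "\<And>a b. a \<le> b \<Longrightarrow> \<nu> {a<..b} = \<rho> {a<..b}"
  shows "\<nu> = \<rho>"
proof
  fix A :: "real set"
  show "\<nu> A = \<rho> A"
  proof (cases "A \<in> sets borel")
    case False then show ?thesis using complex_measure_borel[OF \<nu>] complex_measure_borel[OF \<rho>] by simp
  next
    case True
    let ?G = "range (\<lambda>(a, b). {a<..b::real})"
    have emp: "\<nu> {} = \<rho> {}" using \<nu> \<rho> by simp
    have sing: "\<nu> {a<..b} = \<rho> {a<..b}" for a b using eq[of a b] emp by (cases "a \<le> b") auto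
    have sg: "sets borel = sigma_sets UNIV ?G"
      using borel_sigma_sets_Ioc by (metis sets_measure_of Pow_UNIV subset_UNIV)
    have disjU: "\<nu> UNIV = \<rho> UNIV"
    proof -
      define D where "D = (\<lambda>i::int. {real_of_int i <.. real_of_int (i + 1)})"
      \<comment> \<open>Countable additivity is about sequences, so the unit intervals are enumerated by \<open>int_decode\<close>.\<close>
      let ?A = "\<lambda>n. D (int_decode n)"
      have "disjoint_family ?A"
        unfolding disjoint_family_on_def
      proof (intro ballI impI)
        fix m n :: nat assume "m \<noteq> n"
        then have "int_decode m \<noteq> int_decode n" using inj_int_decode[of UNIV] by (auto simp: inj_on_def)
        then have "int_decode m + 1 \<le> int_decode n \<or> int_decode n + 1 \<le> int_decode m" by linarith
        then have "real_of_int (int_decode m + 1) \<le> real_of_int (int_decode n) \<or>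
           real_of_int (int_decode n + 1) \<le> real_of_int (int_decode m)" by (simp only: of_int_le_iff)
        then show "?A m \<inter> ?A n = {}" unfolding D_def by auto
      qed
      moreover have "(\<Union>n. ?A n) = UNIV"
      proof (intro set_eqI iffI UNIV_I)
        fix x :: real
        have "x \<in> D (\<lceil>x\<rceil> - 1)" unfolding D_def by (simp, linarith)
        then show "x \<in> (\<Union>n. ?A n)" by (metis UN_iff UNIV_I surj_int_decode surjD)
      qed
      ultimately have "(\<lambda>n. \<nu> (?A n)) sums \<nu> UNIV" "(\<lambda>n. \<rho> (?A n)) sums \<rho> UNIV"
        using complex_measure_sums[OF \<nu>, of ?A] complex_measure_sums[OF \<rho>, of ?A] by (auto simp: D_def)
      moreover have "\<nu> (?A n) = \<rho> (?A n)" for n unfolding D_def by (rule sing)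
      ultimately show ?thesis by (simp add: sums_unique2)
    qed
    have "A \<in> sigma_sets UNIV ?G" using True sg by simp
    then show ?thesis
    proof (rule sigma_sets_induct_disjoint[rotated 2])
      show "Int_stable ?G"
        unfolding Int_stable_def by (auto simp: image_iff)
      show "?G \<subseteq> Pow UNIV" by simp
      show "\<nu> {} = \<rho> {}" by (rule emp)
      show "\<nu> B = \<rho> B" if "B \<in> ?G" for B using that sing by auto
    next
      fix B assume B: "B \<in> sigma_sets UNIV ?G" "\<nu> B = \<rho> B"
      then have b: "B \<in> sets borel" using sg by simp
      have "\<nu> UNIV = \<nu> B + \<nu> (UNIV - B)" "\<rho> UNIV = \<rho> B + \<rho> (UNIV - B)"
        using complex_measure_Un[OF \<nu> b, of "UNIV - B"] complex_measure_Un[OF \<rho> b, of "UNIV - B"] b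
        by (auto simp: Un_absorb1)
      then show "\<nu> (UNIV - B) = \<rho> (UNIV - B)" using disjU B(2) by simp
    next
      fix B :: "nat \<Rightarrow> real set"
      assume "disjoint_family B" "range B \<subseteq> sigma_sets UNIV ?G" "\<And>i. \<nu> (B i) = \<rho> (B i)"
      then show "\<nu> (\<Union>i. B i) = \<rho> (\<Union>i. B i)"
        using complex_measure_sums[OF \<nu>, of B] complex_measure_sums[OF \<rho>, of B] sg
        by (auto simp: subset_eq intro: sums_unique2)
    qed
  qed
qed

lemma has_complex_densityD:
  assumes "has_complex_density \<nu> S h"
  shows "finite_measure S" "sets S = sets borel" "integrable S h" "space S = UNIV"
    "h \<in> borel_measurable S" "h \<in> borel_measurable borel"
    "\<And>A. A \<in> sets borel \<Longrightarrow> \<nu> A = (\<integral>x. indicator A x * h x \<partial>S)"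
proof -
  show *: "sets S = sets borel" "integrable S h" using assms unfolding has_complex_density_def by auto
  show "h \<in> borel_measurable S" using * by auto
  then show "h \<in> borel_measurable borel" using measurable_cong_sets[OF *(1) refl] by blast
  show "space S = UNIV" using sets_eq_imp_space_eq[OF *(1)] by simp
qed (use assms in \<open>auto simp: has_complex_density_def\<close>)

lemma complex_integral_density:
  assumes \<nu>: "has_complex_density \<nu> S h" and f: "f \<in> borel_measurable borel" and fh: "integrable S (\<lambda>x. f x * h x)"
  shows "complex_integral \<nu> f = (\<integral>x. f x * h x \<partial>S)"
  using complex_integral_pushforward[of "\<lambda>x. x" S h \<nu> f] has_complex_densityD[OF \<nu>] f fh by simp

lemma integrable_bounded_mult:
  fixes f h :: "'a \<Rightarrow> complex"
  assumes "integrable S h" "f \<in> borel_measurable S" "\<And>x. norm (f x) \<le> C"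
  shows "integrable S (\<lambda>x. f x * h x)"
proof (rule Bochner_Integration.integrable_bound[of S "\<lambda>x. complex_of_real C * h x"])
  show "AE x in S. norm (f x * h x) \<le> norm (complex_of_real C * h x)"
  proof (rule AE_I2)
    fix x
    have "norm (f x) \<le> \<bar>C\<bar>" using assms(3)[of x] by linarith
    then show "norm (f x * h x) \<le> norm (complex_of_real C * h x)" by (simp add: norm_mult mult_right_mono)
  qed
qed (use assms in auto)

lemma complex_integral_density_bounded:
  assumes \<nu>: "has_complex_density \<nu> S h" and f: "f \<in> borel_measurable borel" "\<And>x. norm (f x) \<le> C"
  shows "complex_integral \<nu> f = (\<integral>x. f x * h x \<partial>S)"
proof (rule complex_integral_density[OF \<nu> f(1)])
  have "f \<in> borel_measurable S"
    using f(1) measurable_cong_sets[OF has_complex_densityD(2)[OF \<nu>] refl] by blast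
  then show "integrable S (\<lambda>x. f x * h x)"
    by (rule integrable_bounded_mult[OF has_complex_densityD(3)[OF \<nu>] _ f(2)])
qed

lemma complex_char_density:
  assumes "has_complex_density \<nu> S h"
  shows "complex_char \<nu> t = (\<integral>x. iexp (t * x) * h x \<partial>S)"
  unfolding complex_char_def by (rule complex_integral_density_bounded[OF assms, where C=1]) auto

lemma complex_char_of_measure:
  assumes "finite_measure M" "sets M = sets borel"
  shows "complex_char (of_measure M) t = char M t"
proof -
  interpret finite_measure M by fact
  have "has_complex_density (of_measure M) M (\<lambda>_. 1)"
    unfolding has_complex_density_def
  proof (intro conjI ballI)
    fix A :: "real set" assume A: "A \<in> sets borel"
    have "(\<integral>x. indicator A x * (1::complex) \<partial>M) = (\<integral>x. complex_of_real (indicator A x) \<partial>M)"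
      by (intro Bochner_Integration.integral_cong) (auto simp: indicator_def)
    then show "of_measure M A = (\<integral>x. indicator A x * 1 \<partial>M)"
      using A assms(2) sets_eq_imp_space_eq[OF assms(2)] by (simp add: of_measure_def)
  qed (use assms in auto)
  from complex_char_density[OF this] show ?thesis by (simp add: char_def)
qed

section \<open>Linearity and convolution\<close>

text \<open>
  The chain rule for densities; it serves to pass to a common reference measure.
\<close>

lemma has_complex_density_change:
  fixes d :: "real \<Rightarrow> real" and h :: "real \<Rightarrow> complex"
  assumes \<nu>: "has_complex_density \<nu> (density S (\<lambda>x. ennreal (d x))) h"
    and S: "finite_measure S" "sets S = sets borel" and d: "integrable S d" "\<And>x. 0 \<le> d x"
  shows "has_complex_density \<nu> S (\<lambda>x. d x * h x)"
proof -
  note D = has_complex_densityD[OF \<nu>]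
  note [measurable_cong] = S(2)
  have [measurable]: "d \<in> borel_measurable S" "h \<in> borel_measurable borel" using d D by auto
  have "integrable S (\<lambda>x. d x *\<^sub>R h x)" using D(3) d(2) by (subst (asm) integrable_density) auto
  moreover have "\<nu> A = (\<integral>x. d x *\<^sub>R (indicator A x * h x) \<partial>S)" if [measurable]: "A \<in> sets borel" for A
    using d(2) by (subst D(7)[OF that], subst integral_density) auto
  ultimately show ?thesis
    using S unfolding has_complex_density_def by (simp add: scaleR_conv_of_real mult.left_commute)
qed

lemma common_complex_density:
  assumes "complex_measure \<nu>" "complex_measure \<rho>"
  obtains S h k where "has_complex_density \<nu> S h" "has_complex_density \<rho> S k"
proof -
  obtain M h where h: "has_complex_density \<nu> M h" using complex_measure_has_density[OF assms(1)] .
  obtain N k where k: "has_complex_density \<rho> N k" using complex_measure_has_density[OF assms(2)] .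
  note H = has_complex_densityD[OF h] and K = has_complex_densityD[OF k]
  obtain S where S: "finite_measure S" "sets S = sets borel"
    and em: "\<And>A. A \<in> sets borel \<Longrightarrow> emeasure S A = emeasure M A + emeasure N A"
    using sum_of_finite_measures[OF H(1) K(1) H(2) K(2)] by metis
  obtain p where p: "integrable S p" "\<And>x. 0 \<le> p x" "M = density S p"
    using dominated_measure_density[OF H(1) S(1) H(2) S(2)] em by auto
  obtain q where q: "integrable S q" "\<And>x. 0 \<le> q x" "N = density S q"
    using dominated_measure_density[OF K(1) S(1) K(2) S(2)] em by auto
  show ?thesis
    using that has_complex_density_change[OF h[unfolded p(3)] S p(1,2)]
      has_complex_density_change[OF k[unfolded q(3)] S q(1,2)] by blast
qed

text \<open>
  Linearity in the measure is not visible from the definition by positive parts; it holds because both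
  measures have densities with respect to one finite measure.
\<close>

lemma complex_integral_add_scaled:
  assumes \<nu>: "complex_measure \<nu>" and \<rho>: "complex_measure \<rho>"
    and f: "f \<in> borel_measurable borel" "\<And>x. norm (f x) \<le> C"
  shows "complex_integral (\<lambda>A. \<nu> A + c * \<rho> A) f = complex_integral \<nu> f + c * complex_integral \<rho> f"
proof -
  obtain S h k where h: "has_complex_density \<nu> S h" and k: "has_complex_density \<rho> S k"
    using common_complex_density[OF \<nu> \<rho>] .
  note H = has_complex_densityD[OF h] and K = has_complex_densityD[OF k]
  note [measurable_cong] = H(2)
  have i: "integrable S (\<lambda>x. g x * h x)" "integrable S (\<lambda>x. g x * k x)"
    if "g \<in> borel_measurable borel" "\<And>x. norm (g x) \<le> C" for g C
    using that H(3) K(3) by (auto intro!: integrable_bounded_mult[where C=C])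
  have "has_complex_density (\<lambda>A. \<nu> A + c * \<rho> A) S (\<lambda>x. h x + c * k x)"
    unfolding has_complex_density_def
  proof (intro conjI ballI)
    fix A :: "real set" assume A[measurable]: "A \<in> sets borel"
    have "(\<lambda>x. indicator A x :: complex) \<in> borel_measurable borel" "norm (indicator A x :: complex) \<le> 1" for x
      by (auto simp: indicator_def)
    from i[OF this] show "\<nu> A + c * \<rho> A = (\<integral>x. indicator A x * (h x + c * k x) \<partial>S)"
      unfolding H(7)[OF A] K(7)[OF A] by (simp add: distrib_left mult.left_commute[of _ c])
  qed (use H K in auto)
  from complex_integral_density_bounded[OF this f]
  have "complex_integral (\<lambda>A. \<nu> A + c * \<rho> A) f = (\<integral>x. f x * (h x + c * k x) \<partial>S)" .
  also have "\<dots> = (\<integral>x. f x * h x \<partial>S) + c * (\<integral>x. f x * k x \<partial>S)"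
    using i[OF f] by (simp add: distrib_left mult.left_commute[of _ c])
  finally show ?thesis
    using complex_integral_density_bounded[OF h f] complex_integral_density_bounded[OF k f] by simp
qed

lemma complex_char_add_scaled:
  "complex_measure \<nu> \<Longrightarrow> complex_measure \<rho> \<Longrightarrow>
    complex_char (\<lambda>A. \<nu> A + c * \<rho> A) t = complex_char \<nu> t + c * complex_char \<rho> t"
  unfolding complex_char_def by (rule complex_integral_add_scaled[where C=1]) auto

text \<open>
  The form in which Fubini's theorem is applied throughout: an integrable product function times a bounded kernel.
\<close>

lemma integrable_product_bounded:
  fixes h :: "'a \<Rightarrow> complex" and k :: "'b \<Rightarrow> complex"
  assumes "sigma_finite_measure M" "sigma_finite_measure N" and h: "integrable M h" and k: "integrable N k"
    and b[measurable]: "case_prod b \<in> borel_measurable (M \<Otimes>\<^sub>M N)" and C: "\<And>x y. norm (b x y) \<le> C"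
  shows "integrable (M \<Otimes>\<^sub>M N) (\<lambda>(x, y). b x y * (h x * k y))"
proof -
  interpret M: sigma_finite_measure M by fact
  interpret N: sigma_finite_measure N by fact
  interpret pair_sigma_finite M N ..
  have [measurable]: "h \<in> borel_measurable M" "k \<in> borel_measurable N" using h k by auto
  have "integrable (M \<Otimes>\<^sub>M N) (\<lambda>p. h (fst p) * k (snd p))"
  proof (rule Fubini_integrable)
    show "integrable M (\<lambda>x. \<integral>y. norm (h (fst (x, y)) * k (snd (x, y))) \<partial>N)"
      using h by (simp add: norm_mult)
    show "AE x in M. integrable N (\<lambda>y. h (fst (x, y)) * k (snd (x, y)))"
      using k by auto
  qed simp
  from integrable_bounded_mult[OF this b, of C] C show ?thesis by (auto simp: case_prod_beta' split_beta')
qed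

text \<open>
  The iterated integral in the definition is an integral over the product, by Fubini.
\<close>

lemma complex_convolution_pushforward:
  assumes \<nu>: "has_complex_density \<nu> M h" and \<rho>: "has_complex_density \<rho> N k"
  shows "complex_convolution \<nu> \<rho> = (\<lambda>A. if A \<in> sets borel then
    (\<integral>p. indicator A (fst p + snd p) * (h (fst p) * k (snd p)) \<partial>(M \<Otimes>\<^sub>M N)) else 0)"
proof
  note H = has_complex_densityD[OF \<nu>] and K = has_complex_densityD[OF \<rho>]
  note [measurable_cong] = H(2) K(2)
  interpret M: finite_measure M by (rule H)
  interpret N: finite_measure N by (rule K)
  interpret pair_sigma_finite M N ..
  have [measurable]: "h \<in> borel_measurable borel" "k \<in> borel_measurable borel" by (rule H K)+
  fix A :: "real set"
  show "complex_convolution \<nu> \<rho> A = (if A \<in> sets borel then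
    (\<integral>p. indicator A (fst p + snd p) * (h (fst p) * k (snd p)) \<partial>(M \<Otimes>\<^sub>M N)) else 0)"
  proof (cases "A \<in> sets borel")
    case True
    note [measurable] = True
    have int: "integrable (M \<Otimes>\<^sub>M N) (\<lambda>(x, y). indicator A (x + y) * (h x * k y))"
      by (rule integrable_product_bounded[OF M.sigma_finite_measure N.sigma_finite_measure H(3) K(3), where C=1])
         (auto simp: indicator_def)
    have inner: "complex_integral \<rho> (\<lambda>y. indicator A (x + y)) = (\<integral>y. indicator A (x + y) * k y \<partial>N)" for x
      by (rule complex_integral_density_bounded[OF \<rho>, where C=1]) (auto simp: indicator_def)
    have "complex_convolution \<nu> \<rho> A = complex_integral \<nu> (\<lambda>x. \<integral>y. indicator A (x + y) * k y \<partial>N)"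
      using True by (simp add: complex_convolution_def inner)
    also have "\<dots> = (\<integral>x. (\<integral>y. indicator A (x + y) * k y \<partial>N) * h x \<partial>M)"
    proof (rule complex_integral_density_bounded[OF \<nu>])
      fix x
      have "norm (\<integral>y. indicator A (x + y) * k y \<partial>N) \<le> (\<integral>y. norm (k y) \<partial>N)"
        using K(3) by (intro Bochner_Integration.integral_norm_bound_integral integrable_bounded_mult[where C=1])
          (auto simp: indicator_def norm_mult)
      then show "norm (\<integral>y. indicator A (x + y) * k y \<partial>N) \<le> (\<integral>y. norm (k y) \<partial>N)" .
    qed measurable
    also have "\<dots> = (\<integral>x. (\<integral>y. indicator A (x + y) * (h x * k y) \<partial>N) \<partial>M)"
    proof (intro Bochner_Integration.integral_cong refl)
      fix x
      have "(\<integral>y. indicator A (x + y) * k y \<partial>N) * h x = (\<integral>y. (indicator A (x + y) * k y) * h x \<partial>N)"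
        by (rule integral_mult_left_zero[symmetric])
      then show "(\<integral>y. indicator A (x + y) * k y \<partial>N) * h x = (\<integral>y. indicator A (x + y) * (h x * k y) \<partial>N)"
        by (simp add: mult_ac)
    qed
    also have "\<dots> = (\<integral>p. indicator A (fst p + snd p) * (h (fst p) * k (snd p)) \<partial>(M \<Otimes>\<^sub>M N))"
      using integral_fst[OF int] by (simp add: case_prod_beta')
    finally show ?thesis using True by simp
  qed (simp add: complex_convolution_def)
qed

lemma
  assumes "complex_measure \<nu>" "complex_measure \<rho>"
  shows complex_measure_convolution: "complex_measure (complex_convolution \<nu> \<rho>)"
    and complex_char_convolution: "complex_char (complex_convolution \<nu> \<rho>) t = complex_char \<nu> t * complex_char \<rho> t"
proof -
  obtain M h where \<nu>: "has_complex_density \<nu> M h" using complex_measure_has_density[OF assms(1)] .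
  obtain N k where \<rho>: "has_complex_density \<rho> N k" using complex_measure_has_density[OF assms(2)] .
  note H = has_complex_densityD[OF \<nu>] and K = has_complex_densityD[OF \<rho>]
  note [measurable_cong] = H(2) K(2)
  interpret M: finite_measure M by (rule H)
  interpret N: finite_measure N by (rule K)
  interpret pair_sigma_finite M N ..
  have [measurable]: "h \<in> borel_measurable borel" "k \<in> borel_measurable borel" by (rule H K)+
  have int: "integrable (M \<Otimes>\<^sub>M N) (\<lambda>(x, y). b x y * (h x * k y))"
    if "case_prod b \<in> borel_measurable (M \<Otimes>\<^sub>M N)" "\<And>x y. norm (b x y) \<le> 1" for b
    by (rule integrable_product_bounded[OF M.sigma_finite_measure N.sigma_finite_measure H(3) K(3) that])
  have hk: "integrable (M \<Otimes>\<^sub>M N) (\<lambda>p. h (fst p) * k (snd p))"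
    using int[of "\<lambda>_ _. 1"] by (simp add: case_prod_beta')
  show "complex_measure (complex_convolution \<nu> \<rho>)"
    unfolding complex_convolution_pushforward[OF \<nu> \<rho>]
    by (rule complex_measure_pushforward[OF _ hk]) measurable
  have e: "integrable (M \<Otimes>\<^sub>M N) (\<lambda>(x, y). iexp (t * (x + y)) * (h x * k y))"
    by (rule int) auto
  have "complex_char (complex_convolution \<nu> \<rho>) t =
      (\<integral>p. iexp (t * (fst p + snd p)) * (h (fst p) * k (snd p)) \<partial>(M \<Otimes>\<^sub>M N))"
    unfolding complex_char_def
    by (rule complex_integral_pushforward[OF _ hk]) (use e in \<open>auto simp: complex_convolution_pushforward[OF \<nu> \<rho>] case_prod_beta'\<close>)
  also have "\<dots> = (\<integral>x. (\<integral>y. iexp (t * (x + y)) * (h x * k y) \<partial>N) \<partial>M)"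
    using integral_fst[OF e] by (simp add: case_prod_beta')
  also have "\<dots> = (\<integral>x. (\<integral>y. (iexp (t * x) * h x) * (iexp (t * y) * k y) \<partial>N) \<partial>M)"
    by (intro Bochner_Integration.integral_cong refl) (simp add: distrib_left exp_add mult_ac)
  also have "\<dots> = complex_char \<nu> t * complex_char \<rho> t"
    by (simp add: complex_char_density[OF \<nu>] complex_char_density[OF \<rho>])
  finally show "complex_char (complex_convolution \<nu> \<rho>) t = complex_char \<nu> t * complex_char \<rho> t" .
qed

lemma
  assumes "complex_measure \<nu>"
  shows complex_measure_convolution_power: "complex_measure (convolution_power \<nu> l)"
    and complex_char_convolution_power: "complex_char (convolution_power \<nu> l) t = complex_char \<nu> t ^ l"
proof (induction l)
  case 0
  interpret prob_space "return borel (0::real)" by (rule prob_space_return) simp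
  have "char (return borel 0) t = 1"
    unfolding char_def by (subst integral_return) auto
  then show "complex_measure (convolution_power \<nu> 0)" "complex_char (convolution_power \<nu> 0) t = complex_char \<nu> t ^ 0"
    using complex_measure_of_measure[of "return borel (0::real)"] complex_char_of_measure[of "return borel (0::real)"]
    by (simp_all add: finite_measure_axioms)
next
  case (Suc l)
  then show "complex_measure (convolution_power \<nu> (Suc l))"
    "complex_char (convolution_power \<nu> (Suc l)) t = complex_char \<nu> t ^ Suc l"
    using complex_measure_convolution[OF assms Suc(1)] complex_char_convolution[OF assms Suc(1)] by simp_all
qed

lemma
  assumes "finite_measure \<mu>s" "sets \<mu>s = sets borel"
  shows complex_measure_complementary: "complex_measure (complementary_measure \<mu>s)"
    and complex_char_complementary: "complex_char (complementary_measure \<mu>s) t = 1 - char \<mu>s t"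
proof -
  interpret prob_space "return borel (0::real)" by (rule prob_space_return) simp
  have d: "complex_measure (of_measure (return borel (0::real)))"
    by (rule complex_measure_of_measure) (auto simp: finite_measure_axioms)
  have m: "complex_measure (of_measure \<mu>s)" by (rule complex_measure_of_measure[OF assms])
  have eq: "complementary_measure \<mu>s = (\<lambda>A. of_measure (return borel 0) A + (- 1) * of_measure \<mu>s A)"
    by (auto simp: complementary_measure_def)
  show "complex_measure (complementary_measure \<mu>s)"
    unfolding eq by (intro complex_measure_add complex_measure_mult d m)
  have "char (return borel 0) t = 1"
    unfolding char_def by (subst integral_return) auto
  then show "complex_char (complementary_measure \<mu>s) t = 1 - char \<mu>s t"
    unfolding eq complex_char_add_scaled[OF d m]
    using complex_char_of_measure[of "return borel (0::real)" t] complex_char_of_measure[OF assms, of t]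
    by (simp add: finite_measure_axioms)
qed

lemma complex_char_sum:
  assumes "finite I" "\<And>i. i \<in> I \<Longrightarrow> complex_measure (\<nu> i)"
  shows "complex_char (\<lambda>A. \<Sum>i\<in>I. \<nu> i A) t = (\<Sum>i\<in>I. complex_char (\<nu> i) t)"
  using assms
proof (induction I rule: finite_induct)
  case empty
  have "has_complex_density (\<lambda>_. 0) (return borel 0) (\<lambda>_. 0)"
    unfolding has_complex_density_def using prob_space_return[of 0 borel, THEN prob_space.axioms(1)]
    by auto
  from complex_char_density[OF this] show ?case by simp
next
  case (insert i I)
  have "complex_char (\<lambda>A. \<nu> i A + 1 * (\<Sum>i\<in>I. \<nu> i A)) t = complex_char (\<nu> i) t + 1 * complex_char (\<lambda>A. \<Sum>i\<in>I. \<nu> i A) t"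
    using insert by (intro complex_char_add_scaled complex_measure_sum) auto
  with insert show ?case by simp
qed

lemma stieltjes_measure_eqI:
  assumes "complex_measure \<nu>" "\<And>a b. a \<le> b \<Longrightarrow> \<nu> {a<..b} = G b - G a"
  shows "stieltjes_measure G = \<nu>"
  unfolding stieltjes_measure_def
  using assms by (intro the_equality) (auto intro!: complex_measure_eqI)

lemma complex_cdf_diff:
  assumes "complex_measure \<nu>" "a \<le> b"
  shows "\<nu> {a<..b} = complex_cdf \<nu> b - complex_cdf \<nu> a"
  using complex_measure_Un[OF assms(1), of "{..a}" "{a<..b}"] assms(2)
  by (simp add: complex_cdf_def ivl_disj_un_one(3) ivl_disj_int_one(3))

text \<open>
  The kernel is the distribution function of the sum of the convolution powers, so its Stieltjes measure is this sum.
\<close>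

lemma stieltjes_measure_deconv_kernel:
  fixes m :: nat
  assumes "finite_measure \<mu>s" "sets \<mu>s = sets borel"
  defines "K \<equiv> (\<lambda>A. \<Sum>l=0..m. convolution_power (complementary_measure \<mu>s) l A)"
  shows "complex_measure K"
    and "stieltjes_measure (\<lambda>x. deconv_kernel \<mu>s x m) = K"
    and "complex_char K t = (\<Sum>l=0..m. (1 - char \<mu>s t) ^ l)"
proof -
  note cm = complex_measure_convolution_power[OF complex_measure_complementary[OF assms(1,2)]]
  show K: "complex_measure K" unfolding K_def by (rule complex_measure_sum) (rule cm)
  show "stieltjes_measure (\<lambda>x. deconv_kernel \<mu>s x m) = K"
    by (rule stieltjes_measure_eqI[OF K])
       (simp add: complex_cdf_diff[OF K] deconv_kernel_def, simp add: K_def complex_cdf_def)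
  show "complex_char K t = (\<Sum>l=0..m. (1 - char \<mu>s t) ^ l)"
    unfolding K_def
    by (subst complex_char_sum) (auto simp: cm complex_char_convolution_power
        complex_measure_complementary complex_char_complementary assms(1,2))
qed

section \<open>Stieltjes measures of functions of bounded variation\<close>

lemma finite_interval_measure:
  assumes mono: "\<And>x y. x \<le> y \<Longrightarrow> F x \<le> F y" and rc: "\<And>a. continuous (at_right a) F"
    and C: "\<And>x. \<bar>F x\<bar> \<le> C"
  shows "finite_measure (interval_measure F)"
proof (rule finite_measureI)
  let ?M = "interval_measure F"
  have UN: "(\<Union>n::nat. {- real n <.. real n}) = UNIV"
  proof (intro set_eqI iffI UNIV_I)
    fix x :: real
    obtain n where "\<bar>x\<bar> < real n" using reals_Archimedean2 by blast
    then show "x \<in> (\<Union>n::nat. {- real n <.. real n})" by (auto intro!: exI[of _ n])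
  qed
  have "(SUP n::nat. emeasure ?M {- real n <.. real n}) = emeasure ?M (\<Union>n::nat. {- real n <.. real n})"
    by (rule SUP_emeasure_incseq) (auto simp: incseq_def)
  moreover have "(SUP n::nat. emeasure ?M {- real n <.. real n}) \<le> ennreal (2 * C)"
  proof (rule SUP_least)
    fix n :: nat
    have "emeasure ?M {- real n <.. real n} = ennreal (F (real n) - F (- real n))"
      by (rule emeasure_interval_measure_Ioc) (auto intro: mono rc)
    also have "\<dots> \<le> ennreal (2 * C)"
      using C[of "real n"] C[of "- real n"] by (intro ennreal_leI) linarith
    finally show "emeasure ?M {- real n <.. real n} \<le> ennreal (2 * C)" .
  qed
  ultimately show "emeasure ?M (space ?M) \<noteq> \<infinity>"
    unfolding UN by (auto simp: top_unique)
qed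

text \<open>
  Passing to right limits makes a monotone function right-continuous, as needed for an interval measure.
\<close>

lemma mono_right_limit:
  fixes V :: "real \<Rightarrow> real"
  assumes V: "mono V"
  defines "W \<equiv> \<lambda>x. Inf (V ` {x<..})"
  shows "\<And>x y. x \<le> y \<Longrightarrow> W x \<le> W y" "\<And>x. (V \<longlongrightarrow> W x) (at_right x)"
    "\<And>x. continuous (at_right x) W" "\<And>x y. x < y \<Longrightarrow> W x \<le> V y" "\<And>x. V x \<le> W x"
proof -
  have mono: "V x \<le> V y" if "x \<le> y" for x y using V that by (rule monoD)
  have bdd: "bdd_below (V ` {x<..})" for x by (rule bdd_belowI[of _ "V x"]) (auto intro: mono)
  show up: "W x \<le> V y" if "x < y" for x y
    unfolding W_def by (rule cINF_lower[OF bdd]) (use that in simp)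
  have low: "c \<le> W x" if "\<And>y. x < y \<Longrightarrow> c \<le> V y" for c x
    unfolding W_def using that gt_ex[of x] by (intro cINF_greatest) auto
  show W_mono: "W x \<le> W y" if "x \<le> y" for x y
    using that by (intro low up) simp
  have lim: "(H \<longlongrightarrow> W x) (at_right x)" if H: "\<And>t. x < t \<Longrightarrow> W x \<le> H t" "\<And>t y. t < y \<Longrightarrow> H t \<le> V y" for H x
  proof (rule order_tendstoI)
    fix a assume "a < W x"
    then have "\<forall>t>x. a < H t" using H(1) less_le_trans by blast
    then show "\<forall>\<^sub>F t in at_right x. a < H t"
      by (auto simp: eventually_at_right_field intro!: exI[of _ "x + 1"])
  next
    fix a assume "W x < a"
    then obtain y where y: "x < y" "V y < a"
      unfolding W_def using cInf_lessD[of "V ` {x<..}" a] gt_ex[of x] by auto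
    then show "\<forall>\<^sub>F t in at_right x. H t < a"
      using H(2) by (auto simp: eventually_at_right_field intro!: exI[of _ y] intro: le_less_trans)
  qed
  show "(V \<longlongrightarrow> W x) (at_right x)" for x by (rule lim) (auto intro: up mono)
  show "continuous (at_right x) W" for x
    unfolding continuous_within by (rule lim) (auto intro: up W_mono)
  show "V x \<le> W x" for x by (rule low) (auto intro: mono)
qed

text \<open>
  Let \<open>W\<close> be the right-continuous version of the variation function \<open>V\<close>. With \<open>V - Re G\<close> also its right
  limit \<open>W - Re G\<close> is increasing, and likewise for \<open>Im G\<close>. So \<open>Re G = W - (W - Re G)\<close> and \<open>Im G = W - (W - Im G)\<close>
  are differences of increasing right-continuous functions.
\<close>

lemma complex_measure_of_bounded_variation:
  fixes G :: "real \<Rightarrow> complex" and V :: "real \<Rightarrow> real"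
  assumes rc: "\<And>a. continuous (at_right a) G"
    and V: "\<And>x y. x \<le> y \<Longrightarrow> norm (G y - G x) \<le> V y - V x" and bd: "\<And>x. \<bar>V x\<bar> \<le> C"
  obtains \<nu> where "complex_measure \<nu>" "\<And>a b. a \<le> b \<Longrightarrow> \<nu> {a<..b} = G b - G a"
proof -
  have "V x \<le> V y" if "x \<le> y" for x y using V[OF that] norm_ge_zero[of "G y - G x"] by linarith
  then have "mono V" by (rule monoI)
  define W where "W x = Inf (V ` {x<..})" for x
  note W = mono_right_limit[OF \<open>mono V\<close>, folded W_def]
  have W_bd: "\<bar>W x\<bar> \<le> C" for x
    using W(4)[of x "x + 1"] W(5)[of x] bd[of x] bd[of "x + 1"] by linarith
  have G_bd: "norm (G x) \<le> norm (G 0) + 2 * C" for x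
  proof -
    have "norm (G x - G 0) \<le> 2 * C"
      using V[of x 0] V[of 0 x] bd[of x] bd[of 0] by (cases "x \<le> 0") (auto simp: norm_minus_commute)
    then show ?thesis using norm_triangle_sub[of "G x" "G 0"] by linarith
  qed
  have part: "finite_measure (interval_measure (\<lambda>x. W x - g x)) \<and>
      (\<forall>a b. a \<le> b \<longrightarrow> measure (interval_measure (\<lambda>x. W x - g x)) {a<..b} = (W b - g b) - (W a - g a))"
    if g: "\<And>x y. x \<le> y \<Longrightarrow> \<bar>g y - g x\<bar> \<le> norm (G y - G x)" "\<And>a. continuous (at_right a) g" "\<And>x. \<bar>g x\<bar> \<le> norm (G x)"
    for g :: "real \<Rightarrow> real"
  proof -
    have mono: "W x - g x \<le> W y - g y" if "x \<le> y" for x y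
    proof (cases "x = y")
      case False
      with that have "x < y" by simp
      have *: "V s - g s \<le> V t - g t" if "s \<le> t" for s t
        using V[OF that] g(1)[OF that] by linarith
      have l: "((\<lambda>t. V t - g t) \<longlongrightarrow> W z - g z) (at_right z)" for z
        using g(2)[of z] by (intro tendsto_diff W) (simp add: continuous_within)
      have "W x - g x \<le> V y - g y"
        using \<open>x < y\<close> by (intro tendsto_upperbound[OF l])
          (auto simp: eventually_at_right_field intro!: exI[of _ y] *)
      also have "\<dots> \<le> W y - g y" using W(5)[of y] by simp
      finally show ?thesis .
    qed simp
    have rc': "continuous (at_right a) (\<lambda>x. W x - g x)" for a by (intro continuous_diff W g)
    have "\<bar>W x - g x\<bar> \<le> C + (norm (G 0) + 2 * C)" for x
      using W_bd[of x] g(3)[of x] G_bd[of x] by linarith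
    from finite_interval_measure[OF mono rc' this] show ?thesis
      using measure_interval_measure_Ioc[OF _ mono rc'] by simp
  qed
  let ?A = "interval_measure (\<lambda>x. W x - 0)"
  let ?B = "interval_measure (\<lambda>x. W x - Re (G x))"
  let ?D = "interval_measure (\<lambda>x. W x - Im (G x))"
  have A: "finite_measure ?A" "\<And>a b. a \<le> b \<Longrightarrow> measure ?A {a<..b} = (W b - 0) - (W a - 0)"
    using part[of "\<lambda>_. 0"] by auto
  have B: "finite_measure ?B" "\<And>a b. a \<le> b \<Longrightarrow> measure ?B {a<..b} = (W b - Re (G b)) - (W a - Re (G a))"
    using part[of "\<lambda>x. Re (G x)"] abs_Re_le_cmod[of "G _ - G _"] rc
    by (auto simp: abs_Re_le_cmod intro!: continuous_Re)
  have D: "finite_measure ?D" "\<And>a b. a \<le> b \<Longrightarrow> measure ?D {a<..b} = (W b - Im (G b)) - (W a - Im (G a))"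
    using part[of "\<lambda>x. Im (G x)"] abs_Im_le_cmod[of "G _ - G _"] rc
    by (auto simp: abs_Im_le_cmod intro!: continuous_Im)
  show thesis
  proof (rule that)
    show "complex_measure (\<lambda>E. (of_measure ?A E - of_measure ?B E) + \<i> * (of_measure ?A E - of_measure ?D E))"
      using A(1) B(1) D(1)
      by (intro complex_measure_add complex_measure_diff complex_measure_mult complex_measure_of_measure) auto
    show "(of_measure ?A {a<..b} - of_measure ?B {a<..b}) + \<i> * (of_measure ?A {a<..b} - of_measure ?D {a<..b}) = G b - G a"
      if "a \<le> b" for a b
      unfolding of_measure_def A(2)[OF that] B(2)[OF that] D(2)[OF that] by (simp add: complex_eq_iff)
  qed
qed

text \<open>
  Here \<open>V x\<close> is the variation of \<open>\<phi>\<close> on \<open>[T0, max T0 x]\<close>. Appending the points \<open>max T0 x\<close> and \<open>max T0 y\<close> to a partition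
  for \<open>x\<close> gives a partition for \<open>y\<close> whose sum is larger by at least the increment of \<open>\<phi>\<close>.
\<close>

lemma bounded_variation_on_control:
  fixes \<phi> :: "ereal \<Rightarrow> complex"
  assumes bv: "bounded_variation_on \<phi> {ereal T0..\<infinity>}"
  obtains V C where
    "\<And>x y. x \<le> y \<Longrightarrow> norm (\<phi> (ereal (max T0 y)) - \<phi> (ereal (max T0 x))) \<le> V y - V x" "\<And>x::real. \<bar>V x\<bar> \<le> C"
proof -
  define vs where "vs xs = (\<Sum>i<length xs - 1. norm (\<phi> (xs ! Suc i) - \<phi> (xs ! i)))" for xs
  define S where "S x = {xs. sorted xs \<and> set xs \<subseteq> {ereal T0..ereal (max T0 x)}}" for x
  define V where "V x = (SUP xs\<in>S x. vs xs)" for x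
  obtain M where M: "\<And>xs. sorted xs \<Longrightarrow> set xs \<subseteq> {ereal T0..\<infinity>} \<Longrightarrow> vs xs \<le> M"
    using bv unfolding bounded_variation_on_def vs_def by blast
  have vsM: "vs xs \<le> M" if "xs \<in> S x" for x xs
    using that by (intro M) (auto simp: S_def)
  have bdd: "bdd_above (vs ` S x)" for x by (rule bdd_aboveI[of _ M]) (auto intro: vsM)
  have nil: "[] \<in> S x" for x by (simp add: S_def)
  have step: "vs xs + norm (\<phi> q - \<phi> p) \<le> vs (xs @ [p, q])" for xs p q
  proof -
    let ?t = "\<lambda>i. norm (\<phi> ((xs @ [p, q]) ! Suc i) - \<phi> ((xs @ [p, q]) ! i))"
    have "vs (xs @ [p, q]) = (\<Sum>i<length xs. ?t i) + norm (\<phi> q - \<phi> p)"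
      unfolding vs_def by (simp add: nth_append)
    moreover have "vs xs \<le> (\<Sum>i<length xs. ?t i)"
    proof -
      have "vs xs = (\<Sum>i<length xs - 1. ?t i)"
        unfolding vs_def by (intro sum.cong) (auto simp: nth_append)
      also have "\<dots> \<le> (\<Sum>i<length xs. ?t i)" by (rule sum_mono2) auto
      finally show ?thesis .
    qed
    ultimately show ?thesis by simp
  qed
  show thesis
  proof (rule that[of V M])
    fix x y :: real assume "x \<le> y"
    let ?p = "ereal (max T0 x)" and ?q = "ereal (max T0 y)"
    have "V x \<le> V y - norm (\<phi> ?q - \<phi> ?p)"
      unfolding V_def[of x]
    proof (rule cSUP_least)
      fix xs assume xs: "xs \<in> S x"
      have pq: "?p \<le> ?q" "ereal T0 \<le> ?p" unfolding ereal_less_eq using \<open>x \<le> y\<close> by auto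
      have "xs @ [?p, ?q] \<in> S y"
        using xs pq unfolding S_def by (auto simp: sorted_append subset_eq simp del: ereal_max intro: order_trans)
      then have "vs (xs @ [?p, ?q]) \<le> V y"
        unfolding V_def by (intro cSUP_upper bdd)
      with step[of xs ?q ?p] show "vs xs \<le> V y - norm (\<phi> ?q - \<phi> ?p)" by simp
    qed (use nil in blast)
    then show "norm (\<phi> ?q - \<phi> ?p) \<le> V y - V x" by simp
  next
    fix x
    have "vs [] \<le> V x" unfolding V_def by (intro cSUP_upper nil bdd)
    moreover have "V x \<le> M" unfolding V_def using nil vsM by (intro cSUP_least) blast+
    ultimately show "\<bar>V x\<bar> \<le> M" by (simp add: vs_def)
  qed
qed

text \<open>
  The half-line is cut into unit intervals, and the sum of their masses telescopes.
\<close>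

lemma complex_measure_tail:
  assumes \<nu>: "complex_measure \<nu>" and G: "\<And>a b. a \<le> b \<Longrightarrow> \<nu> {a<..b} = G b - G a" and lim: "(G \<longlongrightarrow> 0) at_top"
  shows "\<nu> {t<..} = - G t"
proof -
  let ?A = "\<lambda>n::nat. {t + real n <.. t + real (Suc n)}"
  have "disjoint_family ?A"
    unfolding disjoint_family_on_def
  proof (intro ballI impI)
    fix m n :: nat assume "m \<noteq> n"
    then have "real (Suc m) \<le> real n \<or> real (Suc n) \<le> real m" unfolding of_nat_le_iff by linarith
    then show "?A m \<inter> ?A n = {}" by auto
  qed
  moreover have "(\<Union>n. ?A n) = {t<..}"
  proof (intro set_eqI iffI)
    fix x assume x: "x \<in> {t<..}"
    define n where "n = nat (\<lceil>x - t\<rceil> - 1)"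
    have "real n = real_of_int \<lceil>x - t\<rceil> - 1" using x by (simp add: n_def)
    then have "x \<in> ?A n" using ceiling_correct[of "x - t"] by (simp, linarith)
    then show "x \<in> (\<Union>n. ?A n)" by blast
  qed auto
  ultimately have "(\<lambda>n. \<nu> (?A n)) sums \<nu> {t<..}"
    using complex_measure_sums[OF \<nu>, of ?A] by simp
  moreover have "\<nu> (?A n) = G (t + real (Suc n)) - G (t + real n)" for n by (rule G) simp
  moreover have "(\<lambda>n. G (t + real (Suc n)) - G (t + real n)) sums (0 - G (t + real 0))"
  proof (rule telescope_sums)
    show "(\<lambda>n. G (t + real n)) \<longlonglongrightarrow> 0"
      by (rule filterlim_compose[OF lim])
         (auto intro!: filterlim_tendsto_add_at_top[OF tendsto_const] filterlim_real_sequentially)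
  qed
  ultimately show ?thesis by (auto dest: sums_unique2)
qed

lemma stieltjes_measure_bounded_variation:
  fixes \<phi> :: "ereal \<Rightarrow> complex"
  assumes cont: "continuous_on {ereal T0..\<infinity>} \<phi>" and bv: "bounded_variation_on \<phi> {ereal T0..\<infinity>}"
    and lim: "((\<lambda>t. \<phi> (ereal t)) \<longlongrightarrow> 0) at_top"
  defines "\<nu> \<equiv> stieltjes_measure (\<lambda>u. \<phi> (ereal (max T0 u)))"
  shows "complex_measure \<nu>" "\<And>t. T0 \<le> t \<Longrightarrow> \<nu> {t<..} = - \<phi> (ereal t)"
proof -
  let ?G = "\<lambda>u. \<phi> (ereal (max T0 u))"
  have "continuous_on UNIV ?G"
    by (rule continuous_on_compose2[OF cont]) (auto intro!: continuous_intros)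
  then have rc: "continuous (at_right a) ?G" for a
    using continuous_on_eq_continuous_at[of UNIV ?G] continuous_at_imp_continuous_at_within by auto
  obtain V C where V: "\<And>x y. x \<le> y \<Longrightarrow> norm (?G y - ?G x) \<le> V y - V x" "\<And>x::real. \<bar>V x\<bar> \<le> C"
    using bounded_variation_on_control[OF bv] by metis
  obtain \<rho> where \<rho>: "complex_measure \<rho>" "\<And>a b. a \<le> b \<Longrightarrow> \<rho> {a<..b} = ?G b - ?G a"
    using complex_measure_of_bounded_variation[OF rc V] by metis
  have eq: "\<nu> = \<rho>" unfolding \<nu>_def by (rule stieltjes_measure_eqI[OF \<rho>])
  show "complex_measure \<nu>" unfolding eq by (rule \<rho>)
  have "(?G \<longlongrightarrow> 0) at_top"
    by (rule Lim_transform_eventually[OF lim])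
       (auto intro!: eventually_mono[OF eventually_ge_at_top[of T0]] simp: max_def)
  from complex_measure_tail[OF \<rho> this] show "\<nu> {t<..} = - \<phi> (ereal t)" if "T0 \<le> t" for t
    unfolding eq using that by (simp add: max_def)
qed

section \<open>Fourier inversion of densities\<close>

definition inversion_integral :: "(real \<Rightarrow> complex) \<Rightarrow> real \<Rightarrow> real \<Rightarrow> complex" where
  "inversion_integral \<Phi> R x = 1 / (2 * of_real pi) * (\<integral>t\<in>{-R..R}. iexp (- (x * t)) * \<Phi> t \<partial>lborel)"

lemma integral_iexp_Icc:
  fixes a b y :: real
  assumes "a \<le> b" "y \<noteq> 0"
  shows "(\<integral>t\<in>{a..b}. iexp (y * t) \<partial>lborel) = (iexp (y * b) - iexp (y * a)) / (\<i> * y)"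
proof -
  have "(\<integral>t. indicator {a..b} t *\<^sub>R iexp (y * t) \<partial>lborel) = iexp (y * b) / (\<i> * y) - iexp (y * a) / (\<i> * y)"
  proof (rule integral_FTC_Icc[OF \<open>a \<le> b\<close>])
    fix x
    show "((\<lambda>t. iexp (y * t) / (\<i> * y)) has_vector_derivative iexp (y * x)) (at x within {a..b})"
      using \<open>y \<noteq> 0\<close> by (auto intro!: derivative_eq_intros has_vector_derivative_real_field simp: scaleR_conv_of_real has_vector_derivative_complex_iff)
  qed (auto intro!: continuous_intros)
  then show ?thesis by (simp add: set_lebesgue_integral_def diff_divide_distrib)
qed

lemma set_integrable_iexp_bounded:
  assumes [measurable]: "\<Phi> \<in> borel_measurable borel" and "\<And>t. norm (\<Phi> t) \<le> C"
  shows "set_integrable lborel {a..b::real} (\<lambda>t. iexp (x * t) * \<Phi> t)"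
  unfolding set_integrable_def
  by (rule integrableI_bounded_set_indicator[where B=C]) (auto simp: norm_mult assms(2) emeasure_lborel_Icc_eq)

lemma continuous_inversion_integral:
  assumes [measurable]: "\<Phi> \<in> borel_measurable borel" and C: "\<And>t. norm (\<Phi> t) \<le> C"
  shows "continuous_on UNIV (inversion_integral \<Phi> R)"
  unfolding continuous_on_eq_continuous_at[OF open_UNIV]
proof
  fix x
  show "isCont (inversion_integral \<Phi> R) x"
    unfolding continuous_at_sequentially
  proof (intro allI impI)
    fix X :: "nat \<Rightarrow> real" assume X: "X \<longlonglongrightarrow> x"
    have "(\<lambda>n. \<integral>t. indicator {-R..R} t *\<^sub>R (iexp (- (X n * t)) * \<Phi> t) \<partial>lborel) \<longlonglongrightarrow>
        (\<integral>t. indicator {-R..R} t *\<^sub>R (iexp (- (x * t)) * \<Phi> t) \<partial>lborel)"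
    proof (rule integral_dominated_convergence[where w="\<lambda>t. indicator {-R..R} t * \<bar>C\<bar>"])
      show "AE t in lborel. (\<lambda>n. indicator {-R..R} t *\<^sub>R (iexp (- (X n * t)) * \<Phi> t)) \<longlonglongrightarrow>
          indicator {-R..R} t *\<^sub>R (iexp (- (x * t)) * \<Phi> t)"
        using X by (intro AE_I2 tendsto_intros)
      have "norm (\<Phi> t) \<le> \<bar>C\<bar>" for t using C[of t] by linarith
      then show "AE t in lborel. norm (indicator {-R..R} t *\<^sub>R (iexp (- (X n * t)) * \<Phi> t)) \<le> indicator {-R..R} t * \<bar>C\<bar>" for n
        by (auto simp: norm_mult indicator_def)
    qed (auto simp: emeasure_lborel_Icc_eq)
    then show "(inversion_integral \<Phi> R \<circ> X) \<longlonglongrightarrow> inversion_integral \<Phi> R x"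
      unfolding comp_def inversion_integral_def set_lebesgue_integral_def by (intro tendsto_intros)
  qed
qed

text \<open>
  Fubini on a rectangle; the integrand on the right is the one in Levy's inversion formula. At \<open>t = 0\<close> its quotient
  has the default value 0 instead of \<open>b - a\<close>; a single point does not contribute.
\<close>

lemma integral_inversion_integral:
  assumes \<Phi>[measurable]: "\<Phi> \<in> borel_measurable borel" and C: "\<And>t. norm (\<Phi> t) \<le> C" and "a \<le> b"
  shows "(\<integral>x\<in>{a..b}. inversion_integral \<Phi> R x \<partial>lborel) =
    1 / (2 * of_real pi) * (\<integral>t\<in>{-R..R}. (iexp (- (t * a)) - iexp (- (t * b))) / (\<i> * t) * \<Phi> t \<partial>lborel)"
proof -
  have i1: "integrable lborel (\<lambda>x. indicator {a..b} x :: complex)"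
  proof -
    have "integrable lborel (\<lambda>x. complex_of_real (indicator {a..b} x))"
      by (intro integrable_of_real) (simp add: emeasure_lborel_Icc_eq)
    then show ?thesis by (simp only: of_real_indicator)
  qed
  have i2: "integrable lborel (\<lambda>t. indicator {-R..R} t * \<Phi> t)"
    using set_integrable_iexp_bounded[OF \<Phi> C, of "-R" R 0]
    by (simp add: set_integrable_def scaleR_conv_of_real of_real_indicator)
  have int: "integrable (lborel \<Otimes>\<^sub>M lborel) (\<lambda>(x, t). iexp (- (x * t)) * (indicator {a..b} x * (indicator {-R..R} t * \<Phi> t)))"
    by (rule integrable_product_bounded[OF _ _ i1 i2, where C=1]) (auto intro: lborel.sigma_finite_measure_axioms)
  have "(\<integral>x\<in>{a..b}. (\<integral>t\<in>{-R..R}. iexp (- (x * t)) * \<Phi> t \<partial>lborel) \<partial>lborel)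
      = (\<integral>x. (\<integral>t. iexp (- (x * t)) * (indicator {a..b} x * (indicator {-R..R} t * \<Phi> t)) \<partial>lborel) \<partial>lborel)"
    unfolding set_lebesgue_integral_def
  proof (intro Bochner_Integration.integral_cong refl)
    fix x :: real
    show "indicator {a..b} x *\<^sub>R (\<integral>t. indicator {-R..R} t *\<^sub>R (iexp (- (x * t)) * \<Phi> t) \<partial>lborel) =
      (\<integral>t. iexp (- (x * t)) * (indicator {a..b} x * (indicator {-R..R} t * \<Phi> t)) \<partial>lborel)"
      by (cases "x \<in> {a..b}") (auto intro!: Bochner_Integration.integral_cong simp: indicator_def)
  qed
  also have "\<dots> = (\<integral>t. (\<integral>x. iexp (- (x * t)) * (indicator {a..b} x * (indicator {-R..R} t * \<Phi> t)) \<partial>lborel) \<partial>lborel)"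
    by (rule lborel_pair.Fubini_integral[OF int, symmetric])
  also have "\<dots> = (\<integral>t\<in>{-R..R}. (iexp (- (t * a)) - iexp (- (t * b))) / (\<i> * t) * \<Phi> t \<partial>lborel)"
    unfolding set_lebesgue_integral_def
  proof (rule integral_cong_AE)
    show "AE t in lborel. (\<integral>x. iexp (- (x * t)) * (indicator {a..b} x * (indicator {-R..R} t * \<Phi> t)) \<partial>lborel) =
        indicator {-R..R} t *\<^sub>R ((iexp (- (t * a)) - iexp (- (t * b))) / (\<i> * t) * \<Phi> t)"
      using AE_lborel_singleton[of 0]
    proof eventually_elim
      case (elim t)
      have "(\<integral>x. iexp (- (x * t)) * (indicator {a..b} x * (indicator {-R..R} t * \<Phi> t)) \<partial>lborel)
         = (\<integral>x. (indicator {a..b} x *\<^sub>R iexp (- t * x)) * (indicator {-R..R} t * \<Phi> t) \<partial>lborel)"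
        by (intro Bochner_Integration.integral_cong) (auto simp: indicator_def mult.commute)
      also have "\<dots> = (iexp (- t * b) - iexp (- t * a)) / (\<i> * (- t)) * (indicator {-R..R} t * \<Phi> t)"
        unfolding integral_mult_left_zero using integral_iexp_Icc[OF \<open>a \<le> b\<close>, of "- t"] elim
        by (simp add: set_lebesgue_integral_def)
      also have "\<dots> = indicator {-R..R} t *\<^sub>R ((iexp (- (t * a)) - iexp (- (t * b))) / (\<i> * t) * \<Phi> t)"
        using elim by (auto simp: indicator_def field_simps)
      finally show ?case .
    qed
  qed measurable
  finally show ?thesis unfolding inversion_integral_def by simp
qed

lemma (in real_distribution) integral_inversion_integral_tendsto:
  assumes "a \<le> b" "measure M {a} = 0" "measure M {b} = 0"
  shows "(\<lambda>n::nat. \<integral>x\<in>{a..b}. inversion_integral (char M) (real n) x \<partial>lborel) \<longlonglongrightarrow> measure M {a<..b}"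
proof -
  show ?thesis
    using Levy_Inversion[OF assms]
    by (subst integral_inversion_integral[OF char_measurable cmod_char_le_1 assms(1)])
       (simp add: interval_integral_Icc)
qed

lemma has_density_integral:
  assumes M: "real_distribution M" and f: "has_density M f"
  shows "integrable lborel f" and "\<And>A. A \<in> sets borel \<Longrightarrow> measure M A = (\<integral>x. indicator A x * f x \<partial>lborel)"
proof -
  interpret real_distribution M by (rule M)
  have [measurable]: "f \<in> borel_measurable borel" and nn: "AE x in lborel. 0 \<le> f x"
    and Mf: "M = density lborel (\<lambda>x. ennreal (f x))"
    using f unfolding has_density_def by auto
  show int: "integrable lborel f"
  proof (rule integrableI_nonneg)
    have "emeasure M UNIV = (\<integral>\<^sup>+x. f x \<partial>lborel)" unfolding Mf by (subst emeasure_density) auto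
    then show "(\<integral>\<^sup>+x. f x \<partial>lborel) < \<infinity>" using emeasure_finite[of UNIV] by (simp add: top.not_eq_extremum)
  qed (use nn in auto)
  fix A :: "real set" assume A[measurable]: "A \<in> sets borel"
  have "measure M A = measure (density lborel (\<lambda>x. ennreal (max 0 (f x)))) A" unfolding Mf by simp
  also have "\<dots> = (\<integral>x. indicator A x * max 0 (f x) \<partial>lborel)"
    by (rule measure_density_integral) (use int in auto)
  also have "\<dots> = (\<integral>x. indicator A x * f x \<partial>lborel)"
    using nn by (intro integral_cong_AE) auto
  finally show "measure M A = (\<integral>x. indicator A x * f x \<partial>lborel)" .
qed

text \<open>
  The real and the imaginary part have real densities, for which uniqueness is known.
\<close>

lemma complex_density_unique:
  fixes u v :: "'a \<Rightarrow> complex"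
  assumes u: "integrable M u" and v: "integrable M v"
    and eq: "\<And>A. A \<in> sets M \<Longrightarrow> (\<integral>x. indicator A x * u x \<partial>M) = (\<integral>x. indicator A x * v x \<partial>M)"
  shows "AE x in M. u x = v x"
proof -
  have ind: "integrable M (\<lambda>x. indicator A x * w x)" if "A \<in> sets M" "integrable M w"
    for A and w :: "'a \<Rightarrow> complex"
    using that by (intro integrable_bounded_mult[where C=1]) (auto simp: indicator_def)
  have Re_ind: "Re (indicator A x * z) = indicator A x *\<^sub>R Re z"
    and Im_ind: "Im (indicator A x * z) = indicator A x *\<^sub>R Im z" for A and x :: 'a and z
    by (simp_all add: indicator_def)
  have re: "AE x in M. Re (u x) = Re (v x)"
  proof (rule density_unique_real)
    fix A assume A: "A \<in> sets M"
    show "(\<integral>x\<in>A. Re (u x) \<partial>M) = (\<integral>x\<in>A. Re (v x) \<partial>M)"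
      using arg_cong[OF eq[OF A], of Re] integral_Re[OF ind[OF A u]] integral_Re[OF ind[OF A v]]
      unfolding set_lebesgue_integral_def Re_ind by simp
  qed (use u v in auto)
  have im: "AE x in M. Im (u x) = Im (v x)"
  proof (rule density_unique_real)
    fix A assume A: "A \<in> sets M"
    show "(\<integral>x\<in>A. Im (u x) \<partial>M) = (\<integral>x\<in>A. Im (v x) \<partial>M)"
      using arg_cong[OF eq[OF A], of Im] integral_Im[OF ind[OF A u]] integral_Im[OF ind[OF A v]]
      unfolding set_lebesgue_integral_def Im_ind by simp
  qed (use u v in auto)
  show ?thesis using re im by eventually_elim (simp add: complex_eq_iff)
qed

text \<open>
  By Levy's formula the integrals of \<open>f\<close> and of \<open>L\<close> agree on all subintervals of \<open>[c, d]\<close>. Hence the complex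
  measures with densities \<open>f\<close> and \<open>L\<close> on \<open>[c, d]\<close> coincide, and so do the densities almost everywhere.
  Uniform convergence supplies the continuity of \<open>L\<close> and the bound for dominated convergence.
\<close>

lemma density_eq_inversion_limit:
  assumes M: "real_distribution M" and f: "has_density M f"
    and L: "uniform_limit {c..d} (\<lambda>n. inversion_integral (char M) (real n)) L sequentially"
  shows "continuous_on {c..d} L" and "AE x in lborel. x \<in> {c..d} \<longrightarrow> complex_of_real (f x) = L x"
proof -
  interpret real_distribution M by (rule M)
  let ?I = "\<lambda>n::nat. inversion_integral (char M) (real n)"
  note fint = has_density_integral[OF M f]
  have I_cont: "continuous_on UNIV (?I n)" for n
    by (rule continuous_inversion_integral[OF char_measurable cmod_char_le_1])
  show cL: "continuous_on {c..d} L"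
    by (rule uniform_limit_theorem[OF _ L]) (auto intro!: always_eventually continuous_on_subset[OF I_cont])
  have [measurable]: "f \<in> borel_measurable borel" using fint(1) by auto
  have [measurable]: "?I n \<in> borel_measurable borel" for n
    by (rule borel_measurable_continuous_onI[OF I_cont])
  define g where "g x = indicator {c..d} x *\<^sub>R L x" for x
  have [measurable]: "g \<in> borel_measurable borel"
    unfolding g_def by (rule borel_measurable_continuous_on_indicator[OF _ cL]) auto
  have g_int: "integrable lborel g"
    using borel_integrable_compact[OF compact_Icc cL] by (simp add: g_def[abs_def])
  have f_int: "integrable lborel (\<lambda>x. complex_of_real (indicator {c..d} x * f x))"
    using integrable_real_mult_indicator[OF _ fint(1), of "{c..d}"]
    by (intro integrable_of_real) (simp add: mult.commute)
  have noatom: "measure M {x} = 0" for x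
  proof -
    have "AE y in lborel. indicator {x} y * f y = 0"
      using AE_lborel_singleton[of x] by eventually_elim auto
    then show ?thesis by (subst fint(2)) (auto simp: integral_eq_zero_AE)
  qed
  define \<nu> where "\<nu> A = (if A \<in> sets borel then \<integral>x. indicator A x * complex_of_real (indicator {c..d} x * f x) \<partial>lborel else 0)" for A
  define \<rho> where "\<rho> A = (if A \<in> sets borel then \<integral>x. indicator A x * g x \<partial>lborel else 0)" for A
  have "\<nu> = \<rho>"
  proof (rule complex_measure_eqI)
    show "complex_measure \<nu>" unfolding \<nu>_def by (rule complex_measure_pushforward[OF _ f_int]) auto
    show "complex_measure \<rho>" unfolding \<rho>_def by (rule complex_measure_pushforward[OF _ g_int]) auto
  next
    fix a b :: real
    let ?a = "max a c" and ?b = "min b d"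
    \<comment> \<open>At these two points the half-open and the closed intervals below may differ.\<close>
    have AE: "AE x in lborel. x \<noteq> a \<and> x \<noteq> ?a"
      using AE_lborel_singleton[of a] AE_lborel_singleton[of ?a] by eventually_elim auto
    have "\<nu> {a<..b} = (\<integral>x. complex_of_real (indicator {?a<..?b} x * f x) \<partial>lborel)"
    proof -
      have "AE x in lborel. indicator {a<..b} x * complex_of_real (indicator {c..d} x * f x)
          = complex_of_real (indicator {?a<..?b} x * f x)"
        using AE by eventually_elim (auto simp: indicator_def)
      then show ?thesis unfolding \<nu>_def by (auto intro!: integral_cong_AE)
    qed
    also have "\<dots> = measure M {?a<..?b}"
      by (simp only: integral_complex_of_real fint(2)[of "{?a<..?b}", symmetric] greaterThanAtMost_borel)
    finally have 1: "\<nu> {a<..b} = measure M {?a<..?b}" .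
    have 2: "\<rho> {a<..b} = (\<integral>x\<in>{?a..?b}. g x \<partial>lborel)"
    proof -
      have "AE x in lborel. indicator {a<..b} x * g x = indicator {?a..?b} x *\<^sub>R g x"
        using AE by eventually_elim (auto simp: indicator_def g_def)
      then show ?thesis unfolding \<rho>_def set_lebesgue_integral_def by (auto intro!: integral_cong_AE)
    qed
    show "\<nu> {a<..b} = \<rho> {a<..b}"
    proof (cases "?a \<le> ?b")
      case False
      then show ?thesis unfolding 1 2 by (auto simp: set_lebesgue_integral_def)
    next
      case True
      have "(\<lambda>n. \<integral>x\<in>{?a..?b}. ?I n x \<partial>lborel) \<longlonglongrightarrow> measure M {?a<..?b}"
        by (rule integral_inversion_integral_tendsto[OF True noatom noatom])
      moreover have "(\<lambda>n. \<integral>x\<in>{?a..?b}. ?I n x \<partial>lborel) \<longlonglongrightarrow> (\<integral>x\<in>{?a..?b}. g x \<partial>lborel)"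
      proof -
        have "\<forall>\<^sub>F n in sequentially. \<forall>x\<in>{c..d}. dist (?I n x) (L x) < 1"
          using uniform_limitD[OF L, of 1] by simp
        then obtain n0 where n0: "\<And>n x. n0 \<le> n \<Longrightarrow> x \<in> {c..d} \<Longrightarrow> dist (?I n x) (L x) < 1"
          unfolding eventually_sequentially by blast
        \<comment> \<open>The shift by \<open>n0\<close> makes the bound by \<open>norm (g x) + 1\<close> hold for every index.\<close>
        have "(\<lambda>n. \<integral>x. indicator {?a..?b} x *\<^sub>R ?I (n + n0) x \<partial>lborel) \<longlonglongrightarrow> (\<integral>x. indicator {?a..?b} x *\<^sub>R g x \<partial>lborel)"
        proof (rule integral_dominated_convergence[where w="\<lambda>x. norm (g x) + indicator {c..d} x"])
          show "integrable lborel (\<lambda>x. norm (g x) + indicator {c..d} x)"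
            using g_int by (intro Bochner_Integration.integrable_add) (auto simp: emeasure_lborel_Icc_eq)
          show "AE x in lborel. (\<lambda>n. indicator {?a..?b} x *\<^sub>R ?I (n + n0) x) \<longlonglongrightarrow> indicator {?a..?b} x *\<^sub>R g x"
          proof (rule AE_I2)
            fix x
            show "(\<lambda>n. indicator {?a..?b} x *\<^sub>R ?I (n + n0) x) \<longlonglongrightarrow> indicator {?a..?b} x *\<^sub>R g x"
            proof (cases "x \<in> {?a..?b}")
              case True
              then have "x \<in> {c..d}" by auto
              then have "(\<lambda>n. ?I n x) \<longlonglongrightarrow> L x" by (rule tendsto_uniform_limitI[OF L])
              from LIMSEQ_ignore_initial_segment[OF this, of n0] show ?thesis
                using True \<open>x \<in> {c..d}\<close> by (simp add: g_def del: of_nat_add)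
            qed simp
          qed
          show "AE x in lborel. norm (indicator {?a..?b} x *\<^sub>R ?I (n + n0) x) \<le> norm (g x) + indicator {c..d} x" for n
          proof (rule AE_I2)
            fix x
            show "norm (indicator {?a..?b} x *\<^sub>R ?I (n + n0) x) \<le> norm (g x) + indicator {c..d} x"
            proof (cases "x \<in> {?a..?b}")
              case True
              then have x: "x \<in> {c..d}" by auto
              have "norm (?I (n + n0) x) \<le> norm (L x) + 1"
                using n0[of "n + n0" x] x norm_triangle_sub[of "?I (n + n0) x" "L x"] by (auto simp: dist_norm)
              then show ?thesis using True x by (simp add: g_def)
            next
              case False
              then have "indicator {?a..?b} x = (0::real)" by (rule indicator_simps)
              then show ?thesis by (simp only: scaleR_zero_left norm_zero) simp
            qed
          qed
        qed (auto simp del: of_nat_add)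
        then show ?thesis unfolding set_lebesgue_integral_def by (rule LIMSEQ_offset)
      qed
      ultimately show ?thesis unfolding 1 2 by (rule LIMSEQ_unique)
    qed
  qed
  then have eq: "(\<integral>x. indicator A x * complex_of_real (indicator {c..d} x * f x) \<partial>lborel) = (\<integral>x. indicator A x * g x \<partial>lborel)"
    if "A \<in> sets borel" for A
    using that unfolding \<nu>_def \<rho>_def by (auto dest!: fun_cong[of _ _ A])
  have "AE x in lborel. complex_of_real (indicator {c..d} x * f x) = g x"
    by (rule complex_density_unique[OF f_int g_int]) (use eq in simp)
  then show "AE x in lborel. x \<in> {c..d} \<longrightarrow> complex_of_real (f x) = L x"
    by eventually_elim (auto simp: g_def)
qed

lemma AE_Icc_frequently:
  fixes c d \<xi> :: real
  assumes "AE x in lborel. x \<in> {c..d} \<longrightarrow> P x"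
  shows "c \<le> \<xi> \<Longrightarrow> \<xi> < d \<Longrightarrow> \<exists>\<^sub>F x in at_right \<xi>. P x"
    and "c < \<xi> \<Longrightarrow> \<xi> \<le> d \<Longrightarrow> \<exists>\<^sub>F x in at_left \<xi>. P x"
proof -
  have null: False if "p < q" "{p<..<q} \<subseteq> {c..d}" "\<And>x. x \<in> {p<..<q} \<Longrightarrow> \<not> P x" for p q
  proof -
    have "AE x in lborel. x \<notin> {p<..<q}" using assms by eventually_elim (use that in auto)
    then have "emeasure lborel {p<..<q} = 0" by (subst (asm) AE_iff_measurable[of "{p<..<q}"]) auto
    then show False using \<open>p < q\<close> by simp
  qed
  show "\<exists>\<^sub>F x in at_right \<xi>. P x" if "c \<le> \<xi>" "\<xi> < d"
  proof (rule ccontr)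
    assume "\<not> ?thesis"
    then obtain b where b: "b > \<xi>" "\<And>x. \<xi> < x \<Longrightarrow> x < b \<Longrightarrow> \<not> P x"
      by (auto simp: frequently_def eventually_at_right_field)
    show False by (rule null[of \<xi> "min b d"]) (use b that in auto)
  qed
  show "\<exists>\<^sub>F x in at_left \<xi>. P x" if "c < \<xi>" "\<xi> \<le> d"
  proof (rule ccontr)
    assume "\<not> ?thesis"
    then obtain b where b: "b < \<xi>" "\<And>x. b < x \<Longrightarrow> x < \<xi> \<Longrightarrow> \<not> P x"
      by (auto simp: frequently_def eventually_at_left_field)
    show False by (rule null[of "max b c" \<xi>]) (use b that in auto)
  qed
qed

lemma tendsto_unique_frequently:
  fixes f g :: "'a \<Rightarrow> complex"
  assumes "\<exists>\<^sub>F x in F. f x = g x" "(f \<longlongrightarrow> l) F" "(g \<longlongrightarrow> m) F"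
  shows "l = m"
proof (rule ccontr)
  assume "l \<noteq> m"
  have "((\<lambda>x. f x - g x) \<longlongrightarrow> l - m) F" using assms by (intro tendsto_diff)
  then have "\<forall>\<^sub>F x in F. f x - g x \<noteq> 0" using \<open>l \<noteq> m\<close> by (intro tendsto_imp_eventually_ne) auto
  then show False using assms(1) by (simp add: frequently_def)
qed

text \<open>
  Every one-sided neighbourhood has positive Lebesgue measure and therefore contains points where \<open>f\<close> agrees with the
  continuous function \<open>L\<close>. So \<open>f\<close> cannot have a jump at \<open>\<xi>\<close>.
\<close>

lemma one_sided_limit_of_density:
  fixes f :: "real \<Rightarrow> real"
  assumes ae: "AE x in lborel. x \<in> {c..d} \<longrightarrow> complex_of_real (f x) = L x"
    and L: "continuous_on {c..d} L" and \<xi>: "c < \<xi>" "\<xi> < d"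
  shows "(f \<longlongrightarrow> p) (at_right \<xi>) \<Longrightarrow> complex_of_real p = L \<xi>"
    and "(f \<longlongrightarrow> p) (at_left \<xi>) \<Longrightarrow> complex_of_real p = L \<xi>"
proof -
  have "isCont L \<xi>"
  proof (rule continuous_on_interior[OF L])
    show "\<xi> \<in> interior {c..d}" by (rule interiorI[of "{c<..<d}"]) (use \<xi> in auto)
  qed
  then have l: "(L \<longlongrightarrow> L \<xi>) (at_right \<xi>)" "(L \<longlongrightarrow> L \<xi>) (at_left \<xi>)"
    unfolding isCont_def by (auto intro: tendsto_mono[OF at_le])
  show "complex_of_real p = L \<xi>" if "(f \<longlongrightarrow> p) (at_right \<xi>)"
    by (rule tendsto_unique_frequently[OF AE_Icc_frequently(1)[OF ae] tendsto_of_real[OF that] l(1)])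
       (use \<xi> in auto)
  show "complex_of_real p = L \<xi>" if "(f \<longlongrightarrow> p) (at_left \<xi>)"
    by (rule tendsto_unique_frequently[OF AE_Icc_frequently(2)[OF ae] tendsto_of_real[OF that] l(2)])
       (use \<xi> in auto)
qed

section \<open>Measures concentrated on their atoms\<close>

text \<open>
  A partition sum is at most the integral of \<open>norm h\<close>. Finiteness makes equality of total variations informative.
\<close>

lemma total_variation_finite:
  assumes \<kappa>: "has_complex_density \<kappa> S h"
  shows "total_variation \<kappa> A < \<infinity>"
proof -
  note H = has_complex_densityD[OF \<kappa>]
  note [measurable_cong] = H(2)
  have [measurable]: "h \<in> borel_measurable borel" by (rule H)
  have "total_variation \<kappa> A \<le> (\<integral>\<^sup>+x. ennreal (norm (h x)) \<partial>S)"
    unfolding total_variation_def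
  proof (rule SUP_least, clarsimp)
    fix E :: "nat \<Rightarrow> real set" assume E: "range E \<subseteq> sets borel" "disjoint_family E"
    then have [measurable]: "E n \<in> sets borel" for n by auto
    have "ennreal (norm (\<kappa> (E n))) \<le> (\<integral>\<^sup>+x. ennreal (norm (h x)) * indicator (E n) x \<partial>S)" for n
    proof -
      have int: "integrable S (\<lambda>x. indicator (E n) x * h x)"
        by (rule integrable_bounded_mult[OF H(3), where C=1]) (auto simp: indicator_def)
      have "ennreal (norm (\<kappa> (E n))) \<le> (\<integral>\<^sup>+x. ennreal (norm (indicator (E n) x * h x)) \<partial>S)"
        by (subst H(7), simp, rule integral_norm_bound_ennreal[OF int])
      also have "\<dots> = (\<integral>\<^sup>+x. ennreal (norm (h x)) * indicator (E n) x \<partial>S)"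
        by (intro nn_integral_cong) (auto simp: indicator_def)
      finally show ?thesis .
    qed
    then have "(\<Sum>n. ennreal (norm (\<kappa> (E n)))) \<le> (\<Sum>n. \<integral>\<^sup>+x. ennreal (norm (h x)) * indicator (E n) x \<partial>S)"
      by (intro suminf_le) auto
    also have "\<dots> = (\<integral>\<^sup>+x. ennreal (norm (h x)) * indicator (\<Union>n. E n) x \<partial>S)"
      by (subst nn_integral_disjoint_family) (use E H(2) in auto)
    also have "\<dots> \<le> (\<integral>\<^sup>+x. ennreal (norm (h x)) \<partial>S)"
      by (intro nn_integral_mono) (auto simp: indicator_def)
    finally show "(\<Sum>n. ennreal (norm (\<kappa> (E n)))) \<le> (\<integral>\<^sup>+x. ennreal (norm (h x)) \<partial>S)" .
  qed
  also have "\<dots> < \<infinity>" using H(3) by (simp add: integrable_iff_bounded)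
  finally show ?thesis .
qed

text \<open>
  Any partition of \<open>A\<close> becomes a partition of \<open>A \<union> B\<close> by putting \<open>B\<close> in front.
\<close>

lemma total_variation_Un_ge:
  assumes B: "B \<in> sets borel" "A \<in> sets borel" "B \<inter> A = {}"
  shows "total_variation \<kappa> A + ennreal (norm (\<kappa> B)) \<le> total_variation \<kappa> (A \<union> B)"
proof -
  let ?P = "\<lambda>A. {E :: nat \<Rightarrow> real set. range E \<subseteq> sets borel \<and> disjoint_family E \<and> (\<Union>n. E n) = A}"
  have "(\<lambda>n::nat. if n = 0 then A else {}) \<in> ?P A"
    using B by (auto simp: disjoint_family_on_def split: if_splits)
  then have ne: "?P A \<noteq> {}" by blast
  show ?thesis
    unfolding total_variation_def[of \<kappa> A]
  proof (subst ennreal_SUP_add_left[OF ne, symmetric], rule SUP_least)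
    fix E assume E: "E \<in> ?P A"
    define E' where "E' n = (case n of 0 \<Rightarrow> B | Suc m \<Rightarrow> E m)" for n :: nat
    have "E' \<in> ?P (A \<union> B)"
    proof -
      have dj: "disjoint_family E" and un: "(\<Union>n. E n) = A" and bo: "\<And>n. E n \<in> sets borel" using E by auto
      have EB: "E m \<inter> B = {}" "B \<inter> E m = {}" for m using un B(3) by auto
      have "disjoint_family E'"
        unfolding disjoint_family_on_def
      proof (intro ballI impI)
        fix m n :: nat assume "m \<noteq> n"
        then show "E' m \<inter> E' n = {}"
          using EB disjoint_family_onD[OF dj] by (cases m; cases n) (auto simp: E'_def)
      qed
      moreover have "(\<Union>n. E' n) = A \<union> B"
      proof -
        have "(\<Union>n. E' n) = (\<Union>n\<in>insert 0 (range Suc). E' n)" by (simp only: UNIV_nat_eq[symmetric])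
        then show ?thesis using un by (auto simp: E'_def)
      qed
      moreover have "range E' \<subseteq> sets borel" using bo B(1) by (auto simp: E'_def split: nat.splits)
      ultimately show ?thesis by simp
    qed
    then have "(\<Sum>n. ennreal (norm (\<kappa> (E' n)))) \<le> total_variation \<kappa> (A \<union> B)"
      unfolding total_variation_def by (rule SUP_upper)
    moreover have "(\<Sum>n. ennreal (norm (\<kappa> (E' n)))) = ennreal (norm (\<kappa> B)) + (\<Sum>n. ennreal (norm (\<kappa> (E n))))"
      using suminf_offset[OF summableI, of "\<lambda>n. ennreal (norm (\<kappa> (E' n)))" 1] by (simp add: E'_def)
    ultimately show "(\<Sum>n. ennreal (norm (\<kappa> (E n)))) + ennreal (norm (\<kappa> B)) \<le> total_variation \<kappa> (A \<union> B)"
      by (simp add: add.commute)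
  qed
qed

text \<open>
  A Borel set \<open>B\<close> off the atoms has \<open>\<kappa> B = 0\<close>: otherwise the total variation of the line would exceed that of
  the atoms by \<open>norm (\<kappa> B)\<close>. The atoms form a Borel set, because they are atoms of the finite measure \<open>S\<close> and hence countable.
\<close>

lemma AE_atoms_of_total_variation:
  assumes \<kappa>: "has_complex_density \<kappa> S h" and tv: "total_variation \<kappa> UNIV = total_variation \<kappa> (atoms \<kappa>)"
  shows "AE x in S. h x \<noteq> 0 \<longrightarrow> x \<in> atoms \<kappa>"
proof -
  note H = has_complex_densityD[OF \<kappa>]
  note [measurable_cong] = H(2)
  have [measurable]: "h \<in> borel_measurable borel" by (rule H)
  interpret finite_measure S by (rule H)
  have "atoms \<kappa> \<subseteq> {x. measure S {x} \<noteq> 0}"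
  proof (rule ccontr)
    assume "\<not> ?thesis"
    then obtain x where x: "\<kappa> {x} \<noteq> 0" "measure S {x} = 0" by (auto simp: atoms_def)
    have "{x} \<in> null_sets S" using x(2) H(2) by (auto simp: emeasure_eq_measure null_sets_def)
    then have "AE y in S. y \<notin> {x}" by (rule AE_not_in)
    then have "(\<integral>y. indicator {x} y * h y \<partial>S) = 0"
      by (intro integral_eq_zero_AE) (auto elim!: eventually_mono)
    with H(7)[of "{x}"] x(1) show False by simp
  qed
  then have "countable (atoms \<kappa>)" using countable_support by (rule countable_subset)
  then have atoms[measurable]: "atoms \<kappa> \<in> sets borel" by (rule sets.countable[rotated]) simp
  have zero: "\<kappa> B = 0" if [measurable]: "B \<in> sets borel" and dj: "B \<inter> atoms \<kappa> = {}" for B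
  proof -
    have ins: "total_variation \<kappa> (atoms \<kappa>) + ennreal (norm (\<kappa> B)) \<le> total_variation \<kappa> (atoms \<kappa> \<union> B)"
      by (rule total_variation_Un_ge) (use dj in auto)
    \<comment> \<open>By the same lemma the total variation is monotone; the rest of the line is added as one further set.\<close>
    have rest: "total_variation \<kappa> (atoms \<kappa> \<union> B) + ennreal (norm (\<kappa> (- (atoms \<kappa> \<union> B))))
        \<le> total_variation \<kappa> ((atoms \<kappa> \<union> B) \<union> - (atoms \<kappa> \<union> B))"
      by (rule total_variation_Un_ge) auto
    have "atoms \<kappa> \<union> B \<union> - (atoms \<kappa> \<union> B) = UNIV" by blast
    from rest[unfolded this] have "total_variation \<kappa> (atoms \<kappa> \<union> B) \<le> total_variation \<kappa> UNIV"
      by (rule order_trans[OF add_increasing2[OF zero_le order_refl]])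
    from order_trans[OF ins this]
    have le: "total_variation \<kappa> (atoms \<kappa>) + ennreal (norm (\<kappa> B)) \<le> total_variation \<kappa> (atoms \<kappa>) + 0"
      unfolding tv add_0_right .
    have "ennreal (norm (\<kappa> B)) \<le> 0"
      using le total_variation_finite[OF \<kappa>, of "atoms \<kappa>"] by (subst (asm) ennreal_add_left_cancel_le) auto
    then show ?thesis by simp
  qed
  have "AE x in S. indicator (- atoms \<kappa>) x * h x = 0"
  proof (rule complex_density_unique)
    show "integrable S (\<lambda>x. indicator (- atoms \<kappa>) x * h x)"
      by (rule integrable_bounded_mult[OF H(3), where C=1]) (auto simp: indicator_def)
    fix A assume "A \<in> sets S"
    then have [measurable]: "A \<in> sets borel" using H(2) by simp
    have "(\<integral>x. indicator A x * (indicator (- atoms \<kappa>) x * h x) \<partial>S) = (\<integral>x. indicator (A - atoms \<kappa>) x * h x \<partial>S)"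
      by (intro Bochner_Integration.integral_cong) (auto simp: indicator_def)
    also have "\<dots> = \<kappa> (A - atoms \<kappa>)" by (rule H(7)[symmetric]) measurable
    also have "\<dots> = 0" by (rule zero) auto
    finally show "(\<integral>x. indicator A x * (indicator (- atoms \<kappa>) x * h x) \<partial>S) = (\<integral>x. indicator A x * 0 \<partial>S)" by simp
  qed auto
  then show ?thesis by eventually_elim (auto simp: indicator_def)
qed

section \<open>The tail of the inversion integral\<close>

text \<open>
  Integration by parts in disguise: the inner integral on the left is the mass of \<open>(t, \<infinity>)\<close>, and exchanging
  the integrals leaves the integral of \<open>iexp (y * t)\<close> over \<open>[M, min u R]\<close> for \<open>u \<ge> M\<close>.
\<close>

lemma integral_iexp_tail:
  fixes k :: "real \<Rightarrow> complex"
  assumes N: "finite_measure N" "sets N = sets borel" and k: "integrable N k" and "M \<le> R" "y \<noteq> 0"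
  shows "(\<integral>t\<in>{M..R}. iexp (y * t) * (\<integral>u. indicator {t<..} u * k u \<partial>N) \<partial>lborel) =
    (\<integral>u. indicator {M..} u * ((iexp (y * min u R) - iexp (y * M)) / (\<i> * y)) * k u \<partial>N)"
proof -
  interpret N: finite_measure N by (rule N)
  note [measurable_cong] = N(2)
  have [measurable]: "k \<in> borel_measurable borel"
    using borel_measurable_integrable[OF k] measurable_cong_sets[OF N(2) refl] by blast
  interpret pair_sigma_finite "lborel :: real measure" N ..
  have i1: "integrable lborel (\<lambda>t. indicator {M..R} t :: complex)"
  proof -
    have "integrable lborel (\<lambda>x. complex_of_real (indicator {M..R} x))"
      by (intro integrable_of_real) (simp add: emeasure_lborel_Icc_eq)
    then show ?thesis by (simp only: of_real_indicator)
  qed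
  have int: "integrable (lborel \<Otimes>\<^sub>M N) (\<lambda>(t, u). (iexp (y * t) * indicator {(t, u). t < u} (t, u)) * (indicator {M..R} t * k u))"
    by (rule integrable_product_bounded[OF _ _ i1 k, where C=1])
       (auto simp: norm_mult indicator_def intro: lborel.sigma_finite_measure_axioms N.sigma_finite_measure)
  have "(\<integral>t\<in>{M..R}. iexp (y * t) * (\<integral>u. indicator {t<..} u * k u \<partial>N) \<partial>lborel)
     = (\<integral>t. (\<integral>u. (iexp (y * t) * indicator {(t, u). t < u} (t, u)) * (indicator {M..R} t * k u) \<partial>N) \<partial>lborel)"
    unfolding set_lebesgue_integral_def
  proof (intro Bochner_Integration.integral_cong refl)
    fix t
    have "(\<integral>u. (iexp (y * t) * indicator {(t, u). t < u} (t, u)) * (indicator {M..R} t * k u) \<partial>N)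
       = (\<integral>u. (indicator {M..R} t * iexp (y * t)) * (indicator {t<..} u * k u) \<partial>N)"
      by (intro Bochner_Integration.integral_cong) (auto simp: indicator_def)
    also have "\<dots> = (indicator {M..R} t * iexp (y * t)) * (\<integral>u. indicator {t<..} u * k u \<partial>N)"
      by (rule integral_mult_right_zero)
    finally show "indicator {M..R} t *\<^sub>R (iexp (y * t) * (\<integral>u. indicator {t<..} u * k u \<partial>N)) =
      (\<integral>u. (iexp (y * t) * indicator {(t, u). t < u} (t, u)) * (indicator {M..R} t * k u) \<partial>N)"
      by (simp add: scaleR_conv_of_real of_real_indicator mult.assoc)
  qed
  also have "\<dots> = (\<integral>u. (\<integral>t. (iexp (y * t) * indicator {(t, u). t < u} (t, u)) * (indicator {M..R} t * k u) \<partial>lborel) \<partial>N)"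
    by (rule Fubini_integral[OF int, symmetric])
  also have "\<dots> = (\<integral>u. indicator {M..} u * ((iexp (y * min u R) - iexp (y * M)) / (\<i> * y)) * k u \<partial>N)"
  proof (intro Bochner_Integration.integral_cong refl)
    fix u
    have "(\<integral>t. (iexp (y * t) * indicator {(t, u). t < u} (t, u)) * (indicator {M..R} t * k u) \<partial>lborel)
       = (\<integral>t. (indicator {t. t < u} t * indicator {M..R} t) * iexp (y * t) * k u \<partial>lborel)"
      by (intro Bochner_Integration.integral_cong) (auto simp: indicator_def)
    also have "\<dots> = (\<integral>t. (indicator {t. t < u} t * indicator {M..R} t) * iexp (y * t) \<partial>lborel) * k u"
      by (rule integral_mult_left_zero)
    also have "(\<integral>t. (indicator {t. t < u} t * indicator {M..R} t) * iexp (y * t) \<partial>lborel) =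
        indicator {M..} u * ((iexp (y * min u R) - iexp (y * M)) / (\<i> * y))"
    proof (cases "M \<le> u")
      case True
      have "AE t in lborel. (indicator {t. t < u} t * indicator {M..R} t) * iexp (y * t) = indicator {M..min u R} t *\<^sub>R iexp (y * t)"
        using AE_lborel_singleton[of u] by eventually_elim (auto simp: indicator_def)
      then have "(\<integral>t. (indicator {t. t < u} t * indicator {M..R} t) * iexp (y * t) \<partial>lborel) = (\<integral>t\<in>{M..min u R}. iexp (y * t) \<partial>lborel)"
        unfolding set_lebesgue_integral_def by (intro integral_cong_AE) auto
      also have "\<dots> = (iexp (y * min u R) - iexp (y * M)) / (\<i> * y)"
        by (rule integral_iexp_Icc) (use True assms in auto)
      finally show ?thesis using True by simp
    next
      case False
      then have zero: "(indicator {t. t < u} t * indicator {M..R} t) * iexp (y * t) = 0" for t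
        by (auto simp: indicator_def)
      show ?thesis unfolding zero using False by simp
    qed
    finally show "(\<integral>t. (iexp (y * t) * indicator {(t, u). t < u} (t, u)) * (indicator {M..R} t * k u) \<partial>lborel) =
      indicator {M..} u * ((iexp (y * min u R) - iexp (y * M)) / (\<i> * y)) * k u" .
  qed
  finally show ?thesis .
qed

lemma norm_iexp_diff_quotient:
  "norm ((iexp p - iexp q) / (\<i> * complex_of_real (pi * z))) \<le> 2 / (pi * \<bar>z\<bar>)"
proof -
  have "norm (iexp p - iexp q) \<le> norm (iexp p) + norm (iexp q)" by (rule norm_triangle_ineq4)
  also have "\<dots> = 2" by simp
  finally have "norm (iexp p - iexp q) \<le> 2" .
  then show ?thesis by (simp add: norm_divide norm_mult abs_mult divide_right_mono)
qed

text \<open>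
  By Fubini the left integral is the double integral of the kernel \<open>p\<close> in which \<open>u\<close> is replaced by \<open>min u R\<close>.
  The kernels \<open>p\<close> and \<open>q\<close> agree for \<open>u \<le> R\<close>, and differ by at most \<open>2 / (\<pi> d)\<close> for \<open>u > R\<close> because
  \<open>\<bar>x - \<xi>\<bar> \<ge> d\<close> holds for almost all \<open>x\<close> that carry mass.
\<close>

lemma fourier_tail_estimate:
  assumes \<kappa>: "has_complex_density \<kappa> S h" and \<nu>: "has_complex_density \<nu> N k"
    and \<phi>: "\<And>t. M \<le> t \<Longrightarrow> \<phi> t = - \<nu> {t<..}" and "d > 0" and "M \<le> R"
    and sep: "AE x in S. h x \<noteq> 0 \<longrightarrow> d \<le> \<bar>x - \<xi>\<bar>"
  shows "norm (1 / of_real pi * (\<integral>t\<in>{M..R}. iexp (- (\<xi> * t)) * (complex_char \<kappa> t * \<phi> t) \<partial>lborel)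
     - complex_integral \<kappa> (\<lambda>x. complex_integral \<nu> (\<lambda>u. indicator {M..} u *
        ((iexp ((x - \<xi>) * M) - iexp ((x - \<xi>) * u)) / (\<i> * of_real (pi * (x - \<xi>)))))))
    \<le> 2 / (pi * d) * (\<integral>x. norm (h x) \<partial>S) * (\<integral>u. indicator {R<..} u * norm (k u) \<partial>N)"
proof -
  note H = has_complex_densityD[OF \<kappa>] and K = has_complex_densityD[OF \<nu>]
  note [measurable_cong] = H(2) K(2)
  have [measurable]: "h \<in> borel_measurable borel" "k \<in> borel_measurable borel" by (rule H K)+
  interpret S: finite_measure S by (rule H)
  interpret N: finite_measure N by (rule K)
  interpret NN: pair_sigma_finite "lborel :: real measure" S ..
  \<comment> \<open>\<open>q\<close> is the kernel of the limit, \<open>p\<close> that of the integral truncated at \<open>R\<close>.\<close>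
  define q where "q x u = indicator {M..} u * ((iexp ((x - \<xi>) * M) - iexp ((x - \<xi>) * u)) / (\<i> * of_real (pi * (x - \<xi>))))" for x u :: real
  define p where "p x u = indicator {M..} u * ((iexp ((x - \<xi>) * M) - iexp ((x - \<xi>) * min u R)) / (\<i> * of_real (pi * (x - \<xi>))))" for x u :: real
  have [measurable]: "case_prod q \<in> borel_measurable (borel \<Otimes>\<^sub>M borel)" "case_prod p \<in> borel_measurable (borel \<Otimes>\<^sub>M borel)"
    unfolding q_def p_def by measurable
  have qb: "norm (q x u) \<le> 2 / (pi * \<bar>x - \<xi>\<bar>)" and pb: "norm (p x u) \<le> 2 / (pi * \<bar>x - \<xi>\<bar>)" for x u
    unfolding q_def p_def using norm_iexp_diff_quotient[of _ _ "x - \<xi>"]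
    by (auto simp: norm_mult indicator_def simp del: of_real_mult of_real_diff)
  have ip: "integrable N (\<lambda>u. p x u * k u)" and iq: "integrable N (\<lambda>u. q x u * k u)" for x
    by (rule integrable_bounded_mult[OF K(3) _ pb] integrable_bounded_mult[OF K(3) _ qb]; measurable)+
  have inner: "complex_integral \<nu> (q x) = (\<integral>u. q x u * k u \<partial>N)" for x
    by (rule complex_integral_density_bounded[OF \<nu> _ qb]) measurable
  let ?K = "\<integral>u. norm (k u) \<partial>N"
  have bnd: "norm (\<integral>u. r u * k u \<partial>N) \<le> c * ?K" if "\<And>u. norm (r u) \<le> c" "integrable N (\<lambda>u. r u * k u)" for r c
  proof -
    have "norm (\<integral>u. r u * k u \<partial>N) \<le> (\<integral>u. c * norm (k u) \<partial>N)"
      using that K(3) by (intro Bochner_Integration.integral_norm_bound_integral) (auto simp: norm_mult mult_right_mono)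
    then show ?thesis by simp
  qed
  have le: "2 / (pi * \<bar>x - \<xi>\<bar>) \<le> 2 / (pi * d)" if "d \<le> \<bar>x - \<xi>\<bar>" for x
    using that \<open>d > 0\<close> by (intro divide_left_mono mult_left_mono mult_pos_pos) auto
  have K0: "0 \<le> ?K" by (rule integral_nonneg_AE) auto
  have outer: "integrable S (\<lambda>x. (\<integral>u. r x u * k u \<partial>N) * h x)"
    if [measurable]: "case_prod r \<in> borel_measurable (borel \<Otimes>\<^sub>M borel)" and r: "\<And>x u. norm (r x u) \<le> 2 / (pi * \<bar>x - \<xi>\<bar>)" for r
  proof (rule Bochner_Integration.integrable_bound)
    show "integrable S (\<lambda>x. (2 / (pi * d) * ?K) * norm (h x))" using H(3) by auto
    show "AE x in S. norm ((\<integral>u. r x u * k u \<partial>N) * h x) \<le> norm ((2 / (pi * d) * ?K) * norm (h x))"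
      using sep
    proof eventually_elim
      case (elim x)
      show ?case
      proof (cases "h x = 0")
        case False
        have "norm (\<integral>u. r x u * k u \<partial>N) \<le> 2 / (pi * \<bar>x - \<xi>\<bar>) * ?K"
          by (rule bnd[OF r]) (rule integrable_bounded_mult[OF K(3) _ r], measurable)
        also have "\<dots> \<le> 2 / (pi * d) * ?K"
          by (rule mult_right_mono[OF le K0]) (use elim False in auto)
        finally show ?thesis using \<open>d > 0\<close> K0
          by (simp add: norm_mult abs_mult mult_right_mono del: times_divide_eq_left)
      qed simp
    qed
  qed measurable
  have \<Theta>: "complex_integral \<kappa> (\<lambda>x. complex_integral \<nu> (q x)) = (\<integral>x. (\<integral>u. q x u * k u \<partial>N) * h x \<partial>S)"
    unfolding inner by (rule complex_integral_density[OF \<kappa>]) (measurable, rule outer[OF _ qb], measurable)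
  have LHS: "1 / of_real pi * (\<integral>t\<in>{M..R}. iexp (- (\<xi> * t)) * (complex_char \<kappa> t * \<phi> t) \<partial>lborel)
     = (\<integral>x. (\<integral>u. p x u * k u \<partial>N) * h x \<partial>S)"
  proof -
    define \<psi> where "\<psi> t = (\<integral>u. indicator {t<..} u * k u \<partial>N)" for t
    have \<psi>_alt: "\<psi> t = (\<integral>u. indicator {(t, u). t < u} (t, u) * k u \<partial>N)" for t
      unfolding \<psi>_def by (intro Bochner_Integration.integral_cong) (auto simp: indicator_def)
    have [measurable]: "\<psi> \<in> borel_measurable borel" unfolding \<psi>_alt[abs_def] by measurable
    have \<psi>b: "norm (\<psi> t) \<le> 1 * ?K" for t unfolding \<psi>_def
      by (rule bnd) (auto intro!: integrable_bounded_mult[OF K(3), where C=1] simp: indicator_def)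
    have i1: "integrable lborel (\<lambda>t. indicator {M..R} t * \<psi> t)"
      using set_integrable_iexp_bounded[of \<psi> "?K" M R 0] \<psi>b
      by (simp add: set_integrable_def scaleR_conv_of_real of_real_indicator)
    have int: "integrable (lborel \<Otimes>\<^sub>M S) (\<lambda>(t, x). iexp ((x - \<xi>) * t) * ((indicator {M..R} t * \<psi> t) * h x))"
      by (rule integrable_product_bounded[OF _ _ i1 H(3), where C=1])
         (auto intro: lborel.sigma_finite_measure_axioms S.sigma_finite_measure)
    have "(\<integral>t\<in>{M..R}. iexp (- (\<xi> * t)) * (complex_char \<kappa> t * \<phi> t) \<partial>lborel)
      = (\<integral>t. - (\<integral>x. iexp ((x - \<xi>) * t) * ((indicator {M..R} t * \<psi> t) * h x) \<partial>S) \<partial>lborel)"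
      unfolding set_lebesgue_integral_def
    proof (intro Bochner_Integration.integral_cong refl)
      fix t
      have "(\<integral>x. iexp ((x - \<xi>) * t) * ((indicator {M..R} t * \<psi> t) * h x) \<partial>S)
         = (\<integral>x. (indicator {M..R} t * \<psi> t * iexp (- (\<xi> * t))) * (iexp (t * x) * h x) \<partial>S)"
        by (intro Bochner_Integration.integral_cong refl)
           (simp add: algebra_simps exp_diff exp_minus divide_inverse)
      also have "\<dots> = (indicator {M..R} t * \<psi> t * iexp (- (\<xi> * t))) * complex_char \<kappa> t"
        unfolding complex_char_density[OF \<kappa>] by (rule integral_mult_right_zero)
      finally have "(\<integral>x. iexp ((x - \<xi>) * t) * ((indicator {M..R} t * \<psi> t) * h x) \<partial>S) =
        (indicator {M..R} t * \<psi> t * iexp (- (\<xi> * t))) * complex_char \<kappa> t" .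
      moreover have "\<phi> t = - \<psi> t" if "M \<le> t" unfolding \<phi>[OF that] \<psi>_def by (subst K(7)) auto
      ultimately show "indicator {M..R} t *\<^sub>R (iexp (- (\<xi> * t)) * (complex_char \<kappa> t * \<phi> t)) =
        - (\<integral>x. iexp ((x - \<xi>) * t) * ((indicator {M..R} t * \<psi> t) * h x) \<partial>S)"
        by (cases "t \<in> {M..R}") auto
    qed
    also have "\<dots> = - (\<integral>x. (\<integral>t. iexp ((x - \<xi>) * t) * ((indicator {M..R} t * \<psi> t) * h x) \<partial>lborel) \<partial>S)"
      by (simp only: integral_minus NN.Fubini_integral[OF int])
    also have "(\<integral>x. (\<integral>t. iexp ((x - \<xi>) * t) * ((indicator {M..R} t * \<psi> t) * h x) \<partial>lborel) \<partial>S)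
       = (\<integral>x. - (of_real pi * ((\<integral>u. p x u * k u \<partial>N) * h x)) \<partial>S)"
    proof (rule integral_cong_AE)
      show "AE x in S. (\<integral>t. iexp ((x - \<xi>) * t) * ((indicator {M..R} t * \<psi> t) * h x) \<partial>lborel)
          = - (of_real pi * ((\<integral>u. p x u * k u \<partial>N) * h x))"
        using sep
      proof eventually_elim
        case (elim x)
        show ?case
        proof (cases "h x = 0")
          case False
          with elim \<open>d > 0\<close> have y: "x - \<xi> \<noteq> 0" by auto
          have "(\<integral>t. iexp ((x - \<xi>) * t) * ((indicator {M..R} t * \<psi> t) * h x) \<partial>lborel)
            = (\<integral>t. (indicator {M..R} t *\<^sub>R (iexp ((x - \<xi>) * t) * \<psi> t)) * h x \<partial>lborel)"
            by (intro Bochner_Integration.integral_cong) (auto simp: indicator_def)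
          also have "\<dots> = (\<integral>t\<in>{M..R}. iexp ((x - \<xi>) * t) * \<psi> t \<partial>lborel) * h x"
            unfolding set_lebesgue_integral_def by (rule integral_mult_left_zero)
          also have "(\<integral>t\<in>{M..R}. iexp ((x - \<xi>) * t) * \<psi> t \<partial>lborel)
            = (\<integral>u. indicator {M..} u * ((iexp ((x - \<xi>) * min u R) - iexp ((x - \<xi>) * M)) / (\<i> * (x - \<xi>))) * k u \<partial>N)"
            unfolding \<psi>_def by (rule integral_iexp_tail[OF K(1,2,3) \<open>M \<le> R\<close> y])
          also have "\<dots> = (\<integral>u. - of_real pi * (p x u * k u) \<partial>N)"
          proof (intro Bochner_Integration.integral_cong refl)
            fix u
            have "(z - w) / (\<i> * complex_of_real v) = - of_real pi * ((w - z) / (\<i> * of_real (pi * v)))" if "v \<noteq> 0" for z w v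
              using that by (simp add: field_simps)
            from this[OF y] show "indicator {M..} u * ((iexp ((x - \<xi>) * min u R) - iexp ((x - \<xi>) * M)) / (\<i> * (x - \<xi>))) * k u = - of_real pi * (p x u * k u)"
              unfolding p_def by (simp only: mult_ac)
          qed
          also have "\<dots> = - of_real pi * (\<integral>u. p x u * k u \<partial>N)" by (rule integral_mult_right_zero)
          finally show ?thesis by (simp add: mult.assoc)
        qed simp
      qed
    qed measurable
    also have "\<dots> = - (of_real pi * (\<integral>x. (\<integral>u. p x u * k u \<partial>N) * h x \<partial>S))"
      by (simp only: integral_minus integral_mult_right_zero)
    finally show ?thesis by simp
  qed
  have "(\<integral>x. (\<integral>u. p x u * k u \<partial>N) * h x \<partial>S) - (\<integral>x. (\<integral>u. q x u * k u \<partial>N) * h x \<partial>S)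
      = (\<integral>x. (\<integral>u. p x u * k u \<partial>N) * h x - (\<integral>u. q x u * k u \<partial>N) * h x \<partial>S)"
    by (rule Bochner_Integration.integral_diff[symmetric]) (rule outer[OF _ pb] outer[OF _ qb]; measurable)+
  also have "norm \<dots> \<le> (\<integral>x. (2 / (pi * d) * (\<integral>u. indicator {R<..} u * norm (k u) \<partial>N)) * norm (h x) \<partial>S)"
  proof (rule order_trans[OF integral_norm_bound integral_mono_AE])
    show "integrable S (\<lambda>x. norm ((\<integral>u. p x u * k u \<partial>N) * h x - (\<integral>u. q x u * k u \<partial>N) * h x))"
      by (intro integrable_norm Bochner_Integration.integrable_diff outer[OF _ pb] outer[OF _ qb]; measurable)
    show "integrable S (\<lambda>x. (2 / (pi * d) * (\<integral>u. indicator {R<..} u * norm (k u) \<partial>N)) * norm (h x))" using H(3) by auto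
    show "AE x in S. norm ((\<integral>u. p x u * k u \<partial>N) * h x - (\<integral>u. q x u * k u \<partial>N) * h x)
       \<le> (2 / (pi * d) * (\<integral>u. indicator {R<..} u * norm (k u) \<partial>N)) * norm (h x)"
      using sep
    proof eventually_elim
      case (elim x)
      show ?case
      proof (cases "h x = 0")
        case False
        then have d: "d \<le> \<bar>x - \<xi>\<bar>" using elim by simp
        have iK: "integrable N (\<lambda>u. indicator {R<..} u * norm (k u))"
          using integrable_real_mult_indicator[OF _ integrable_norm[OF K(3)], of "{R<..}"] by (simp add: mult.commute)
        have "norm ((\<integral>u. p x u * k u \<partial>N) - (\<integral>u. q x u * k u \<partial>N)) = norm (\<integral>u. p x u * k u - q x u * k u \<partial>N)"
          using ip iq by simp
        also have "\<dots> \<le> (\<integral>u. 2 / (pi * d) * (indicator {R<..} u * norm (k u)) \<partial>N)"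
        proof (rule Bochner_Integration.integral_norm_bound_integral)
          show "integrable N (\<lambda>u. p x u * k u - q x u * k u)" using ip iq by simp
          show "integrable N (\<lambda>u. 2 / (pi * d) * (indicator {R<..} u * norm (k u)))" using iK by simp
          fix u
          have "norm (p x u - q x u) \<le> 2 / (pi * d) * indicator {R<..} u"
          proof (cases "R < u")
            case False
            then have "p x u = q x u" by (simp add: p_def q_def min_def)
            then show ?thesis using False by simp
          next
            case True
            then have "p x u - q x u = (iexp ((x - \<xi>) * u) - iexp ((x - \<xi>) * R)) / (\<i> * of_real (pi * (x - \<xi>)))"
              using \<open>M \<le> R\<close> unfolding p_def q_def by (simp add: diff_divide_distrib min_def del: of_real_mult of_real_diff)
            then have "norm (p x u - q x u) \<le> 2 / (pi * \<bar>x - \<xi>\<bar>)" using norm_iexp_diff_quotient by metis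
            then show ?thesis using le[OF d] True by simp
          qed
          then have "norm (p x u - q x u) * norm (k u) \<le> (2 / (pi * d) * indicator {R<..} u) * norm (k u)"
            by (rule mult_right_mono) simp
          then show "norm (p x u * k u - q x u * k u) \<le> 2 / (pi * d) * (indicator {R<..} u * norm (k u))"
            by (simp only: left_diff_distrib[symmetric] norm_mult mult.assoc)
        qed
        also have "\<dots> = 2 / (pi * d) * (\<integral>u. indicator {R<..} u * norm (k u) \<partial>N)" by simp
        finally show ?thesis
          by (simp only: left_diff_distrib[symmetric] norm_mult mult_right_mono norm_ge_zero)
      qed simp
    qed
  qed
  also have "\<dots> = 2 / (pi * d) * (\<integral>x. norm (h x) \<partial>S) * (\<integral>u. indicator {R<..} u * norm (k u) \<partial>N)" by simp
  finally show ?thesis unfolding LHS using \<Theta> unfolding q_def by simp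
qed

text \<open>
  By the symmetry of \<open>\<Phi>\<close> the integral over \<open>[-R, -M]\<close> is the conjugate of the one over \<open>[M, R]\<close>; the sum of
  the two is twice the real part.
\<close>

lemma inversion_integral_split:
  assumes [measurable]: "\<Phi> \<in> borel_measurable borel" and C: "\<And>t. norm (\<Phi> t) \<le> C"
    and herm: "\<And>t. \<Phi> (- t) = cnj (\<Phi> t)" and M: "0 \<le> M" "M \<le> R"
  shows "inversion_integral \<Phi> R x = inversion_integral \<Phi> M x
    + of_real (Re (1 / of_real pi * (\<integral>t\<in>{M..R}. iexp (- (x * t)) * \<Phi> t \<partial>lborel)))"
proof -
  let ?F = "\<lambda>t. iexp (- (x * t)) * \<Phi> t"
  have int: "set_integrable lborel {a..b} ?F" for a b
    using set_integrable_iexp_bounded[OF assms(1) C, of a b "- x"] by simp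
  have "(\<integral>t\<in>{-R..R}. ?F t \<partial>lborel) = (\<integral>t. (indicator {-R..-M} t *\<^sub>R ?F t + indicator {-M..M} t *\<^sub>R ?F t) + indicator {M..R} t *\<^sub>R ?F t \<partial>lborel)"
    unfolding set_lebesgue_integral_def
  proof (rule integral_cong_AE)
    show "AE t in lborel. indicator {-R..R} t *\<^sub>R ?F t
        = (indicator {-R..-M} t *\<^sub>R ?F t + indicator {-M..M} t *\<^sub>R ?F t) + indicator {M..R} t *\<^sub>R ?F t"
      using AE_lborel_singleton[of M] AE_lborel_singleton[of "- M"]
      by eventually_elim (use M in \<open>auto simp: indicator_def\<close>)
  qed measurable
  also have "\<dots> = (\<integral>t\<in>{-R..-M}. ?F t \<partial>lborel) + (\<integral>t\<in>{-M..M}. ?F t \<partial>lborel) + (\<integral>t\<in>{M..R}. ?F t \<partial>lborel)"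
    using int unfolding set_lebesgue_integral_def set_integrable_def by simp
  also have "(\<integral>t\<in>{-R..-M}. ?F t \<partial>lborel) = cnj (\<integral>t\<in>{M..R}. ?F t \<partial>lborel)"
  proof -
    have "(\<integral>t\<in>{-R..-M}. ?F t \<partial>lborel) = (\<integral>t. indicator {-R..-M} (- t) *\<^sub>R ?F (- t) \<partial>lborel)"
      unfolding set_lebesgue_integral_def
      using lborel_integral_real_affine[of "-1" "\<lambda>t. indicator {-R..-M} t *\<^sub>R ?F t" 0] by simp
    also have "\<dots> = (\<integral>t. cnj (indicator {M..R} t *\<^sub>R ?F t) \<partial>lborel)"
      by (intro Bochner_Integration.integral_cong refl) (auto simp: herm exp_cnj indicator_def)
    also have "\<dots> = cnj (\<integral>t\<in>{M..R}. ?F t \<partial>lborel)" unfolding set_lebesgue_integral_def by (rule Bochner_Integration.integral_cnj)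
    finally show ?thesis .
  qed
  finally have "(\<integral>t\<in>{-R..R}. ?F t \<partial>lborel) = (\<integral>t\<in>{-M..M}. ?F t \<partial>lborel) + 2 * of_real (Re (\<integral>t\<in>{M..R}. ?F t \<partial>lborel))"
    by (simp add: complex_eq_iff)
  then show ?thesis
    unfolding inversion_integral_def by (simp add: complex_eq_iff add_divide_distrib)
qed

text \<open>
  The estimate of the tail is uniform over points at distance at least \<open>d\<close> from \<open>A\<close>, and the mass of
  \<open>norm k\<close> beyond \<open>n\<close> tends to 0.
\<close>

lemma uniform_limit_inversion_integral:
  assumes \<Phi>: "\<Phi> \<in> borel_measurable borel" "\<And>t. norm (\<Phi> t) \<le> C" "\<And>t. \<Phi> (- t) = cnj (\<Phi> t)"
    and \<kappa>: "has_complex_density \<kappa> S h" and \<nu>: "has_complex_density \<nu> N k"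
    and "0 \<le> M" and \<phi>: "\<And>t. M \<le> t \<Longrightarrow> \<Phi> t = complex_char \<kappa> t * (- \<nu> {t<..})"
    and A: "AE x in S. h x \<noteq> 0 \<longrightarrow> x \<in> A" and "d > 0" and sep: "\<And>x \<xi>. x \<in> A \<Longrightarrow> \<xi> \<in> X \<Longrightarrow> d \<le> \<bar>x - \<xi>\<bar>"
  shows "uniform_limit X (\<lambda>n. inversion_integral \<Phi> (real n))
    (\<lambda>\<xi>. inversion_integral \<Phi> M \<xi> + of_real (Re (complex_integral \<kappa> (\<lambda>x. complex_integral \<nu> (\<lambda>u. indicator {M..} u *
        ((iexp ((x - \<xi>) * M) - iexp ((x - \<xi>) * u)) / (\<i> * of_real (pi * (x - \<xi>)))))))))
    sequentially"
proof (rule uniform_limitI)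
  note K = has_complex_densityD[OF \<nu>]
  note [measurable_cong] = K(2)
  have [measurable]: "k \<in> borel_measurable borel" by (rule K)
  let ?\<Theta> = "\<lambda>\<xi>. complex_integral \<kappa> (\<lambda>x. complex_integral \<nu> (\<lambda>u. indicator {M..} u *
        ((iexp ((x - \<xi>) * M) - iexp ((x - \<xi>) * u)) / (\<i> * of_real (pi * (x - \<xi>))))))"
  let ?e = "\<lambda>n. 2 / (pi * d) * (\<integral>x. norm (h x) \<partial>S) * (\<integral>u. indicator {real n<..} u * norm (k u) \<partial>N)"
  have "(\<lambda>n. \<integral>u. indicator {real n<..} u * norm (k u) \<partial>N) \<longlonglongrightarrow> (\<integral>u. 0 \<partial>N)"
  proof (rule integral_dominated_convergence[where w="\<lambda>u. norm (k u)"])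
    show "AE u in N. (\<lambda>n. indicator {real n<..} u * norm (k u)) \<longlonglongrightarrow> 0"
    proof (rule AE_I2, rule tendsto_eventually)
      fix u :: real
      obtain n0 :: nat where "u < real n0" using reals_Archimedean2 by blast
      then show "\<forall>\<^sub>F n in sequentially. indicator {real n<..} u * norm (k u) = 0"
        by (intro eventually_sequentiallyI[of n0]) (auto simp: indicator_def)
    qed
  qed (use K in \<open>auto simp: indicator_def\<close>)
  then have "?e \<longlonglongrightarrow> 2 / (pi * d) * (\<integral>x. norm (h x) \<partial>S) * (\<integral>u. 0 \<partial>N)"
    by (intro tendsto_mult tendsto_const)
  then have e0: "?e \<longlonglongrightarrow> 0" by simp
  fix e :: real assume "e > 0"
  then have "\<forall>\<^sub>F n in sequentially. ?e n < e" by (rule order_tendstoD(2)[OF e0])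
  moreover have "\<forall>\<^sub>F n in sequentially. M \<le> real n"
    using filterlim_real_sequentially unfolding filterlim_at_top by blast
  ultimately show "\<forall>\<^sub>F n in sequentially. \<forall>\<xi>\<in>X. dist (inversion_integral \<Phi> (real n) \<xi>)
      (inversion_integral \<Phi> M \<xi> + of_real (Re (?\<Theta> \<xi>))) < e"
  proof eventually_elim
    case (elim n)
    show ?case
    proof
      fix \<xi> assume "\<xi> \<in> X"
      let ?I = "1 / of_real pi * (\<integral>t\<in>{M..real n}. iexp (- (\<xi> * t)) * \<Phi> t \<partial>lborel)"
      have I: "?I = 1 / of_real pi * (\<integral>t\<in>{M..real n}. iexp (- (\<xi> * t)) * (complex_char \<kappa> t * (- \<nu> {t<..})) \<partial>lborel)"
        unfolding set_lebesgue_integral_def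
        by (intro arg_cong[where f="(*) (1 / of_real pi)"] Bochner_Integration.integral_cong refl)
           (auto simp: indicator_def \<phi>)
      have AE: "AE x in S. h x \<noteq> 0 \<longrightarrow> d \<le> \<bar>x - \<xi>\<bar>" using A by eventually_elim (use sep \<open>\<xi> \<in> X\<close> in blast)
      have "dist (inversion_integral \<Phi> (real n) \<xi>) (inversion_integral \<Phi> M \<xi> + of_real (Re (?\<Theta> \<xi>))) = \<bar>Re (?I - ?\<Theta> \<xi>)\<bar>"
        unfolding inversion_integral_split[OF \<Phi> \<open>0 \<le> M\<close> elim(2)]
        by (simp only: dist_add_cancel dist_of_real dist_real_def minus_complex.sel)
      also have "\<dots> \<le> norm (?I - ?\<Theta> \<xi>)" by (rule abs_Re_le_cmod)
      also have "\<dots> \<le> ?e n"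
        unfolding I by (rule fourier_tail_estimate[OF \<kappa> \<nu> _ \<open>d > 0\<close> elim(2) AE]) simp
      also have "\<dots> < e" by (rule elim)
      finally show "dist (inversion_integral \<Phi> (real n) \<xi>) (inversion_integral \<Phi> M \<xi> + of_real (Re (?\<Theta> \<xi>))) < e" .
    qed
  qed
qed

section \<open>The deconvolution density and its limit\<close>

lemma
  assumes "real_distribution M" "real_distribution N"
  shows real_distribution_convolution: "real_distribution (M \<star> N)"
    and char_convolution: "char (M \<star> N) t = char M t * char N t"
proof -
  interpret M: real_distribution M by fact
  interpret N: real_distribution N by fact
  interpret pair_prob_space M N ..
  have MN: "M \<star> N = distr (M \<Otimes>\<^sub>M N) borel (\<lambda>(x, y). x + y)" by (simp add: convolution_def)
  have "prob_space (M \<star> N)" unfolding MN by (rule prob_space_distr) measurable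
  then show "real_distribution (M \<star> N)"
    unfolding real_distribution_def real_distribution_axioms_def by (simp add: MN)
  \<comment> \<open>The factor \<open>1 * 1\<close> stands for the two integrable functions in the product lemma.\<close>
  have int: "integrable (M \<Otimes>\<^sub>M N) (\<lambda>(x, y). iexp (t * (x + y)) * (1 * 1))"
    by (rule integrable_product_bounded[where C=1])
       (auto intro: M.sigma_finite_measure_axioms N.sigma_finite_measure_axioms)
  have "char (M \<star> N) t = (\<integral>p. (case p of (x, y) \<Rightarrow> iexp (t * (x + y)) * (1 * 1)) \<partial>(M \<Otimes>\<^sub>M N))"
    unfolding char_def MN by (subst integral_distr) (auto simp: case_prod_beta')
  also have "\<dots> = (\<integral>x. (\<integral>y. iexp (t * (x + y)) * (1 * 1) \<partial>N) \<partial>M)"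
    by (rule integral_fst[OF int, symmetric])
  also have "\<dots> = (\<integral>x. (\<integral>y. iexp (t * x) * iexp (t * y) \<partial>N) \<partial>M)"
    by (simp add: distrib_left exp_add)
  also have "\<dots> = char M t * char N t" by (simp add: char_def)
  finally show "char (M \<star> N) t = char M t * char N t" .
qed

lemma char_minus: "char M (- t) = cnj (char M t)"
  unfolding char_def by (subst Bochner_Integration.integral_cnj[symmetric]) (simp add: exp_cnj)

text \<open>
  The inversion integrals are constant from \<open>T\<close> on, so their limit is a density; two densities that are continuous agree
  everywhere.
\<close>

lemma continuous_density_eq_inversion_integral:
  assumes M: "real_distribution M" and g: "has_density M g" "continuous_on UNIV g"
    and T: "\<And>t. T < \<bar>t\<bar> \<Longrightarrow> char M t = 0"
  shows "complex_of_real (g x) = inversion_integral (char M) T x"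
proof -
  have eq: "inversion_integral (char M) (real n) = inversion_integral (char M) T" if "T \<le> real n" for n
    unfolding inversion_integral_def set_lebesgue_integral_def
  proof (intro ext arg_cong[where f="(*) (1 / (2 * of_real pi))"] Bochner_Integration.integral_cong refl)
    fix x t
    show "indicator {- real n..real n} t *\<^sub>R (iexp (- (x * t)) * char M t) = indicator {- T..T} t *\<^sub>R (iexp (- (x * t)) * char M t)"
      using T[of t] that by (cases "T < \<bar>t\<bar>") (auto simp: indicator_def)
  qed
  have "\<forall>\<^sub>F n in sequentially. T \<le> real n"
    using filterlim_real_sequentially unfolding filterlim_at_top by blast
  then have ul: "uniform_limit {x - 1..x + 1} (\<lambda>n. inversion_integral (char M) (real n)) (inversion_integral (char M) T) sequentially"
    by (intro uniform_limitI) (auto elim!: eventually_mono simp: eq)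
  have "isCont g x" using g(2) by (simp add: continuous_on_eq_continuous_at)
  then have "(g \<longlongrightarrow> g x) (at_right x)" unfolding isCont_def by (rule tendsto_mono[OF at_le, rotated]) simp
  then show ?thesis
    by (rule one_sided_limit_of_density(1)[OF density_eq_inversion_limit(2,1)[OF M g(1) ul], rotated 2]) auto
qed

text \<open>
  Insert the inversion integral for \<open>g\<close> and exchange the integrals: the inner integral becomes the characteristic function
  of the kernel, a geometric sum with ratio \<open>1 - char \<mu>s t\<close>, whose product with \<open>char \<mu>s t\<close> telescopes.
\<close>

lemma deconv_density_eq_inversion_integral:
  assumes chi: "real_distribution chi" and \<mu>s: "real_distribution \<mu>s"
    and g: "has_density (chi \<star> \<mu>s) g" "continuous_on UNIV g"
    and T: "\<And>t. T < \<bar>t\<bar> \<Longrightarrow> char \<mu>s t = 0"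
  shows "deconv_density g \<mu>s \<xi> m = inversion_integral (\<lambda>t. char chi t * (1 - (1 - char \<mu>s t) ^ Suc m)) T \<xi>"
proof -
  interpret chi: real_distribution chi by (rule chi)
  interpret \<mu>s: real_distribution \<mu>s by (rule \<mu>s)
  define K where "K A = (\<Sum>l=0..m. convolution_power (complementary_measure \<mu>s) l A)" for A
  have f: "finite_measure \<mu>s" "sets \<mu>s = sets borel" by unfold_locales auto
  note Km = stieltjes_measure_deconv_kernel[OF f, of m, folded K_def]
  obtain S h where h: "has_complex_density K S h" using complex_measure_has_density[OF Km(1)] .
  note H = has_complex_densityD[OF h]
  note [measurable_cong] = H(2)
  have [measurable]: "h \<in> borel_measurable borel" by (rule H)
  interpret S: finite_measure S by (rule H)
  interpret pair_sigma_finite S "lborel :: real measure" ..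
  let ?P = "\<lambda>t. char chi t * char \<mu>s t"
  have gx: "complex_of_real (g x) = inversion_integral ?P T x" for x
    using continuous_density_eq_inversion_integral[OF real_distribution_convolution[OF chi \<mu>s] g, of T x] T
    by (simp add: char_convolution[OF chi \<mu>s, abs_def])
  have [measurable]: "g \<in> borel_measurable borel" using g(1) by (simp add: has_density_def)
  have "norm (?P t) \<le> 1 * 1" for t
    unfolding norm_mult by (intro mult_mono chi.cmod_char_le_1 \<mu>s.cmod_char_le_1) auto
  then have i2: "integrable lborel (\<lambda>t. indicator {-T..T} t * ?P t)"
    using set_integrable_iexp_bounded[of ?P 1 "-T" T 0]
    by (simp add: set_integrable_def scaleR_conv_of_real of_real_indicator)
  have int: "integrable (S \<Otimes>\<^sub>M lborel) (\<lambda>(x, t). iexp (- ((\<xi> - x) * t)) * (h x * (indicator {-T..T} t * ?P t)))"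
    by (rule integrable_product_bounded[OF _ _ H(3) i2, where C=1])
       (auto intro: lborel.sigma_finite_measure_axioms S.sigma_finite_measure)
  have inner: "1 / (2 * of_real pi) * (\<integral>t. iexp (- ((\<xi> - x) * t)) * (h x * (indicator {-T..T} t * ?P t)) \<partial>lborel)
      = complex_of_real (g (\<xi> - x)) * h x" for x
  proof -
    have "(\<integral>t. iexp (- ((\<xi> - x) * t)) * (h x * (indicator {-T..T} t * ?P t)) \<partial>lborel)
        = (\<integral>t. (indicator {-T..T} t *\<^sub>R (iexp (- ((\<xi> - x) * t)) * ?P t)) * h x \<partial>lborel)"
      by (intro Bochner_Integration.integral_cong refl) (simp add: indicator_def)
    also have "\<dots> = (\<integral>t\<in>{-T..T}. iexp (- ((\<xi> - x) * t)) * ?P t \<partial>lborel) * h x"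
      unfolding set_lebesgue_integral_def by (rule integral_mult_left_zero)
    finally show ?thesis unfolding gx inversion_integral_def by simp
  qed
  have "integrable S (\<lambda>x. 1 / (2 * of_real pi) * (\<integral>t. iexp (- ((\<xi> - x) * t)) * (h x * (indicator {-T..T} t * ?P t)) \<partial>lborel))"
    by (intro integrable_mult_right integrable_fst[OF int])
  then have "deconv_density g \<mu>s \<xi> m = (\<integral>x. complex_of_real (g (\<xi> - x)) * h x \<partial>S)"
    unfolding inner deconv_density_def stieltjes_integral_def Km(2)
    by (intro complex_integral_density[OF h]) auto
  also have "\<dots> = 1 / (2 * of_real pi) * (\<integral>x. (\<integral>t. iexp (- ((\<xi> - x) * t)) * (h x * (indicator {-T..T} t * ?P t)) \<partial>lborel) \<partial>S)"
    unfolding inner[symmetric] by (rule integral_mult_right_zero)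
  also have "(\<integral>x. (\<integral>t. iexp (- ((\<xi> - x) * t)) * (h x * (indicator {-T..T} t * ?P t)) \<partial>lborel) \<partial>S)
     = (\<integral>t. (\<integral>x. iexp (- ((\<xi> - x) * t)) * (h x * (indicator {-T..T} t * ?P t)) \<partial>S) \<partial>lborel)"
    by (rule Fubini_integral[OF int, symmetric])
  also have "\<dots> = (\<integral>t\<in>{-T..T}. iexp (- (\<xi> * t)) * (char chi t * (1 - (1 - char \<mu>s t) ^ Suc m)) \<partial>lborel)"
    unfolding set_lebesgue_integral_def
  proof (intro Bochner_Integration.integral_cong refl)
    fix t
    have "(\<integral>x. iexp (- ((\<xi> - x) * t)) * (h x * (indicator {-T..T} t * ?P t)) \<partial>S)
       = (\<integral>x. (indicator {-T..T} t * ?P t * iexp (- (\<xi> * t))) * (iexp (t * x) * h x) \<partial>S)"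
      by (intro Bochner_Integration.integral_cong refl)
         (simp add: algebra_simps exp_diff exp_minus divide_inverse)
    also have "\<dots> = indicator {-T..T} t * ?P t * iexp (- (\<xi> * t)) * complex_char K t"
      unfolding complex_char_density[OF h] by (rule integral_mult_right_zero)
    also have "complex_char K t = (\<Sum>l<Suc m. (1 - char \<mu>s t) ^ l)"
      unfolding Km(3) by (simp add: atLeast0AtMost lessThan_Suc_atMost)
    finally have *: "(\<integral>x. iexp (- ((\<xi> - x) * t)) * (h x * (indicator {-T..T} t * ?P t)) \<partial>S) =
      indicator {-T..T} t * ?P t * iexp (- (\<xi> * t)) * (\<Sum>l<Suc m. (1 - char \<mu>s t) ^ l)" .
    have "char \<mu>s t * (\<Sum>l<Suc m. (1 - char \<mu>s t) ^ l) = 1 - (1 - char \<mu>s t) ^ Suc m"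
      using one_diff_power_eq[of "1 - char \<mu>s t" "Suc m"] by simp
    \<comment> \<open>The geometric sum, with the common factors of both sides put back.\<close>
    from arg_cong[OF this, of "\<lambda>z. indicator {-T..T} t * iexp (- (\<xi> * t)) * (char chi t * z)"]
    show "(\<integral>x. iexp (- ((\<xi> - x) * t)) * (h x * (indicator {-T..T} t * ?P t)) \<partial>S) =
      indicator {-T..T} t *\<^sub>R (iexp (- (\<xi> * t)) * (char chi t * (1 - (1 - char \<mu>s t) ^ Suc m)))"
      unfolding * scaleR_conv_of_real of_real_indicator by (simp only: mult_ac)
  qed
  finally show ?thesis unfolding inversion_integral_def .
qed

lemma power_one_minus_tendsto:
  fixes z :: complex
  assumes "z \<in> \<real>" "0 \<le> Re z" "Re z \<le> 1"
  shows "(\<lambda>m. (1 - z) ^ Suc m) \<longlonglongrightarrow> (if z = 0 then 1 else 0)"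
proof (cases "z = 0")
  case False
  obtain p where p: "z = complex_of_real p" using assms(1) by (auto elim: Reals_cases)
  with assms(2,3) False have "0 < p" "p \<le> 1" by auto
  moreover have "norm (1 - z) = \<bar>1 - p\<bar>" unfolding p by (metis norm_of_real of_real_1 of_real_diff)
  ultimately have "norm (1 - z) < 1" by auto
  then have "(\<lambda>m. (1 - z) ^ m) \<longlonglongrightarrow> 0" by (rule LIMSEQ_power_zero)
  from LIMSEQ_Suc[OF this] show ?thesis using False by (simp del: power_Suc)
qed simp

lemma inversion_integral_tendsto:
  assumes [measurable]: "\<And>m. \<Phi> m \<in> borel_measurable borel" "\<Psi> \<in> borel_measurable borel"
    and C: "\<And>m t. norm (\<Phi> m t) \<le> C" and lim: "\<And>t. (\<lambda>m. \<Phi> m t) \<longlonglongrightarrow> \<Psi> t"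
  shows "(\<lambda>m::nat. inversion_integral (\<Phi> m) R \<xi>) \<longlonglongrightarrow> inversion_integral \<Psi> R \<xi>"
proof -
  have "(\<lambda>m. \<integral>t. indicator {-R..R} t *\<^sub>R (iexp (- (\<xi> * t)) * \<Phi> m t) \<partial>lborel) \<longlonglongrightarrow>
      (\<integral>t. indicator {-R..R} t *\<^sub>R (iexp (- (\<xi> * t)) * \<Psi> t) \<partial>lborel)"
  proof (rule integral_dominated_convergence[where w="\<lambda>t. C * indicator {-R..R} t"])
    show "integrable lborel (\<lambda>t. C * indicat_real {-R..R} t)"
      by (intro integrable_mult_right) (simp add: emeasure_lborel_Icc_eq)
    show "AE t in lborel. (\<lambda>m. indicator {-R..R} t *\<^sub>R (iexp (- (\<xi> * t)) * \<Phi> m t)) \<longlonglongrightarrow>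
        indicator {-R..R} t *\<^sub>R (iexp (- (\<xi> * t)) * \<Psi> t)"
      by (intro AE_I2 tendsto_intros lim)
  qed (auto simp: norm_mult indicator_def C)
  then show ?thesis
    unfolding inversion_integral_def set_lebesgue_integral_def by (intro tendsto_intros)
qed

lemma deconv_density_tendsto:
  assumes chi: "real_distribution chi" and \<mu>s: "real_distribution \<mu>s"
    and g: "has_density (chi \<star> \<mu>s) g" "continuous_on UNIV g"
    and P: "\<And>t. char \<mu>s t \<in> \<real>" "\<And>t. 0 \<le> Re (char \<mu>s t)" "\<And>t. Re (char \<mu>s t) \<le> 1"
    and T: "\<And>t. T < \<bar>t\<bar> \<Longrightarrow> char \<mu>s t = 0"
    and zeros: "char_zeros \<mu>s = char_zeros \<mu>"
  shows "(\<lambda>m. deconv_density g \<mu>s \<xi> m) \<longlonglongrightarrow>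
    inversion_integral (char chi) T \<xi> - fourier (theta_zeros chi \<mu> T) (- \<xi>)"
proof -
  interpret chi: real_distribution chi by (rule chi)
  interpret \<mu>s: real_distribution \<mu>s by (rule \<mu>s)
  let ?\<Psi> = "\<lambda>t. char chi t * (if char \<mu>s t = 0 then 0 else 1)"
  have dd: "deconv_density g \<mu>s \<xi> = (\<lambda>m. inversion_integral (\<lambda>t. char chi t * (1 - (1 - char \<mu>s t) ^ Suc m)) T \<xi>)"
    by (intro ext deconv_density_eq_inversion_integral[OF chi \<mu>s g T])
  have lim: "(\<lambda>m. deconv_density g \<mu>s \<xi> m) \<longlonglongrightarrow> inversion_integral ?\<Psi> T \<xi>"
    unfolding dd
  proof (rule inversion_integral_tendsto[where C=2])
    fix t
    have "(\<lambda>m. char chi t * (1 - (1 - char \<mu>s t) ^ Suc m)) \<longlonglongrightarrow> char chi t * (1 - (if char \<mu>s t = 0 then 1 else 0))"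
      by (intro tendsto_intros power_one_minus_tendsto P)
    then show "(\<lambda>m. char chi t * (1 - (1 - char \<mu>s t) ^ Suc m)) \<longlonglongrightarrow> ?\<Psi> t"
      by (simp split: if_splits)
    fix m
    obtain p where p: "char \<mu>s t = complex_of_real p" using P(1) by (auto elim: Reals_cases)
    have "norm (1 - char \<mu>s t) = \<bar>1 - p\<bar>" unfolding p by (metis norm_of_real of_real_1 of_real_diff)
    then have "norm (1 - char \<mu>s t) \<le> 1" using P(2,3)[of t] unfolding p by simp
    then have "norm ((1 - char \<mu>s t) ^ Suc m) \<le> 1" unfolding norm_power by (intro power_le_one) auto
    then have "norm (1 - (1 - char \<mu>s t) ^ Suc m) \<le> 2"
      using norm_triangle_ineq4[of 1 "(1 - char \<mu>s t) ^ Suc m"] by simp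
    then show "norm (char chi t * (1 - (1 - char \<mu>s t) ^ Suc m)) \<le> 2"
      using mult_mono[OF chi.cmod_char_le_1[of t], of _ 2] unfolding norm_mult by simp
  qed measurable
  have "inversion_integral (char chi) T \<xi> - fourier (theta_zeros chi \<mu> T) (- \<xi>) = inversion_integral ?\<Psi> T \<xi>"
  proof -
    have z: "ereal t \<in> char_zeros \<mu> \<longleftrightarrow> char \<mu>s t = 0" for t
      unfolding zeros[symmetric] by (auto simp: char_zeros_def)
    have \<theta>: "fourier (theta_zeros chi \<mu> T) (- \<xi>) = 1 / (2 * of_real pi) *
        (\<integral>t\<in>{-T..T}. iexp (- (\<xi> * t)) * (char chi t * (if char \<mu>s t = 0 then 1 else 0)) \<partial>lborel)"
      unfolding fourier_def set_lebesgue_integral_def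
      by (subst integral_mult_right_zero[symmetric], intro Bochner_Integration.integral_cong refl)
         (auto simp: theta_zeros_def z indicator_def)
    have int: "set_integrable lborel {-T..T} (\<lambda>t. iexp (- (\<xi> * t)) * \<Phi> t)"
      if [measurable]: "\<Phi> \<in> borel_measurable borel" "\<And>t. norm (\<Phi> t) \<le> 1" for \<Phi>
      using set_integrable_iexp_bounded[OF that, of "-T" T "- \<xi>"] by simp
    have i1: "set_integrable lborel {-T..T} (\<lambda>t. iexp (- (\<xi> * t)) * char chi t)"
      by (rule int) (auto intro: chi.cmod_char_le_1)
    have i2: "set_integrable lborel {-T..T} (\<lambda>t. iexp (- (\<xi> * t)) * (char chi t * (if char \<mu>s t = 0 then 1 else 0)))"
      by (rule int) (auto intro: chi.cmod_char_le_1)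
    have "(\<integral>t\<in>{-T..T}. iexp (- (\<xi> * t)) * char chi t \<partial>lborel)
        - (\<integral>t\<in>{-T..T}. iexp (- (\<xi> * t)) * (char chi t * (if char \<mu>s t = 0 then 1 else 0)) \<partial>lborel)
        = (\<integral>t\<in>{-T..T}. iexp (- (\<xi> * t)) * char chi t
            - iexp (- (\<xi> * t)) * (char chi t * (if char \<mu>s t = 0 then 1 else 0)) \<partial>lborel)"
      by (rule set_integral_diff(2)[OF i1 i2, symmetric])
    also have "\<dots> = (\<integral>t\<in>{-T..T}. iexp (- (\<xi> * t)) * ?\<Psi> t \<partial>lborel)"
      unfolding set_lebesgue_integral_def by (intro Bochner_Integration.integral_cong refl) auto
    finally have "(\<integral>t\<in>{-T..T}. iexp (- (\<xi> * t)) * char chi t \<partial>lborel)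
        - (\<integral>t\<in>{-T..T}. iexp (- (\<xi> * t)) * (char chi t * (if char \<mu>s t = 0 then 1 else 0)) \<partial>lborel)
        = (\<integral>t\<in>{-T..T}. iexp (- (\<xi> * t)) * ?\<Psi> t \<partial>lborel)" .
    then show ?thesis
      unfolding \<theta> inversion_integral_def right_diff_distrib[symmetric] by simp
  qed
  with lim show ?thesis by simp
qed

text \<open>
  This accounts for the case distinction in the definition of the transform of \<open>\<psi>\<^sub>\<tau>\<^sub>,\<^sub>0\<close>: the range \<open>T \<le> \<bar>t\<bar> \<le> T0\<close>
  is not covered by the tail integral, which starts at \<open>max T0 T\<close>.
\<close>

lemma inversion_integral_max_eq:
  assumes chi: "real_distribution chi" and "0 < T"
  shows "inversion_integral (char chi) (max T0 T) \<xi> =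
    inversion_integral (char chi) T \<xi> + (if T < T0 then fourier (psi chi T0 T) (- \<xi>) else 0)"
proof (cases "T < T0")
  case True
  interpret real_distribution chi by (rule chi)
  let ?F = "\<lambda>t. iexp (- (\<xi> * t)) * char chi t"
  have int: "integrable lborel (\<lambda>t. indicator {a..b} t *\<^sub>R ?F t)" for a b
    using set_integrable_iexp_bounded[OF char_measurable cmod_char_le_1, of a b "- \<xi>"]
    by (simp add: set_integrable_def)
  have "(\<integral>t. indicator {-T0..T0} t *\<^sub>R ?F t - indicator {-T..T} t *\<^sub>R ?F t \<partial>lborel)
      = (\<integral>t. indicator {s. T \<le> \<bar>s\<bar> \<and> \<bar>s\<bar> \<le> T0} t *\<^sub>R ?F t \<partial>lborel)"
  proof (rule integral_cong_AE)
    show "AE t in lborel. indicator {-T0..T0} t *\<^sub>R ?F t - indicator {-T..T} t *\<^sub>R ?F t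
        = indicator {s. T \<le> \<bar>s\<bar> \<and> \<bar>s\<bar> \<le> T0} t *\<^sub>R ?F t"
      using AE_lborel_singleton[of T] AE_lborel_singleton[of "- T"]
      by eventually_elim (use True in \<open>auto simp: indicator_def\<close>)
  qed measurable
  then have "(\<integral>t\<in>{-T0..T0}. ?F t \<partial>lborel) = (\<integral>t\<in>{-T..T}. ?F t \<partial>lborel)
      + (\<integral>t. indicator {s. T \<le> \<bar>s\<bar> \<and> \<bar>s\<bar> \<le> T0} t *\<^sub>R ?F t \<partial>lborel)"
    using int[of "-T0" T0] int[of "-T" T] unfolding set_lebesgue_integral_def by (simp add: algebra_simps)
  moreover have "fourier (psi chi T0 T) (- \<xi>) = 1 / (2 * of_real pi) *
      (\<integral>t. indicator {s. T \<le> \<bar>s\<bar> \<and> \<bar>s\<bar> \<le> T0} t *\<^sub>R ?F t \<partial>lborel)"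
    unfolding fourier_def
    by (subst integral_mult_right_zero[symmetric], intro Bochner_Integration.integral_cong refl)
       (auto simp: psi_def indicator_def)
  ultimately show ?thesis using True by (simp add: inversion_integral_def max_def distrib_left)
qed (simp add: max_def)

lemma gap_positive_iff:
  "gap {\<xi>} A > 0 \<longleftrightarrow> (\<exists>d>0. \<forall>x\<in>A. d \<le> \<bar>x - \<xi>\<bar>)"
proof
  assume "gap {\<xi>} A > 0"
  then obtain e where e: "0 < ereal e" "ereal e < gap {\<xi>} A" using ereal_dense2 by blast
  have "e \<le> \<bar>x - \<xi>\<bar>" if "x \<in> A" for x
  proof -
    have "gap {\<xi>} A \<le> ereal \<bar>\<xi> - x\<bar>"
      unfolding gap_def using that by (intro INF_lower2[of "(\<xi>, x)"]) auto
    with e(2) have "ereal e < ereal \<bar>\<xi> - x\<bar>" by (rule less_le_trans)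
    then show ?thesis by (simp add: abs_minus_commute)
  qed
  with e(1) show "\<exists>d>0. \<forall>x\<in>A. d \<le> \<bar>x - \<xi>\<bar>" by auto
next
  assume "\<exists>d>0. \<forall>x\<in>A. d \<le> \<bar>x - \<xi>\<bar>"
  then obtain d where d: "d > 0" "\<And>x. x \<in> A \<Longrightarrow> d \<le> \<bar>x - \<xi>\<bar>" by blast
  have "ereal d \<le> gap {\<xi>} A"
    unfolding gap_def using d(2) by (intro INF_greatest) (auto simp: abs_minus_commute)
  with d(1) show "gap {\<xi>} A > 0" by (metis ereal_less(2) less_le_trans)
qed

text \<open>
  Redefine the density as \<open>L\<close> on \<open>U\<close>. Since \<open>U\<close> is covered by the countably many intervals with rational
  endpoints on which \<open>f\<close> and \<open>L\<close> agree almost everywhere, this is a change on a null set.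
\<close>

lemma density_continuous_on_open_set:
  assumes M: "has_density M f" and U: "open U"
    and loc: "\<And>\<xi>. \<xi> \<in> U \<Longrightarrow> \<exists>c d. c < \<xi> \<and> \<xi> < d \<and> continuous_on {c..d} L \<and>
        (AE x in lborel. x \<in> {c..d} \<longrightarrow> complex_of_real (f x) = L x)"
  shows "\<exists>f'. has_density M f' \<and> (\<forall>\<xi>\<in>U. isCont f' \<xi>)"
proof -
  have [measurable]: "f \<in> borel_measurable borel" using M by (simp add: has_density_def)
  have [measurable]: "U \<in> sets borel" using U by simp
  have cL: "isCont L \<xi>" if \<xi>: "\<xi> \<in> U" for \<xi>
  proof -
    obtain c d where cd: "c < \<xi>" "\<xi> < d" "continuous_on {c..d} L" using loc[OF \<xi>] by blast
    show ?thesis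
    proof (rule continuous_on_interior[OF cd(3)])
      show "\<xi> \<in> interior {c..d}" by (rule interiorI[of "{c<..<d}"]) (use cd in auto)
    qed
  qed
  define f' where "f' x = Re (indicator U x *\<^sub>R L x) + indicator (- U) x * f x" for x
  have [measurable]: "(\<lambda>x. indicator U x *\<^sub>R L x) \<in> borel_measurable borel"
    by (rule borel_measurable_continuous_on_indicator) (auto intro!: continuous_at_imp_continuous_on cL)
  have [measurable]: "f' \<in> borel_measurable borel" unfolding f'_def[abs_def] by measurable
  \<comment> \<open>Only countably many null sets may be discarded, hence the rational endpoints.\<close>
  define Q where "Q = {(p, q). p \<in> \<rat> \<and> q \<in> \<rat> \<and> (AE x in lborel. x \<in> {p..q} \<longrightarrow> complex_of_real (f x) = L x)}"
  have "countable Q"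
    by (rule countable_subset[of _ "\<rat> \<times> \<rat>"]) (auto simp: Q_def countable_rat)
  then have "AE x in lborel. \<forall>(p, q)\<in>Q. x \<in> {p..q} \<longrightarrow> complex_of_real (f x) = L x"
    by (subst AE_ball_countable) (auto simp: Q_def)
  then have ae: "AE x in lborel. f' x = f x"
  proof eventually_elim
    case (elim x)
    show ?case
    proof (cases "x \<in> U")
      case True
      obtain c d where cd: "c < x" "x < d"
        and cd_ae: "AE x in lborel. x \<in> {c..d} \<longrightarrow> complex_of_real (f x) = L x" using loc[OF True] by blast
      obtain p q where pq: "p \<in> \<rat>" "c < p" "p < x" "q \<in> \<rat>" "x < q" "q < d"
        using Rats_dense_in_real[OF cd(1)] Rats_dense_in_real[OF cd(2)] by blast
      have "(p, q) \<in> Q" unfolding Q_def using pq cd_ae by (auto elim!: eventually_mono)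
      with elim pq have "complex_of_real (f x) = L x" by auto
      then have "Re (L x) = f x" by (metis Re_complex_of_real)
      then show ?thesis using True by (simp add: f'_def)
    qed (simp add: f'_def)
  qed
  have "has_density M f'"
    unfolding has_density_def
  proof (intro conjI)
    show "AE x in lborel. 0 \<le> f' x"
      using ae M unfolding has_density_def by (auto elim: eventually_elim2)
    have "M = density lborel (\<lambda>x. ennreal (f x))" using M by (simp add: has_density_def)
    also have "\<dots> = density lborel (\<lambda>x. ennreal (f' x))"
      by (rule density_cong) (use ae in \<open>auto elim!: eventually_mono\<close>)
    finally show "M = density lborel (\<lambda>x. ennreal (f' x))" .
  qed simp
  moreover have "isCont f' \<xi>" if "\<xi> \<in> U" for \<xi>
  proof -
    have "\<forall>\<^sub>F x in nhds \<xi>. f' x = Re (L x)"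
      using eventually_nhds_in_open[OF U that] by eventually_elim (simp add: f'_def)
    then show ?thesis using cL[OF that] by (subst isCont_cong) (auto intro: continuous_Re)
  qed
  ultimately show ?thesis by blast
qed

section \<open>Limit of the deconvolution density\<close>

theorem theorem6p3:
  fixes chi \<mu> \<mu>s \<iota> :: "real measure"
    and f_chi f_chi_mus f_iota :: "real \<Rightarrow> real"
    and a T T0 :: real
    and \<kappa> :: "real set \<Rightarrow> complex"
    and \<phi> :: "ereal \<Rightarrow> complex"
  assumes "real_distribution chi"
    and "real_distribution \<mu>"
    and "symmetrization \<mu> \<mu>s"
    and "has_density chi f_chi"
    and "has_density (chi \<star> \<mu>s) f_chi_mus"
    and "continuous_on UNIV f_chi_mus"
    and "real_distribution \<iota>"
    and "has_density \<iota> f_iota"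
    and "f_iota \<in> O[at_infinity](\<lambda>x. 1 / x\<^sup>2)"
    and "integrable lborel (char \<iota>)"
    and "char \<iota> C1_differentiable_on {t. \<bar>t\<bar> > 0}"
    and "a > 2"
    and "(\<lambda>t. norm (vector_derivative (char \<iota>) (at t))) \<in> O[at_infinity](\<lambda>t. \<bar>t\<bar> powr - a)"
    and "T > 0"
    and "\<forall>t. \<bar>t\<bar> > T \<longrightarrow> char \<mu>s t = 0"
    and "T0 \<ge> 0"
    and "complex_measure \<kappa>"
    and "total_variation \<kappa> UNIV = total_variation \<kappa> (atoms \<kappa>)"
    and "continuous_on {ereal T0..\<infinity>} \<phi>"
    and "bounded_variation_on \<phi> {ereal T0..\<infinity>}"
    and "((\<lambda>t. \<phi> (ereal t)) \<longlongrightarrow> 0) at_top"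
    and "\<forall>t\<ge>T0. char chi t = complex_char \<kappa> t * \<phi> (ereal t)"
  shows "(\<exists>f. has_density chi f \<and>
            (\<forall>\<xi>. gap {\<xi>} (atoms \<kappa>) > 0 \<longrightarrow>
               (\<exists>f_plus f_minus. (f \<longlongrightarrow> f_plus) (at_right \<xi>) \<and> (f \<longlongrightarrow> f_minus) (at_left \<xi>)))) \<and>
         (\<forall>\<xi> f_plus f_minus.
            gap {\<xi>} (atoms \<kappa>) > 0 \<and> (f_chi \<longlongrightarrow> f_plus) (at_right \<xi>) \<and> (f_chi \<longlongrightarrow> f_minus) (at_left \<xi>) \<longrightarrow>
            (\<lambda>m. deconv_density f_chi_mus \<mu>s \<xi> m) \<longlonglongrightarrow>
              complex_of_real ((f_plus + f_minus) / 2)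
              - fourier (theta_zeros chi \<mu> T) (- \<xi>)
              - fourier_psi0 chi T0 \<phi> \<kappa> T (- \<xi>))"
proof -
  interpret chi: real_distribution chi by fact
  obtain \<eta> where \<eta>: "real_distribution \<eta>" "\<mu>s = (\<mu> \<star> \<eta>)"
    and P: "\<And>t. char \<mu>s t \<in> \<real>" "\<And>t. 0 \<le> Re (char \<mu>s t)" "\<And>t. Re (char \<mu>s t) \<le> 1"
    and zeros: "char_zeros \<mu>s = char_zeros \<mu>"
    using assms(3) unfolding symmetrization_def by metis
  have \<mu>s: "real_distribution \<mu>s" unfolding \<eta>(2) by (rule real_distribution_convolution[OF assms(2) \<eta>(1)])
  define \<nu> where "\<nu> = stieltjes_measure (\<lambda>u. \<phi> (ereal (max T0 u)))"
  have \<nu>: "complex_measure \<nu>" "\<And>t. T0 \<le> t \<Longrightarrow> \<nu> {t<..} = - \<phi> (ereal t)"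
    unfolding \<nu>_def using stieltjes_measure_bounded_variation[OF assms(19,20,21)] by blast+
  obtain S h where h: "has_complex_density \<kappa> S h" using complex_measure_has_density[OF assms(17)] .
  obtain N k where k: "has_complex_density \<nu> N k" using complex_measure_has_density[OF \<nu>(1)] .
  let ?M = "max T0 T"
  \<comment> \<open>The locally uniform limit of the inversion integrals, written with the starting point of the tail integral.\<close>
  define L where "L \<xi> = inversion_integral (char chi) ?M \<xi> + complex_of_real (Re (theta_tail T0 \<phi> \<kappa> T (- \<xi>)))" for \<xi>
  have L_eq: "L \<xi> = inversion_integral (char chi) T \<xi> + fourier_psi0 chi T0 \<phi> \<kappa> T (- \<xi>)" for \<xi>
    unfolding L_def fourier_psi0_def inversion_integral_max_eq[OF assms(1,14)] by simp
  have local: "\<exists>c d. c < \<xi> \<and> \<xi> < d \<and> continuous_on {c..d} L \<and>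
      (AE x in lborel. x \<in> {c..d} \<longrightarrow> complex_of_real (f_chi x) = L x)"
    if gap: "gap {\<xi>} (atoms \<kappa>) > 0" for \<xi>
  proof -
    obtain \<delta> where "\<delta> > 0" "\<forall>x\<in>atoms \<kappa>. \<delta> \<le> \<bar>x - \<xi>\<bar>"
      using gap unfolding gap_positive_iff by blast
    then have \<delta>: "\<delta> > 0" "\<And>x. x \<in> atoms \<kappa> \<Longrightarrow> \<delta> \<le> \<bar>x - \<xi>\<bar>" by auto
    \<comment> \<open>All points of this interval have distance at least \<open>\<delta>/2\<close> from the atoms.\<close>
    have ul: "uniform_limit {\<xi> - \<delta>/2..\<xi> + \<delta>/2} (\<lambda>n. inversion_integral (char chi) (real n)) L sequentially"
      unfolding L_def[abs_def] theta_tail_def stieltjes_integral_def \<nu>_def[symmetric] add_uminus_conv_diff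
    proof (rule uniform_limit_inversion_integral[OF chi.char_measurable chi.cmod_char_le_1 char_minus h k])
      show "0 \<le> ?M" using assms(16) by simp
      show "char chi t = complex_char \<kappa> t * (- \<nu> {t<..})" if "?M \<le> t" for t
        using that \<nu>(2)[of t] assms(22) by simp
      show "AE x in S. h x \<noteq> 0 \<longrightarrow> x \<in> atoms \<kappa>" by (rule AE_atoms_of_total_variation[OF h assms(18)])
      show "\<delta> / 2 > 0" using \<delta> by simp
      show "\<delta> / 2 \<le> \<bar>x - \<zeta>\<bar>" if "x \<in> atoms \<kappa>" "\<zeta> \<in> {\<xi> - \<delta>/2..\<xi> + \<delta>/2}" for x \<zeta>
        using \<delta>(2)[OF that(1)] that(2) by (auto simp: abs_if split: if_splits)
    qed
    show ?thesis
      using density_eq_inversion_limit[OF assms(1,4) ul] \<delta>(1)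
      by (intro exI[of _ "\<xi> - \<delta>/2"] exI[of _ "\<xi> + \<delta>/2"]) auto
  qed
  have "open {\<xi>. gap {\<xi>} (atoms \<kappa>) > 0}"
    unfolding open_dist
  proof (intro ballI)
    fix \<xi> assume "\<xi> \<in> {\<xi>. gap {\<xi>} (atoms \<kappa>) > 0}"
    then obtain \<delta> where \<delta>: "\<delta> > 0" "\<And>x. x \<in> atoms \<kappa> \<Longrightarrow> \<delta> \<le> \<bar>x - \<xi>\<bar>"
      unfolding gap_positive_iff by blast
    have "\<delta> / 2 \<le> \<bar>x - y\<bar>" if "x \<in> atoms \<kappa>" "dist y \<xi> < \<delta> / 2" for x y
      using \<delta>(2)[OF that(1)] that(2) by (auto simp: dist_real_def abs_if split: if_splits)
    then have "gap {y} (atoms \<kappa>) > 0" if "dist y \<xi> < \<delta> / 2" for y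
      unfolding gap_positive_iff using \<delta>(1) that by (intro exI[of _ "\<delta> / 2"]) auto
    then show "\<exists>e>0. \<forall>y. dist y \<xi> < e \<longrightarrow> y \<in> {\<xi>. gap {\<xi>} (atoms \<kappa>) > 0}"
      using \<delta>(1) by (intro exI[of _ "\<delta> / 2"]) auto
  qed
  from density_continuous_on_open_set[OF assms(4) this, of L] local
  obtain f where f: "has_density chi f" "\<And>\<xi>. gap {\<xi>} (atoms \<kappa>) > 0 \<Longrightarrow> isCont f \<xi>" by blast
  show ?thesis
  proof (intro conjI allI impI)
    have "(f \<longlongrightarrow> f \<xi>) (at_right \<xi>) \<and> (f \<longlongrightarrow> f \<xi>) (at_left \<xi>)" if "gap {\<xi>} (atoms \<kappa>) > 0" for \<xi>
      using f(2)[OF that] unfolding isCont_def by (auto intro: tendsto_mono[OF at_le])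
    with f(1) show "\<exists>f. has_density chi f \<and> (\<forall>\<xi>. gap {\<xi>} (atoms \<kappa>) > 0 \<longrightarrow>
        (\<exists>f_plus f_minus. (f \<longlongrightarrow> f_plus) (at_right \<xi>) \<and> (f \<longlongrightarrow> f_minus) (at_left \<xi>)))" by blast
  next
    fix \<xi> f_plus f_minus
    assume *: "gap {\<xi>} (atoms \<kappa>) > 0 \<and> (f_chi \<longlongrightarrow> f_plus) (at_right \<xi>) \<and> (f_chi \<longlongrightarrow> f_minus) (at_left \<xi>)"
    then obtain c d where cd: "c < \<xi>" "\<xi> < d" "continuous_on {c..d} L"
      "AE x in lborel. x \<in> {c..d} \<longrightarrow> complex_of_real (f_chi x) = L x" using local by blast
    have "complex_of_real f_plus = L \<xi>" "complex_of_real f_minus = L \<xi>"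
      using one_sided_limit_of_density[OF cd(4,3,1,2)] * by blast+
    then have avg: "complex_of_real ((f_plus + f_minus) / 2) = L \<xi>" by simp
    have "(\<lambda>m. deconv_density f_chi_mus \<mu>s \<xi> m) \<longlonglongrightarrow>
        inversion_integral (char chi) T \<xi> - fourier (theta_zeros chi \<mu> T) (- \<xi>)"
      by (rule deconv_density_tendsto[OF assms(1) \<mu>s assms(5,6) P _ zeros]) (use assms(15) in auto)
    then show "(\<lambda>m. deconv_density f_chi_mus \<mu>s \<xi> m) \<longlonglongrightarrow>
        complex_of_real ((f_plus + f_minus) / 2) - fourier (theta_zeros chi \<mu> T) (- \<xi>)
        - fourier_psi0 chi T0 \<phi> \<kappa> T (- \<xi>)"
      unfolding avg L_eq by simp
  qed
qed

end
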